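(* Let $\Omega\subset\mathbb{R}^d$ be convex and compact with nonempty interior, equipped with the Euclidean distance, let $\boldsymbol{\lambda}\in\Delta_N$ with $\lambda_i>0$ for all $i$, $\nu_1,\dots,\nu_N\in\mathcal{P}(\Omega)$, and $\nu\in\mathcal{P}(\Omega)$. Then $\nu\in\mathrm{Med}_{\boldsymbol{\lambda}}(\nu_1,\dots,\nu_N)$ if and only if there exist $(u_1,\dots,u_N)\in\mathrm{Lip}_1(\Omega)^N$ and $(\rho_1,\dots,\rho_N)\in\mathcal{M}_+(\Omega)^N$ such that for every $i=1,\dots,N$, $(u_i,\rho_i)$ solves the Monge–Kantorovich system between $\nu_i$ and $\nu$, $$\nabla\cdot(\rho_i\nabla_{\rho_i}u_i)+\nu_i=\nu,\qquad|\nabla_{\rho_i}u_i|=1\ \ \rho_i\text{-a.e.},$$ and $$\sum_{i=1}^N\lambda_iu_i\le0\ \text{on }\Omega,\qquad\sum_{i=1}^N\lambda_iu_i=0\ \text{on }\mathrm{spt}(\nu).$$ Moreover, in this case $(u_1,\dots,u_N)$ solves problem (D) and $(\rho_1\nabla_{\rho_1}u_1,\dots,\rho_N\nabla_{\rho_N}u_N,\nu)$ solves problem (B) below.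
   Context: $\Delta_N$ is the unit simplex of $\mathbb{R}^N$; $\mathcal{P}(\Omega)$ the Borel probability measures on $\Omega$, $\mathcal{M}_+(\Omega)$ the finite nonnegative Borel measures; $\mathrm{Lip}_1(\Omega)$ the 1-Lipschitz real functions on $\Omega$. $\mathrm{Med}_{\boldsymbol{\lambda}}(\nu_1,\dots,\nu_N)$ is the set of minimizers over $\mu\in\mathcal{P}(\Omega)$ of $\sum_i\lambda_iW_1(\nu_i,\mu)$ ($W_1$ the 1-Wasserstein distance). For a vector measure $\sigma\in\mathcal{M}(\Omega,\mathbb{R}^d)$ and measures $\alpha,\beta$, "$\nabla\cdot\sigma+\alpha=\beta$" means $\int_\Omega\nabla\phi\cdot d\sigma=\int_\Omega\phi\,d(\alpha-\beta)$ for all $\phi\in C^1(\Omega)$; $\mathcal{M}_{\mathrm{div}}(\Omega,\mathbb{R}^d)$ denotes vector measures whose distributional divergence is a finite measure; $|\sigma|(\Omega)$ is total variation. Monge–Kantorovich system: $(u_i,\rho_i)\in\mathrm{Lip}_1(\Omega)\times\mathcal{M}_+(\Omega)$ solves it between $\nu_i$ and $\nu$ if there exist $u_i^\varepsilon\in C^1(\Omega)\cap\mathrm{Lip}_1(\Omega)$ converging uniformly to $u_i$ as $\varepsilon\to0$ such that $\nabla u_i^\varepsilon$ converges in $L^2(\rho_i)$ to some $\hat\sigma_i$ with $\nabla\cdot(\rho_i\hat\sigma_i)+\nu_i=\nu$ and $|\hat\sigma_i|=1$ $\rho_i$-a.e.; in that case $\hat\sigma_i$ does not depend on the approximating sequence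 and is denoted $\nabla_{\rho_i}u_i$. Problem (B): minimize $\sum_{j=1}^N\lambda_j|\sigma_j|(\Omega)$ over $(\sigma_1,\dots,\sigma_N,\mu)\in\mathcal{M}_{\mathrm{div}}(\Omega,\mathbb{R}^d)^N\times\mathcal{P}(\Omega)$ subject to $\nabla\cdot\sigma_j+\nu_j=\mu$ for all $j$. Problem (D): maximize $\sum_{i=1}^N\lambda_i\int_\Omega u_i\,d\nu_i$ over $u_i\in\mathrm{Lip}_1(\Omega)$ with $\sum_i\lambda_iu_i\le0$. *)

theory Defs
  imports "HOL-Probability.Probability"
begin

definition prob_on :: "'a::euclidean_space set \<Rightarrow> 'a measure set" where
  "prob_on \<Omega> = {M. prob_space M \<and> sets M = sets borel \<and> emeasure M (- \<Omega>) = 0}"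

definition fmeas_on :: "'a::euclidean_space set \<Rightarrow> 'a measure set" where
  "fmeas_on \<Omega> = {M. finite_measure M \<and> sets M = sets borel \<and> emeasure M (- \<Omega>) = 0}"

definition couplings :: "'a::euclidean_space measure \<Rightarrow> 'a measure \<Rightarrow> ('a \<times> 'a) measure set" where
  "couplings \<mu> \<nu> = {\<gamma>. sets \<gamma> = sets (borel \<Otimes>\<^sub>M borel) \<and>
      distr \<gamma> borel fst = \<mu> \<and> distr \<gamma> borel snd = \<nu>}"

definition W1 :: "'a::euclidean_space measure \<Rightarrow> 'a measure \<Rightarrow> ennreal" where
  "W1 \<mu> \<nu> = (INF \<gamma>\<in>couplings \<mu> \<nu>. \<integral>\<^sup>+ z. ennreal (dist (fst z) (snd z)) \<partial>\<gamma>)"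

definition Med :: "'a::euclidean_space set \<Rightarrow> nat \<Rightarrow> (nat \<Rightarrow> real) \<Rightarrow> (nat \<Rightarrow> 'a measure) \<Rightarrow> 'a measure set" where
  "Med \<Omega> N lam \<nu>s = {\<mu> \<in> prob_on \<Omega>. \<forall>\<mu>'\<in>prob_on \<Omega>.
      (\<Sum>i<N. ennreal (lam i) * W1 (\<nu>s i) \<mu>) \<le> (\<Sum>i<N. ennreal (lam i) * W1 (\<nu>s i) \<mu>')}"

definition C1_grad :: "('a::euclidean_space \<Rightarrow> real) \<Rightarrow> ('a \<Rightarrow> 'a) \<Rightarrow> bool" where
  "C1_grad \<phi> G \<longleftrightarrow> (\<forall>x. (\<phi> has_derivative (\<lambda>h. G x \<bullet> h)) (at x)) \<and> continuous_on UNIV G"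

text \<open>A vector measure sigma on Omega is represented as g * m, with m a finite
  nonnegative measure on Omega and g an m-integrable Borel vector field; its
  total variation is then norm g * m.  The divergence equation
  div sigma + alpha = beta in the weak sense:\<close>

definition div_eq :: "'a::euclidean_space measure \<Rightarrow> ('a \<Rightarrow> 'a) \<Rightarrow> 'a measure \<Rightarrow> 'a measure \<Rightarrow> bool" where
  "div_eq m g \<alpha> \<beta> \<longleftrightarrow> (\<forall>\<phi> G. C1_grad \<phi> G \<longrightarrow>
      (\<integral>x. G x \<bullet> g x \<partial>m) = (\<integral>x. \<phi> x \<partial>\<alpha>) - (\<integral>x. \<phi> x \<partial>\<beta>))"

text \<open>Monge--Kantorovich system; s plays the role of the rho-gradient of u.\<close>

definition MK_witness :: "'a::euclidean_space set \<Rightarrow> ('a \<Rightarrow> real) \<Rightarrow> 'a measure \<Rightarrow> 'a measure \<Rightarrow> 'a measure \<Rightarrow> ('a \<Rightarrow> 'a) \<Rightarrow> bool" where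
  "MK_witness \<Omega> u \<rho> \<nu>i \<nu> s \<longleftrightarrow>
     s \<in> borel_measurable borel \<and>
     (\<exists>U G. (\<forall>\<epsilon>::real>0. C1_grad (U \<epsilon>) (G \<epsilon>) \<and> 1-lipschitz_on \<Omega> (U \<epsilon>)) \<and>
            uniform_limit \<Omega> U u (at_right 0) \<and>
            ((\<lambda>\<epsilon>. \<integral>\<^sup>+ x. ennreal ((norm (G \<epsilon> x - s x))\<^sup>2) \<partial>\<rho>) \<longlongrightarrow> 0) (at_right 0)) \<and>
     div_eq \<rho> s \<nu>i \<nu> \<and>
     (AE x in \<rho>. norm (s x) = 1)"

definition MK_system :: "'a::euclidean_space set \<Rightarrow> ('a \<Rightarrow> real) \<Rightarrow> 'a measure \<Rightarrow> 'a measure \<Rightarrow> 'a measure \<Rightarrow> bool" where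
  "MK_system \<Omega> u \<rho> \<nu>i \<nu> \<longleftrightarrow> (\<exists>s. MK_witness \<Omega> u \<rho> \<nu>i \<nu> s)"

definition spt :: "'a::euclidean_space measure \<Rightarrow> 'a set" where
  "spt \<mu> = {x. \<forall>e>0. emeasure \<mu> (ball x e) > 0}"

definition feasible_B :: "'a::euclidean_space set \<Rightarrow> nat \<Rightarrow> (nat \<Rightarrow> 'a measure) \<Rightarrow>
    (nat \<Rightarrow> 'a measure \<times> ('a \<Rightarrow> 'a)) \<Rightarrow> 'a measure \<Rightarrow> bool" where
  "feasible_B \<Omega> N \<nu>s \<sigma> \<mu> \<longleftrightarrow> \<mu> \<in> prob_on \<Omega> \<and>
     (\<forall>j<N. fst (\<sigma> j) \<in> fmeas_on \<Omega> \<and> snd (\<sigma> j) \<in> borel_measurable borel \<and>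
            integrable (fst (\<sigma> j)) (\<lambda>x. norm (snd (\<sigma> j) x)) \<and>
            div_eq (fst (\<sigma> j)) (snd (\<sigma> j)) (\<nu>s j) \<mu>)"

definition cost_B :: "nat \<Rightarrow> (nat \<Rightarrow> real) \<Rightarrow> (nat \<Rightarrow> 'a::euclidean_space measure \<times> ('a \<Rightarrow> 'a)) \<Rightarrow> real" where
  "cost_B N lam \<sigma> = (\<Sum>j<N. lam j * (\<integral>x. norm (snd (\<sigma> j) x) \<partial>(fst (\<sigma> j))))"

definition solves_B :: "'a::euclidean_space set \<Rightarrow> nat \<Rightarrow> (nat \<Rightarrow> real) \<Rightarrow> (nat \<Rightarrow> 'a measure) \<Rightarrow>
    (nat \<Rightarrow> 'a measure \<times> ('a \<Rightarrow> 'a)) \<Rightarrow> 'a measure \<Rightarrow> bool" where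
  "solves_B \<Omega> N lam \<nu>s \<sigma> \<mu> \<longleftrightarrow> feasible_B \<Omega> N \<nu>s \<sigma> \<mu> \<and>
     (\<forall>\<sigma>' \<mu>'. feasible_B \<Omega> N \<nu>s \<sigma>' \<mu>' \<longrightarrow> cost_B N lam \<sigma> \<le> cost_B N lam \<sigma>')"

definition feasible_D :: "'a::euclidean_space set \<Rightarrow> nat \<Rightarrow> (nat \<Rightarrow> real) \<Rightarrow> (nat \<Rightarrow> 'a \<Rightarrow> real) \<Rightarrow> bool" where
  "feasible_D \<Omega> N lam u \<longleftrightarrow> (\<forall>i<N. 1-lipschitz_on \<Omega> (u i)) \<and>
     (\<forall>x\<in>\<Omega>. (\<Sum>i<N. lam i * u i x) \<le> 0)"

definition value_D :: "'a::euclidean_space set \<Rightarrow> nat \<Rightarrow> (nat \<Rightarrow> real) \<Rightarrow> (nat \<Rightarrow> 'a measure) \<Rightarrow> (nat \<Rightarrow> 'a \<Rightarrow> real) \<Rightarrow> real" where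
  "value_D \<Omega> N lam \<nu>s u = (\<Sum>i<N. lam i * (LINT x:\<Omega>|\<nu>s i. u i x))"

definition solves_D :: "'a::euclidean_space set \<Rightarrow> nat \<Rightarrow> (nat \<Rightarrow> real) \<Rightarrow> (nat \<Rightarrow> 'a measure) \<Rightarrow> (nat \<Rightarrow> 'a \<Rightarrow> real) \<Rightarrow> bool" where
  "solves_D \<Omega> N lam \<nu>s u \<longleftrightarrow> feasible_D \<Omega> N lam u \<and>
     (\<forall>v. feasible_D \<Omega> N lam v \<longrightarrow> value_D \<Omega> N lam \<nu>s v \<le> value_D \<Omega> N lam \<nu>s u)"

end

theory Submission
  imports Defs "HOL-Complex_Analysis.Great_Picard"
begin

text \<open>Minimising the sum of the \<open>\<lambda>\<^sub>i W\<^sub>1(\<nu>\<^sub>i, \<cdot>)\<close> is a linear programme over plans with a common second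
  marginal; it has no duality gap, and its dual (D) is attained. If \<open>\<nu>\<close> is a median, optimal dual potentials are
  therefore Kantorovich potentials for each pair \<open>(\<nu>\<^sub>i, \<nu>)\<close>, and the slack \<open>\<Sum>\<lambda>\<^sub>i u\<^sub>i\<close> vanishes
  \<open>\<nu>\<close>-almost everywhere; the densities \<open>\<rho>\<^sub>i\<close> are the transport densities of optimal plans.
  Conversely, testing the divergence equation with the smooth approximations of \<open>u\<^sub>i\<close> gives
  \<open>\<rho>\<^sub>i(\<Omega>) = \<integral>u\<^sub>i d(\<nu>\<^sub>i - \<nu>)\<close>, so the mass of the flows equals the dual value and weak duality
  makes everything optimal.\<close>

section \<open>A space-filling curve\<close>

text \<open>Duality produces some optimal \<mu>, whereas the systems are wanted for the given \<nu>.
  Only the value passes from one to the other: \<nu> costs no more than \<mu>, so the potentials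
  found together with \<mu> leave no gap at \<nu>. That gap splits into one nonnegative defect per
  pair plus the nonnegative slack integral, hence each vanishes separately. Strong duality comes
  from compactness, without a separation argument. The marginal constraints are cut down to
  countably many moments by a determining sequence of test functions. A quadratic penalty on
  finitely many of them has a minimiser, and its first-order condition supplies multipliers. The
  resulting dual functions are combinations of test functions with no Lipschitz control; an
  inf-convolution with the distance makes them 1-Lipschitz without losing value. Attainment of (D)
  uses the freedom to shift the potentials by constants whose weighted sum is zero, which keeps a
  maximising sequence bounded. The curve serves weak compactness only: a measure on a compact set is
  the image of a measure on [0,1].\<close>

lemma binary_expansion:
  fixes x :: real
  assumes "0 \<le> x" "x < 1"
  shows "\<exists>a :: nat \<Rightarrow> nat. (\<forall>n. a n \<le> 1) \<and> (\<lambda>n. real (a n) / 2 ^ Suc n) sums x"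
proof -
  define F where "F n = \<lfloor>2 ^ n * x\<rfloor>" for n :: nat
  \<comment> \<open>The floor of \<open>2 ^ n * x\<close> is the integer formed by the first n
    digits; its increment after doubling is the next digit, so the partial sums telescope to
    \<open>F m / 2 ^ m\<close>.\<close>
  define a where "a n = nat (F (Suc n) - 2 * F n)" for n
  have bnd: "0 \<le> F (Suc n) - 2 * F n \<and> F (Suc n) - 2 * F n \<le> 1" for n
    unfolding F_def by (simp add: algebra_simps) linarith
  have a: "real (a n) = real_of_int (F (Suc n)) - 2 * real_of_int (F n)" for n
    using bnd[of n] by (simp add: a_def)
  have part: "(\<Sum>n<m. real (a n) / 2 ^ Suc n) = real_of_int (F m) / 2 ^ m" for m
  proof (induction m)
    case 0
    have "F 0 = 0" using assms by (simp add: F_def floor_eq_iff)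
    then show ?case by simp
  next
    case (Suc m)
    then show ?case by (simp add: a field_simps)
  qed
  have "(\<lambda>m. real_of_int (F m) / 2 ^ m) \<longlonglongrightarrow> x"
  proof (rule tendsto_sandwich[OF _ _ _ tendsto_const])
    show "\<forall>\<^sub>F m in sequentially. x - (1/2) ^ m \<le> real_of_int (F m) / 2 ^ m"
    proof (intro always_eventually allI)
      fix m :: nat
      have "2 ^ m * x - 1 \<le> real_of_int (F m)" unfolding F_def by linarith
      then have "(2 ^ m * x - 1) / 2 ^ m \<le> real_of_int (F m) / 2 ^ m"
        by (intro divide_right_mono) auto
      then show "x - (1/2) ^ m \<le> real_of_int (F m) / 2 ^ m"
        by (simp add: diff_divide_distrib power_one_over)
    qed
    show "\<forall>\<^sub>F m in sequentially. real_of_int (F m) / 2 ^ m \<le> x"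
    proof (intro always_eventually allI)
      fix m :: nat
      have "real_of_int (F m) \<le> 2 ^ m * x" unfolding F_def by linarith
      then show "real_of_int (F m) / 2 ^ m \<le> x" by (simp add: field_simps)
    qed
    have "(\<lambda>m. x - (1/2) ^ m) \<longlonglongrightarrow> x - 0"
      by (intro tendsto_intros LIMSEQ_realpow_zero) auto
    then show "(\<lambda>m. x - (1/2) ^ m) \<longlonglongrightarrow> x" by simp
  qed
  then have "(\<lambda>n. real (a n) / 2 ^ Suc n) sums x"
    unfolding sums_def part .
  moreover have "a n \<le> 1" for n using bnd[of n] unfolding a_def by linarith
  ultimately show ?thesis by blast
qed

text \<open>A continuous even function of period 2. Since cos (pi/3) = 1/2, it is constantly 0 on
  [0,1/3] and constantly 1 on [2/3,1], the two intervals left after removing the middle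
  third.\<close>

definition digit_fun :: "real \<Rightarrow> real" where
  "digit_fun t = max 0 (min 1 (1/2 - cos (pi * t)))"

text \<open>A point of the ternary Cantor set, scaled by a power of 3, exposes its digit to
  \<^const>\<open>digit_fun\<close>, because the integer part of the scaled point is even.\<close>

lemma digit_fun_cantor:
  fixes a :: "nat \<Rightarrow> nat"
  assumes a: "\<And>n. a n \<le> 1"
  shows "digit_fun (3 ^ k * (\<Sum>j. 2 * real (a j) / 3 ^ Suc j)) = real (a k)"
proof -
  define g where "g j = 2 * real (a j) / 3 ^ Suc j" for j
  have sg: "summable (\<lambda>j. 2 / 3 ^ Suc j :: real)"
    using summable_mult[OF summable_geometric[of "1/3::real"], of "2/3"]
    by (simp add: power_divide)
  have g_le: "0 \<le> g j \<and> g j \<le> 2 / 3 ^ Suc j" for j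
    using a[of j] by (auto simp: g_def field_simps)
  have sumg: "summable g"
    by (rule summable_comparison_test'[OF sg, of 0]) (use g_le in auto)
  \<comment> \<open>The tail after digit k is at most 1/3 once scaled by \<open>3 ^ k\<close>, so
    modulo 2 the scaled point stays in [0,1/3] or in [2/3,1] according to the digit.\<close>
  define R where "R = (\<Sum>j. g (j + Suc k))"
  have split: "(\<Sum>j. g j) = R + (\<Sum>j<k. g j) + g k"
    using suminf_split_initial_segment[OF sumg, of "Suc k"] by (simp add: R_def)
  have geo: "(\<lambda>j. 2 / 3 ^ Suc (j + Suc k) :: real) sums (1 / 3 ^ Suc k)"
    using sums_mult[OF geometric_sums[of "1/3::real"], of "2 / 3 ^ (k + 2)"]
    by (simp add: power_add power_divide field_simps)
  have sR: "summable (\<lambda>j. g (j + Suc k))"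
    using sumg summable_iff_shift[of g "Suc k"] by blast
  have R0: "0 \<le> R" unfolding R_def
    by (rule suminf_nonneg[OF sR]) (use g_le in auto)
  have R1: "R \<le> 1 / 3 ^ Suc k" unfolding R_def
    by (rule sums_le[OF _ summable_sums[OF sR] geo]) (use g_le in blast)
  define E where "E = (\<Sum>j<k. a j * 3 ^ (k - Suc j))"
  have E: "3 ^ k * (\<Sum>j<k. g j) = 2 * real E"
    unfolding E_def g_def sum_distrib_left of_nat_sum
  proof (rule sum.cong, simp)
    fix j assume "j \<in> {..<k}"
    then have "(3::real) ^ k = 3 ^ (k - Suc j) * 3 ^ Suc j"
      by (subst power_add[symmetric]) simp
    then show "3 ^ k * (2 * real (a j) / 3 ^ Suc j) = 2 * real (a j * 3 ^ (k - Suc j))"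
      by simp
  qed
  define r where "r = 3 ^ k * (g k + R)"
  have "3 ^ k * (\<Sum>j. g j) = r + 2 * real E"
    using E by (simp add: split r_def algebra_simps)
  then have "cos (pi * (3 ^ k * (\<Sum>j. g j))) = cos (pi * r + real E * (2 * pi))"
    by (simp add: algebra_simps)
  also have "\<dots> = cos (pi * r)"
    using cos.plus_of_nat[of "pi * r" E] by (simp add: mult_ac)
  finally have c: "cos (pi * (3 ^ k * (\<Sum>j. g j))) = cos (pi * r)" .
  have kR: "0 \<le> 3 ^ k * R" "3 ^ k * R \<le> 1/3"
    using R0 R1 by (auto simp: field_simps)
  have kg: "3 ^ k * g k = 2 * real (a k) / 3" by (simp add: g_def)
  consider "a k = 0" | "a k = 1" using a[of k] by linarith
  then have "digit_fun (3 ^ k * (\<Sum>j. g j)) = real (a k)"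
  proof cases
    case 1
    then have "0 \<le> r" "r \<le> 1/3" using kR kg by (auto simp: r_def algebra_simps)
    then have "cos (pi / 3) \<le> cos (pi * r)"
      by (intro cos_monotone_0_pi_le) (auto simp: field_simps)
    then show ?thesis using 1 by (simp add: digit_fun_def c cos_60)
  next
    case 2
    then have r: "2/3 \<le> r" "r \<le> 1" using kR kg by (auto simp: r_def algebra_simps)
    have "cos (pi * r) \<le> cos (pi - pi / 3)"
      using r by (intro cos_monotone_0_pi_le) (auto simp: field_simps)
    also have "\<dots> = - (1/2)" by (simp only: cos_pi_minus cos_60)
    finally show ?thesis using 2 by (simp add: digit_fun_def c)
  qed
  then show ?thesis by (simp add: g_def)
qed

text \<open>Schoenberg's curve: each coordinate reads its binary digits off a subsequence of the ternary
  digits of the parameter.\<close>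

lemma space_filling_curve:
  fixes K :: "'b::euclidean_space set"
  assumes "bounded K"
  shows "\<exists>q :: real \<Rightarrow> 'b. continuous_on UNIV q \<and> K \<subseteq> q ` {0..1}"
proof -
  obtain B where B: "B > 0" "\<And>x. x \<in> K \<Longrightarrow> norm x \<le> B"
    using assms by (auto simp: bounded_pos)
  define e where "e b = to_nat_on (Basis :: 'b set) b" for b
  define X where "X b t = (\<Sum>n. digit_fun (3 ^ prod_encode (e b, n) * t) / 2 ^ Suc n)" for b t
  have d01: "0 \<le> digit_fun t" "digit_fun t \<le> 1" for t by (auto simp: digit_fun_def)
  have contd: "continuous_on UNIV (\<lambda>t. digit_fun (c * t))" for c
    unfolding digit_fun_def by (intro continuous_intros)
  have contX: "continuous_on UNIV (X b)" for b
  proof -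
    have "uniform_limit UNIV (\<lambda>m t. \<Sum>n<m. digit_fun (3 ^ prod_encode (e b, n) * t) / 2 ^ Suc n)
            (X b) sequentially"
      unfolding X_def
    proof (rule Weierstrass_m_test)
      show "summable (\<lambda>n. (1/2) ^ Suc n :: real)"
        unfolding summable_Suc_iff by (rule summable_geometric) simp
    qed (use d01 in \<open>auto simp: field_simps\<close>)
    then show ?thesis
      by (rule uniform_limit_theorem[rotated])
         (auto intro!: always_eventually continuous_intros contd)
  qed
  define q where "q t = (\<Sum>b\<in>Basis. (4 * B * X b t - B) *\<^sub>R b)" for t
  have "continuous_on UNIV q"
    unfolding q_def by (intro continuous_intros contX)
  moreover have "K \<subseteq> q ` {0..1}"
  proof
    fix x assume x: "x \<in> K"
    \<comment> \<open>The inverse of the affine map in \<open>q\<close>. As coordinates lie in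
      [-B,B], the values lie in [0,1/2]; the factor 4 keeps them strictly below 1, as the binary
      expansion requires.\<close>
    define y where "y b = (x \<bullet> b + B) / (4 * B)" for b
    have y: "0 \<le> y b" "y b < 1" if "b \<in> Basis" for b
    proof -
      have "\<bar>x \<bullet> b\<bar> \<le> B" using Basis_le_norm[OF that, of x] B(2)[OF x] by linarith
      then show "0 \<le> y b" "y b < 1" using B(1) by (auto simp: y_def field_simps)
    qed
    have "\<forall>b\<in>Basis. \<exists>a :: nat \<Rightarrow> nat. (\<forall>n. a n \<le> 1) \<and> (\<lambda>n. real (a n) / 2 ^ Suc n) sums y b"
      using binary_expansion y by blast
    then obtain A where A: "\<And>b n. b \<in> Basis \<Longrightarrow> A b n \<le> (1::nat)"
        "\<And>b. b \<in> Basis \<Longrightarrow> (\<lambda>n. real (A b n) / 2 ^ Suc n) sums y b"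
      by metis
    \<comment> \<open>All coordinates are interleaved into one digit sequence. Indices beyond the
      dimension still decode to some basis vector, so every entry is a genuine bit.\<close>
    define a where "a k = (case prod_decode k of (i, n) \<Rightarrow> A (from_nat_into Basis i) n)" for k
    have a1: "a k \<le> 1" for k
      unfolding a_def using A(1) from_nat_into[of "Basis :: 'b set"]
      by (auto split: prod.split)
    have ae: "a (prod_encode (e b, n)) = A b n" if "b \<in> Basis" for b n
      using that by (simp add: a_def e_def countable_finite)
    define t where "t = (\<Sum>j. 2 * real (a j) / 3 ^ Suc j)"
    have "X b t = y b" if "b \<in> Basis" for b
    proof -
      have "digit_fun (3 ^ prod_encode (e b, n) * t) = real (A b n)" for n
        unfolding t_def by (subst digit_fun_cantor[OF a1]) (simp add: ae that)
      then show ?thesis using A(2)[OF that] by (simp add: X_def sums_iff)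
    qed
    then have "q t = (\<Sum>b\<in>Basis. (x \<bullet> b) *\<^sub>R b)"
      unfolding q_def using B(1) by (intro sum.cong) (auto simp: y_def)
    then have "q t = x" by (simp add: euclidean_representation)
    moreover have "t \<in> {0..1}"
    proof -
      have geo: "(\<lambda>j. 2 / 3 ^ Suc j :: real) sums 1"
        using sums_mult[OF geometric_sums[of "1/3::real"], of "2/3"]
        by (simp add: power_divide)
      have le: "0 \<le> 2 * real (a j) / 3 ^ Suc j" "2 * real (a j) / 3 ^ Suc j \<le> 2 / 3 ^ Suc j" for j
        using a1[of j] by (auto simp: field_simps)
      have sm: "summable (\<lambda>j. 2 * real (a j) / 3 ^ Suc j)"
        by (rule summable_comparison_test'[OF sums_summable[OF geo], of 0])
           (use le in \<open>auto simp del: power_Suc\<close>)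
      have "0 \<le> t" unfolding t_def by (rule suminf_nonneg[OF sm le(1)])
      moreover have "t \<le> 1" unfolding t_def
        by (rule sums_le[OF le(2) summable_sums[OF sm] geo])
      ultimately show ?thesis by simp
    qed
    ultimately show "x \<in> q ` {0..1}" by (metis imageI)
  qed
  ultimately show ?thesis by blast
qed

section \<open>Weak compactness of probability measures on a compact set\<close>

lemma prob_onD:
  assumes "M \<in> prob_on K"
  shows "prob_space M" "sets M = sets borel" "space M = UNIV" "emeasure M (- K) = 0"
  using assms sets_eq_imp_space_eq[of M borel] by (auto simp: prob_on_def)

lemma prob_on_nonempty:
  assumes "M \<in> prob_on \<Omega>" shows "\<Omega> \<noteq> {}"
  using prob_space.emeasure_space_1[OF prob_onD(1)[OF assms]] prob_onD(3,4)[OF assms] by auto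

lemma prob_on_AE:
  assumes "M \<in> prob_on K" "closed K"
  shows "AE x in M. x \<in> K"
  using assms
  by (intro AE_I[of _ _ "- K"]) (auto simp: prob_on_def intro: borel_open)

lemma prob_on_measurable:
  assumes "M \<in> prob_on K" "f \<in> borel_measurable borel"
  shows "f \<in> borel_measurable M"
  using assms measurable_cong_sets[of M borel borel borel] by (auto simp: prob_on_def)

lemma prob_on_integrable:
  fixes f :: "'a::euclidean_space \<Rightarrow> 'c::{banach, second_countable_topology}"
  assumes M: "M \<in> prob_on K" "compact K" and f: "continuous_on UNIV f"
  shows "integrable M f"
proof -
  interpret prob_space M using prob_onD(1)[OF M(1)] .
  have "compact (f ` K)" using compact_continuous_image continuous_on_subset f M(2) by blast
  then obtain B where B: "\<And>x. x \<in> K \<Longrightarrow> norm (f x) \<le> B"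
    using compact_imp_bounded[of "f ` K"] by (auto simp: bounded_iff)
  have "AE x in M. norm (f x) \<le> B"
    using prob_on_AE[OF M(1) compact_imp_closed[OF M(2)]] by eventually_elim (rule B)
  then show ?thesis
    by (rule integrable_const_bound)
       (rule prob_on_measurable[OF M(1) borel_measurable_continuous_onI[OF f]])
qed

lemma prob_on_distr:
  fixes M :: "'b::euclidean_space measure" and g :: "'b \<Rightarrow> 'a::euclidean_space"
  assumes M: "M \<in> prob_on K" "closed K" and g: "g \<in> borel_measurable borel"
    and im: "\<And>x. x \<in> K \<Longrightarrow> g x \<in> L" and "closed L"
  shows "distr M borel g \<in> prob_on L"
proof -
  have gM: "g \<in> borel_measurable M" by (rule prob_on_measurable[OF M(1) g])
  have "prob_space (distr M borel g)"
    using prob_space.prob_space_distr[OF prob_onD(1)[OF M(1)] gM] .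
  moreover have "AE x in distr M borel g. x \<in> L"
    using prob_on_AE[OF M] im \<open>closed L\<close>
    by (subst AE_distr_iff[OF gM]) auto
  then have "emeasure (distr M borel g) (- L) = 0"
    using \<open>closed L\<close> by (subst (asm) AE_iff_measurable[of "- L"]) (auto intro: borel_open)
  ultimately show ?thesis by (simp add: prob_on_def)
qed

text \<open>The space-filling curve transports weak sequential compactness from the real line,
  where it is Helly's theorem; measures are lifted along a Borel section of the curve.\<close>

lemma prob_on_weakly_compact:
  fixes \<mu> :: "nat \<Rightarrow> 'b::euclidean_space measure"
  assumes K: "compact K" and \<mu>: "\<And>n. \<mu> n \<in> prob_on K"
  obtains r M where "strict_mono (r :: nat \<Rightarrow> nat)" "M \<in> prob_on K"
    "\<forall>f :: 'b \<Rightarrow> real. continuous_on UNIV f \<longrightarrow>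
       (\<lambda>n. integral\<^sup>L (\<mu> (r n)) f) \<longlonglongrightarrow> integral\<^sup>L M f"
proof -
  obtain q :: "real \<Rightarrow> 'b" where q: "continuous_on UNIV q" "K \<subseteq> q ` {0..1}"
    using space_filling_curve compact_imp_bounded[OF K] by blast
  \<comment> \<open>The leftmost preimage gives a section of the curve. The extra point 2 keeps the
    set nonempty, so the infimum is attained for every x, and it marks the points off the
    curve.\<close>
  define T where "T x = {t \<in> {0..1}. q t = x} \<union> {2}" for x
  define \<tau> where "\<tau> x = Inf (T x)" for x
  have clT: "closed (T x)" for x
  proof -
    have "closed ({0..1} \<inter> q -` {x})"
      by (rule continuous_closed_preimage) (auto intro: continuous_on_subset[OF q(1)])
    moreover have "T x = ({0..1} \<inter> q -` {x}) \<union> {2}" by (auto simp: T_def)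
    ultimately show ?thesis by (simp add: closed_Un)
  qed
  have Tbd: "bdd_below (T x)" for x by (auto simp: T_def intro!: bdd_belowI[of _ 0])
  have \<tau>T: "\<tau> x \<in> T x" for x
    unfolding \<tau>_def by (rule closed_contains_Inf[OF _ Tbd clT]) (auto simp: T_def)
  have \<tau>q: "q (\<tau> x) = x" "\<tau> x \<in> {0..1}" if xK: "x \<in> K" for x
  proof -
    obtain t where t: "t \<in> {0..1}" "q t = x" using q(2) xK by auto
    have "\<tau> x \<le> t" unfolding \<tau>_def by (rule cInf_lower[OF _ Tbd]) (use t in \<open>auto simp: T_def\<close>)
    with \<tau>T[of x] t show "q (\<tau> x) = x" "\<tau> x \<in> {0..1}" by (auto simp: T_def)
  qed
  \<comment> \<open>Below level 2 a sublevel set of the leftmost preimage is the image under the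
    curve of a compact interval, hence compact.\<close>
  have \<tau>m: "\<tau> \<in> borel_measurable borel"
  proof (rule borel_measurableI_le)
    fix a :: real
    show "{x \<in> space borel. \<tau> x \<le> a} \<in> sets borel"
    proof (cases "a \<ge> 2")
      case True
      have "\<tau> x \<le> 2" for x unfolding \<tau>_def by (rule cInf_lower[OF _ Tbd]) (auto simp: T_def)
      then have "{x \<in> space borel. \<tau> x \<le> a} = UNIV" using True by (auto intro: order_trans)
      then show ?thesis by simp
    next
      case False
      have "{x \<in> space borel. \<tau> x \<le> a} = q ` ({0..1} \<inter> {..a})"
      proof safe
        fix x assume "\<tau> x \<le> a"
        with \<tau>T[of x] False show "x \<in> q ` ({0..1} \<inter> {..a})"
          by (intro image_eqI[of _ _ "\<tau> x"]) (auto simp: T_def)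
      next
        fix t :: real assume "t \<in> {0..1}" "t \<le> a"
        then show "\<tau> (q t) \<le> a"
          unfolding \<tau>_def by (intro order_trans[OF cInf_lower[OF _ Tbd]]) (auto simp: T_def)
      qed simp
      moreover have "compact (q ` ({0..1} \<inter> {..a}))"
        by (intro compact_continuous_image compact_Int_closed continuous_on_subset[OF q(1)]) auto
      ultimately show ?thesis by (simp add: borel_compact)
    qed
  qed
  have Kc: "closed K" by (rule compact_imp_closed[OF K])
  define m where "m n = distr (\<mu> n) borel \<tau>" for n
  have \<tau>n: "\<tau> \<in> borel_measurable (\<mu> n)" for n by (rule prob_on_measurable[OF \<mu> \<tau>m])
  have m: "m n \<in> prob_on {0..1}" for n
    unfolding m_def by (rule prob_on_distr[OF \<mu> Kc \<tau>m]) (use \<tau>q in auto)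
  have rd: "real_distribution (m n)" for n
    using prob_onD(1)[OF m] by (auto simp: real_distribution_def real_distribution_axioms_def m_def)
  have qd: "integral\<^sup>L (m n) (\<lambda>t. f (q t)) = integral\<^sup>L (\<mu> n) f"
    if "f \<in> borel_measurable borel" for f :: "'b \<Rightarrow> real" and n
  proof -
    have qm: "q \<in> borel_measurable borel" by (rule borel_measurable_continuous_onI[OF q(1)])
    have "integral\<^sup>L (m n) (\<lambda>t. f (q t)) = (\<integral>x. f (q (\<tau> x)) \<partial>\<mu> n)"
      unfolding m_def by (rule integral_distr[OF \<tau>n]) (use qm that in measurable)
    also have "\<dots> = integral\<^sup>L (\<mu> n) f"
    proof (rule integral_cong_AE)
      show "(\<lambda>x. f (q (\<tau> x))) \<in> borel_measurable (\<mu> n)" using qm \<tau>n that by measurable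
      show "f \<in> borel_measurable (\<mu> n)" by (rule prob_on_measurable[OF \<mu> that])
      show "AE x in \<mu> n. f (q (\<tau> x)) = f x"
        using prob_on_AE[OF \<mu> Kc] by eventually_elim (simp add: \<tau>q)
    qed
    finally show ?thesis .
  qed
  have "tight m"
    unfolding tight_def
  proof (intro conjI allI impI rd)
    fix \<epsilon> :: real assume "\<epsilon> > 0"
    have "measure (m n) {-1<..2} = 1" for n
    proof -
      interpret real_distribution "m n" by (rule rd)
      have "AE t in m n. t \<in> {-1<..2}"
        using prob_on_AE[OF m closed_atLeastAtMost] by eventually_elim auto
      then show ?thesis by (subst prob_eq_1) auto
    qed
    then show "\<exists>a b. a < b \<and> (\<forall>n. 1 - \<epsilon> < measure (m n) {a<..b})"
      using \<open>\<epsilon> > 0\<close> by (intro exI[of _ "-1"] exI[of _ 2]) auto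
  qed
  from tight_imp_convergent_subsubsequence[OF this strict_mono_id]
  obtain r M0 where r: "strict_mono (r :: nat \<Rightarrow> nat)" and M0: "real_distribution M0"
    and wc: "weak_conv_m (m \<circ> r) M0" by (auto simp: o_def)
  interpret M0: real_distribution M0 by fact
  have qm: "q \<in> borel_measurable M0"
    using borel_measurable_continuous_onI[OF q(1)] by simp
  define M where "M = distr M0 borel q"
  have pM: "prob_space M" unfolding M_def by (rule M0.prob_space_distr[OF qm])
  \<comment> \<open>Weak convergence on the line controls only bounded continuous integrands; the
    bound is removed at the end, once \<open>M\<close> is known to live on \<open>K\<close>.\<close>
  have conv: "(\<lambda>n. integral\<^sup>L (\<mu> (r n)) f) \<longlonglongrightarrow> integral\<^sup>L M f"
    if f: "continuous_on UNIV f" and B: "\<And>x. norm (f x) \<le> B" for f :: "'b \<Rightarrow> real" and B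
  proof -
    have "(\<lambda>n. integral\<^sup>L ((m \<circ> r) n) (\<lambda>t. f (q t))) \<longlonglongrightarrow> integral\<^sup>L M0 (\<lambda>t. f (q t))"
    proof (rule weak_conv_imp_integral_bdd_continuous_conv[OF _ M0 wc])
      show "real_distribution ((m \<circ> r) n)" for n using rd by simp
      have "continuous_on UNIV (\<lambda>t. f (q t))"
        using f q(1) by (rule continuous_on_compose2) auto
      then show "isCont (\<lambda>t. f (q t)) x" for x
        by (simp add: continuous_on_eq_continuous_at)
      show "norm (f (q x)) \<le> B" for x by (rule B)
    qed
    moreover have fm: "f \<in> borel_measurable borel" by (rule borel_measurable_continuous_onI[OF f])
    moreover have "integral\<^sup>L M f = integral\<^sup>L M0 (\<lambda>t. f (q t))"
      unfolding M_def by (rule integral_distr[OF qm fm])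
    ultimately show ?thesis by (simp add: qd)
  qed
  have "AE x in M. x \<in> K"
  proof (cases "K = {}")
    case True
    then have "emeasure (\<mu> 0) UNIV = 0" using prob_onD(4)[OF \<mu>, of 0] by simp
    then show ?thesis using prob_space.emeasure_space_1[OF prob_onD(1)[OF \<mu>, of 0]] prob_onD(3)[OF \<mu>]
      by simp
  next
    case False
    define f where "f x = min 1 (infdist x K)" for x
    have fc: "continuous_on UNIV f" unfolding f_def by (intro continuous_intros)
    have f0: "0 \<le> f x" "norm (f x) \<le> 1" for x by (auto simp: f_def infdist_nonneg)
    have "integral\<^sup>L (\<mu> n) f = integral\<^sup>L (\<mu> n) (\<lambda>x. 0)" for n
    proof (rule integral_cong_AE)
      show "AE x in \<mu> n. f x = 0"
        using prob_on_AE[OF \<mu> Kc] by eventually_elim (simp add: f_def)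
    qed (auto intro: prob_on_measurable[OF \<mu>] borel_measurable_continuous_onI[OF fc])
    then have "integral\<^sup>L M f = 0"
      using conv[OF fc f0(2)] by (simp add: LIMSEQ_const_iff)
    moreover have "integrable M f"
    proof -
      interpret prob_space M by fact
      have "f \<in> borel_measurable M"
        using borel_measurable_continuous_onI[OF fc] by (simp add: M_def)
      then show ?thesis by (intro integrable_const_bound[of _ 1]) (use f0 in auto)
    qed
    ultimately have "AE x in M. f x = 0"
      using integral_nonneg_eq_0_iff_AE[of M f] f0 by simp
    then show ?thesis
    proof eventually_elim
      case (elim x)
      then have "infdist x K = 0" by (auto simp: f_def min_def split: if_splits)
      then show "x \<in> K" using in_closed_iff_infdist_zero[OF Kc False] by simp
    qed
  qed
  then have "emeasure M (- K) = 0"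
    using Kc by (subst (asm) AE_iff_measurable[of "- K"]) (auto simp: M_def intro: borel_open)
  then have MK: "M \<in> prob_on K" using pM by (simp add: prob_on_def M_def)
  have "(\<lambda>n. integral\<^sup>L (\<mu> (r n)) f) \<longlonglongrightarrow> integral\<^sup>L M f"
    if f: "continuous_on UNIV f" for f :: "'b \<Rightarrow> real"
  proof -
    have "compact (f ` K)" using compact_continuous_image continuous_on_subset f K by blast
    then obtain B where B: "\<And>x. x \<in> K \<Longrightarrow> norm (f x) \<le> B"
      using compact_imp_bounded[of "f ` K"] by (auto simp: bounded_iff)
    \<comment> \<open>Truncation at a bound valid on \<open>K\<close> leaves the integral against
      every measure on \<open>K\<close> unchanged.\<close>
    define g where "g x = max (- \<bar>B\<bar>) (min \<bar>B\<bar> (f x))" for x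
    have g: "continuous_on UNIV g" unfolding g_def by (intro continuous_intros f)
    have eq: "integral\<^sup>L L f = integral\<^sup>L L g" if L: "L \<in> prob_on K" for L
    proof (rule integral_cong_AE)
      show "AE x in L. f x = g x"
        using prob_on_AE[OF L Kc]
      proof eventually_elim
        case (elim x)
        then show ?case using B[of x] by (auto simp: g_def)
      qed
    qed (auto intro: prob_on_measurable[OF L] borel_measurable_continuous_onI f g)
    have "norm (g x) \<le> \<bar>B\<bar>" for x by (auto simp: g_def)
    from conv[OF g this] show ?thesis using eq \<mu> MK by simp
  qed
  then show thesis using that[OF r MK] by blast
qed

section \<open>Duality under moment constraints\<close>

text \<open>The first-order optimality condition for a quadratic perturbation: divide by t and let t
  tend to 0 from the right.\<close>

lemma nonneg_of_quadratic_nonneg: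
  fixes P Q :: real
  assumes "\<And>t. 0 < t \<Longrightarrow> t \<le> 1 \<Longrightarrow> 0 \<le> t * P + t\<^sup>2 * Q"
  shows "0 \<le> P"
proof -
  have "((\<lambda>t. P + t * Q) \<longlongrightarrow> P + 0 * Q) (at_right 0)" by (intro tendsto_intros)
  moreover have "\<forall>\<^sub>F t in at_right 0. 0 \<le> P + t * Q"
    unfolding eventually_at_right_field
  proof (intro exI[of _ 1] conjI allI impI)
    fix t :: real assume t: "0 < t" "t < 1"
    have "t * 0 \<le> t * (P + t * Q)"
      using assms[of t] t by (simp add: algebra_simps power2_eq_square)
    then show "0 \<le> P + t * Q" using t(1) mult_le_cancel_left_pos by blast
  qed simp
  ultimately show ?thesis
    by (intro tendsto_lowerbound[of _ "P" "at_right (0::real)"]) auto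
qed

text \<open>The convex combination of \<open>M\<close> and the Dirac mass at z, realised as a law:
  toss a coin of bias t, return z on success and a sample of \<open>M\<close> otherwise. It provides
  the admissible variations of a minimiser.\<close>

lemma prob_on_mix_dirac:
  fixes M :: "'b::euclidean_space measure"
  assumes M: "M \<in> prob_on K" and K: "compact K" and z: "z \<in> K" and t: "0 \<le> t" "t \<le> 1"
  shows "\<exists>M'\<in>prob_on K. \<forall>f :: 'b \<Rightarrow> real. continuous_on UNIV f \<longrightarrow>
           integral\<^sup>L M' f = integral\<^sup>L M f + t * (f z - integral\<^sup>L M f)"
proof -
  interpret M: prob_space M by (rule prob_onD(1)[OF M])
  interpret pair_prob_space M "measure_pmf (bernoulli_pmf t)" ..
  let ?P = "M \<Otimes>\<^sub>M measure_pmf (bernoulli_pmf t)"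
  define g where "g = (\<lambda>p. if snd p then z else fst p)"
  have Mb: "sets M = sets borel" by (rule prob_onD(2)[OF M])
  have sP: "sets ?P = sets (borel \<Otimes>\<^sub>M count_space UNIV)"
    by (intro sets_pair_measure_cong Mb) simp
  have "g \<in> borel_measurable (borel \<Otimes>\<^sub>M count_space UNIV)"
    unfolding g_def by measurable
  then have g: "g \<in> borel_measurable ?P"
    using measurable_cong_sets[OF sP refl] by blast
  define M' where "M' = distr ?P borel g"
  have Kc: "closed K" by (rule compact_imp_closed[OF K])
  have "AE p in ?P. fst p \<in> K"
  proof (rule AE_pair_measure)
    show "{x \<in> space ?P. fst x \<in> K} \<in> sets ?P"
    proof -
      have "K \<in> sets M" using Kc by (simp add: Mb)
      from measurable_sets[OF measurable_fst this, of "measure_pmf (bernoulli_pmf t)"]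
      moreover have "fst -` K \<inter> space ?P = {x \<in> space ?P. fst x \<in> K}" by blast
      ultimately show ?thesis by (simp only:)
    qed
    show "AE x in M. AE y in measure_pmf (bernoulli_pmf t). fst (x, y) \<in> K"
      using prob_on_AE[OF M Kc] by eventually_elim simp
  qed
  then have "AE p in ?P. g p \<in> K" by eventually_elim (auto simp: g_def z)
  then have "AE x in M'. x \<in> K"
    unfolding M'_def using Kc by (subst AE_distr_iff[OF g]) auto
  then have "emeasure M' (- K) = 0"
    using Kc by (subst (asm) AE_iff_measurable[of "- K"]) (auto simp: M'_def intro: borel_open)
  then have "M' \<in> prob_on K"
    using prob_space_distr[OF g] by (simp add: prob_on_def M'_def)
  moreover have "integral\<^sup>L M' f = integral\<^sup>L M f + t * (f z - integral\<^sup>L M f)"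
    if f: "continuous_on UNIV f" for f :: "'b \<Rightarrow> real"
  proof -
    have fm: "f \<in> borel_measurable borel" by (rule borel_measurable_continuous_onI[OF f])
    have fi: "integrable M f" by (rule prob_on_integrable[OF M K f])
    have "integrable M' f" by (rule prob_on_integrable[OF \<open>M' \<in> prob_on K\<close> K f])
    then have "integrable ?P (\<lambda>p. f (g p))"
      unfolding M'_def using integrable_distr_eq[OF g fm] by simp
    then have "integrable ?P (\<lambda>(x, y). f (g (x, y)))" by (simp add: case_prod_beta')
    from integral_fst[OF this]
    have "integral\<^sup>L ?P (\<lambda>(x, y). f (g (x, y))) =
        (\<integral>x. (\<integral>y. f (g (x, y)) \<partial>measure_pmf (bernoulli_pmf t)) \<partial>M)" by simp
    also have "\<dots> = (\<integral>x. t * f z + (1 - t) * f x \<partial>M)"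
      using t by (simp add: g_def mult.commute)
    also have "\<dots> = t * f z + (1 - t) * integral\<^sup>L M f"
      using fi by (simp add: M.prob_space)
    finally show ?thesis
      unfolding M'_def integral_distr[OF g fm] by (simp add: case_prod_beta' algebra_simps)
  qed
  ultimately show ?thesis by blast
qed

lemma prob_on_weakly_compact_tuple:
  fixes \<mu> :: "nat \<Rightarrow> nat \<Rightarrow> 'b::euclidean_space measure"
  assumes K: "compact K" and \<mu>: "\<And>n i. i < N \<Longrightarrow> \<mu> n i \<in> prob_on K"
  shows "\<exists>r M. strict_mono (r :: nat \<Rightarrow> nat) \<and> (\<forall>i<N. M i \<in> prob_on K \<and>
    (\<forall>f :: 'b \<Rightarrow> real. continuous_on UNIV f \<longrightarrow>
       (\<lambda>n. integral\<^sup>L (\<mu> (r n) i) f) \<longlonglongrightarrow> integral\<^sup>L (M i) f))"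
  using \<mu>
proof (induction N)
  case 0
  show ?case using strict_mono_id by blast
next
  case (Suc N)
  have "\<mu> n i \<in> prob_on K" if "i < N" for n i using Suc.prems that by simp
  from Suc.IH[OF this] obtain r where "\<exists>M. strict_mono (r :: nat \<Rightarrow> nat) \<and>
    (\<forall>i<N. M i \<in> prob_on K \<and> (\<forall>f :: 'b \<Rightarrow> real. continuous_on UNIV f \<longrightarrow>
       (\<lambda>n. integral\<^sup>L (\<mu> (r n) i) f) \<longlonglongrightarrow> integral\<^sup>L (M i) f))" ..
  then obtain M where rM: "strict_mono (r :: nat \<Rightarrow> nat) \<and>
    (\<forall>i<N. M i \<in> prob_on K \<and> (\<forall>f :: 'b \<Rightarrow> real. continuous_on UNIV f \<longrightarrow>
       (\<lambda>n. integral\<^sup>L (\<mu> (r n) i) f) \<longlonglongrightarrow> integral\<^sup>L (M i) f))" ..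
  have r: "strict_mono r" using rM by simp
  have M: "M i \<in> prob_on K" if "i < N" for i using rM that by simp
  have lim: "(\<lambda>n. integral\<^sup>L (\<mu> (r n) i) f) \<longlonglongrightarrow> integral\<^sup>L (M i) f"
    if "i < N" "continuous_on UNIV f" for i and f :: "'b \<Rightarrow> real" using rM that by simp
  have "\<mu> (r n) N \<in> prob_on K" for n using Suc.prems by simp
  then obtain s L where s: "strict_mono (s :: nat \<Rightarrow> nat)" and L: "L \<in> prob_on K"
    and Llim: "\<forall>f :: 'b \<Rightarrow> real. continuous_on UNIV f \<longrightarrow>
       (\<lambda>n. integral\<^sup>L (\<mu> (r (s n)) N) f) \<longlonglongrightarrow> integral\<^sup>L L f"
    by (rule prob_on_weakly_compact[OF K])
  show ?case
  proof (intro exI[of _ "r \<circ> s"] exI[of _ "M(N := L)"] conjI allI impI)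
    show "strict_mono (r \<circ> s)" by (rule strict_mono_o[OF r s])
    fix i assume i: "i < Suc N"
    show "(M(N := L)) i \<in> prob_on K" using i M L by (cases "i = N") auto
    fix f :: "'b \<Rightarrow> real" assume f: "continuous_on UNIV f"
    show "(\<lambda>n. integral\<^sup>L (\<mu> ((r \<circ> s) n) i) f) \<longlonglongrightarrow> integral\<^sup>L ((M(N := L)) i) f"
    proof (cases "i = N")
      case True
      then show ?thesis using Llim f by simp
    next
      case False
      then have "i < N" using i by simp
      from LIMSEQ_subseq_LIMSEQ[OF lim[OF this f] s] show ?thesis using False by (simp add: o_def)
    qed
  qed
qed

text \<open>The direct method: \<open>J\<close> is nonnegative and continuous along weakly
  convergent tuples, because the costs and test functions are continuous, so a minimising sequence
  has a minimiser as limit.\<close>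

lemma prob_on_penalty_minimizer:
  fixes K :: "'b::euclidean_space set" and c :: "nat \<Rightarrow> 'b \<Rightarrow> real"
    and f :: "nat \<Rightarrow> nat \<Rightarrow> 'b \<Rightarrow> real" and b :: "nat \<Rightarrow> real" and n N :: nat
  assumes K: "compact K" and c: "\<And>i. continuous_on UNIV (c i)" "\<And>i z. z \<in> K \<Longrightarrow> 0 \<le> c i z"
    and f: "\<And>j i. continuous_on UNIV (f j i)" and \<gamma>0: "\<forall>i<N. \<gamma>0 i \<in> prob_on K" and "0 \<le> p"
  defines "J \<equiv> \<lambda>\<gamma>. (\<Sum>i<N. integral\<^sup>L (\<gamma> i) (c i)) +
     p * (\<Sum>j<n. ((\<Sum>i<N. integral\<^sup>L (\<gamma> i) (f j i)) - b j)\<^sup>2)"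
  shows "\<exists>\<gamma>. (\<forall>i<N. \<gamma> i \<in> prob_on K) \<and> (\<forall>\<gamma>'. (\<forall>i<N. \<gamma>' i \<in> prob_on K) \<longrightarrow> J \<gamma> \<le> J \<gamma>')"
proof -
  define P where "P = {\<gamma>. \<forall>i<N. \<gamma> i \<in> prob_on K}"
  have cnn: "0 \<le> integral\<^sup>L \<gamma> (c i)" if "\<gamma> \<in> prob_on K" for \<gamma> i
    using prob_on_AE[OF that compact_imp_closed[OF K]]
    by (intro integral_nonneg_AE) (auto elim: eventually_mono simp: c)
  have J0: "0 \<le> J \<gamma>" if "\<gamma> \<in> P" for \<gamma>
    unfolding J_def using cnn that \<open>0 \<le> p\<close> unfolding P_def
    by (intro add_nonneg_nonneg mult_nonneg_nonneg sum_nonneg) auto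
  have bdd: "bdd_below (J ` P)" using J0 by (auto intro!: bdd_belowI[of _ 0])
  define I where "I = Inf (J ` P)"
  have I: "I \<le> J \<gamma>" if "\<gamma> \<in> P" for \<gamma>
    unfolding I_def using that bdd by (intro cInf_lower) auto
  have "\<exists>\<gamma>\<in>P. J \<gamma> < I + 1 / Suc k" for k
  proof -
    have "Inf (J ` P) < I + 1 / Suc k" by (simp add: I_def)
    moreover have "J ` P \<noteq> {}" using \<gamma>0 by (auto simp: P_def)
    ultimately obtain y where "y \<in> J ` P" "y < I + 1 / Suc k"
      using cInf_lessD by metis
    then show ?thesis by auto
  qed
  then obtain \<mu> where \<mu>: "\<And>k. \<mu> k \<in> P" "\<And>k. J (\<mu> k) < I + 1 / Suc k" by metis
  have "\<mu> k i \<in> prob_on K" if "i < N" for k i using \<mu>(1)[of k] that by (simp add: P_def)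
  from prob_on_weakly_compact_tuple[OF K this]
  obtain r where "\<exists>\<gamma>. strict_mono (r :: nat \<Rightarrow> nat) \<and>
    (\<forall>i<N. \<gamma> i \<in> prob_on K \<and> (\<forall>f :: 'b \<Rightarrow> real. continuous_on UNIV f \<longrightarrow>
       (\<lambda>n. integral\<^sup>L (\<mu> (r n) i) f) \<longlonglongrightarrow> integral\<^sup>L (\<gamma> i) f))" ..
  then obtain \<gamma> where r\<gamma>: "strict_mono (r :: nat \<Rightarrow> nat) \<and>
    (\<forall>i<N. \<gamma> i \<in> prob_on K \<and> (\<forall>f :: 'b \<Rightarrow> real. continuous_on UNIV f \<longrightarrow>
       (\<lambda>n. integral\<^sup>L (\<mu> (r n) i) f) \<longlonglongrightarrow> integral\<^sup>L (\<gamma> i) f))" ..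
  have r: "strict_mono r" using r\<gamma> by simp
  have lim: "(\<lambda>n. integral\<^sup>L (\<mu> (r n) i) h) \<longlonglongrightarrow> integral\<^sup>L (\<gamma> i) h"
    if "i < N" "continuous_on UNIV h" for i and h :: "'b \<Rightarrow> real" using r\<gamma> that by simp
  have \<gamma>: "\<gamma> \<in> P" using r\<gamma> by (simp add: P_def)
  have "(\<lambda>k. J (\<mu> (r k))) \<longlonglongrightarrow> J \<gamma>"
    unfolding J_def by (intro tendsto_intros lim c f) auto
  moreover have "(\<lambda>k. I + 1 / Suc (r k)) \<longlonglongrightarrow> I + 0"
    using LIMSEQ_subseq_LIMSEQ[OF LIMSEQ_inverse_real_of_nat r]
    by (intro tendsto_intros) (simp add: o_def inverse_eq_divide)
  ultimately have "J \<gamma> \<le> I + 0"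
    by (rule LIMSEQ_le) (use \<mu>(2) in \<open>auto intro: less_imp_le\<close>)
  then have "J \<gamma> \<le> J \<gamma>'" if "\<gamma>' \<in> P" for \<gamma>' using I[OF that] by linarith
  then show ?thesis using \<gamma> by (intro exI[of _ \<gamma>]) (auto simp: P_def)
qed

text \<open>The first \<open>n\<close> constraints are penalised with weight \<open>n\<close>; testing a minimiser of the penalised cost
  against Dirac masses yields the multipliers, and minimisers accumulate at a feasible tuple.\<close>

lemma moment_duality:
  fixes K :: "'b::euclidean_space set" and c :: "nat \<Rightarrow> 'b \<Rightarrow> real"
    and f :: "nat \<Rightarrow> nat \<Rightarrow> 'b \<Rightarrow> real" and b :: "nat \<Rightarrow> real" and N :: nat
  assumes K: "compact K" and c: "\<And>i. continuous_on UNIV (c i)" "\<And>i z. z \<in> K \<Longrightarrow> 0 \<le> c i z"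
    and f: "\<And>j i. continuous_on UNIV (f j i)"
    and \<gamma>0: "\<forall>i<N. \<gamma>0 i \<in> prob_on K" "\<And>j. (\<Sum>i<N. integral\<^sup>L (\<gamma>0 i) (f j i)) = b j"
  obtains \<gamma> where "\<forall>i<N. \<gamma> i \<in> prob_on K" "\<forall>j. (\<Sum>i<N. integral\<^sup>L (\<gamma> i) (f j i)) = b j"
    "\<forall>\<delta>>0. \<exists>n a m. (\<forall>i<N. \<forall>z\<in>K. m i + (\<Sum>j<n. a j * f j i z) \<le> c i z) \<and>
        (\<Sum>i<N. integral\<^sup>L (\<gamma> i) (c i)) - \<delta> \<le> (\<Sum>i<N. m i) + (\<Sum>j<n. a j * b j)"
proof -
  define C where "C \<gamma> = (\<Sum>i<N. integral\<^sup>L (\<gamma> i) (c i))" for \<gamma>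
  define G where "G \<gamma> j = (\<Sum>i<N. integral\<^sup>L (\<gamma> i) (f j i))" for \<gamma> j
  define J where "J n \<gamma> = C \<gamma> + real n * (\<Sum>j<n. (G \<gamma> j - b j)\<^sup>2)" for n \<gamma>
  have "\<forall>n. \<exists>\<gamma>. (\<forall>i<N. \<gamma> i \<in> prob_on K) \<and> (\<forall>\<gamma>'. (\<forall>i<N. \<gamma>' i \<in> prob_on K) \<longrightarrow> J n \<gamma> \<le> J n \<gamma>')"
    unfolding J_def C_def G_def
    by (intro allI prob_on_penalty_minimizer[OF K c f \<gamma>0(1)]) auto
  then obtain \<mu> where *: "\<forall>n. (\<forall>i<N. \<mu> n i \<in> prob_on K) \<and>
      (\<forall>\<gamma>'. (\<forall>i<N. \<gamma>' i \<in> prob_on K) \<longrightarrow> J n (\<mu> n) \<le> J n \<gamma>')"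
    unfolding choice_iff ..
  have \<mu>: "i < N \<Longrightarrow> \<mu> n i \<in> prob_on K" "(\<forall>i<N. \<gamma>' i \<in> prob_on K) \<Longrightarrow> J n (\<mu> n) \<le> J n \<gamma>'" for n i \<gamma>'
    using * by simp_all
  have cnn: "0 \<le> integral\<^sup>L \<gamma> (c i)" if "\<gamma> \<in> prob_on K" for \<gamma> i
    using prob_on_AE[OF that compact_imp_closed[OF K]]
    by (intro integral_nonneg_AE) (auto elim: eventually_mono simp: c)
  \<comment> \<open>The multiplier of constraint j is minus the derivative of its penalty with
    respect to the moment \<open>G\<close>.\<close>
  define a where "a n j = - 2 * real n * (G (\<mu> n) j - b j)" for n j
  \<comment> \<open>The constant for which the dual inequality below becomes an equality after
    integration against \<open>\<mu> n i\<close>.\<close>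
  define m where "m n i = integral\<^sup>L (\<mu> n i) (c i) - (\<Sum>j<n. a n j * integral\<^sup>L (\<mu> n i) (f j i))" for n i
  have dual: "m n i + (\<Sum>j<n. a n j * f j i z) \<le> c i z" if z: "z \<in> K" and i: "i < N" for n i z
  proof -
    define D where "D j = G (\<mu> n) j - b j" for j
    define F where "F j = integral\<^sup>L (\<mu> n i) (f j i)" for j
    define A where "A = integral\<^sup>L (\<mu> n i) (c i)"
    \<comment> \<open>Only the i-th component is moved towards the Dirac mass at z. The moments are
      affine in t, so the penalised cost is exactly quadratic in t and its linear coefficient must
      be nonnegative.\<close>
    have "0 \<le> t * ((c i z - A) + real n * (\<Sum>j<n. 2 * D j * (f j i z - F j)))
             + t\<^sup>2 * (real n * (\<Sum>j<n. (f j i z - F j)\<^sup>2))" if t: "0 < t" "t \<le> 1" for t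
    proof -
      obtain M' where M': "M' \<in> prob_on K"
        "\<And>h :: 'b \<Rightarrow> real. continuous_on UNIV h \<Longrightarrow>
           integral\<^sup>L M' h = integral\<^sup>L (\<mu> n i) h + t * (h z - integral\<^sup>L (\<mu> n i) h)"
        using prob_on_mix_dirac[OF \<mu>(1)[OF i, of n] K z, of t] t by auto
      have upd: "(\<Sum>k<N. integral\<^sup>L (((\<mu> n)(i := M')) k) (h k)) =
          (\<Sum>k<N. integral\<^sup>L (\<mu> n k) (h k)) + t * (h i z - integral\<^sup>L (\<mu> n i) (h i))"
        if "\<And>k. continuous_on UNIV (h k)" for h :: "nat \<Rightarrow> 'b \<Rightarrow> real"
      proof -
        have "(\<Sum>k\<in>{..<N} - {i}. integral\<^sup>L (((\<mu> n)(i := M')) k) (h k))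
            = (\<Sum>k\<in>{..<N} - {i}. integral\<^sup>L (\<mu> n k) (h k))" by (intro sum.cong) auto
        then show ?thesis using i M'(2)[OF that[of i]] by (simp add: sum.remove[of "{..<N}" i])
      qed
      have e1: "C ((\<mu> n)(i := M')) = C (\<mu> n) + t * (c i z - A)"
        unfolding A_def C_def by (rule upd[OF c(1)])
      have e2: "G ((\<mu> n)(i := M')) j - b j = D j + t * (f j i z - F j)" for j
        unfolding F_def G_def D_def using upd[of "f j"] f by simp
      have "\<forall>k<N. ((\<mu> n)(i := M')) k \<in> prob_on K" using M'(1) \<mu>(1) by simp
      then have "J n (\<mu> n) \<le> J n ((\<mu> n)(i := M'))" by (rule \<mu>(2))
      then have "C (\<mu> n) + real n * (\<Sum>j<n. (D j)\<^sup>2)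
          \<le> C (\<mu> n) + t * (c i z - A) + real n * (\<Sum>j<n. (D j + t * (f j i z - F j))\<^sup>2)"
        unfolding J_def e1 e2 by (simp add: D_def)
      also have "(\<Sum>j<n. (D j + t * (f j i z - F j))\<^sup>2)
         = (\<Sum>j<n. (D j)\<^sup>2) + t * (\<Sum>j<n. 2 * D j * (f j i z - F j))
            + t\<^sup>2 * (\<Sum>j<n. (f j i z - F j)\<^sup>2)"
        unfolding sum_distrib_left sum.distrib[symmetric]
        by (intro sum.cong refl) (simp add: power2_eq_square algebra_simps)
      finally show ?thesis by (simp add: algebra_simps)
    qed
    then have "0 \<le> (c i z - A) + real n * (\<Sum>j<n. 2 * D j * (f j i z - F j))"
      by (rule nonneg_of_quadratic_nonneg)
    also have "real n * (\<Sum>j<n. 2 * D j * (f j i z - F j))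
        = (\<Sum>j<n. a n j * F j) - (\<Sum>j<n. a n j * f j i z)"
      unfolding sum_distrib_left sum_subtractf[symmetric]
      by (intro sum.cong refl) (simp add: a_def D_def algebra_simps)
    finally show ?thesis by (simp add: m_def A_def F_def)
  qed
  \<comment> \<open>By the choice of \<open>a\<close> and \<open>m\<close>, the dual value exceeds
    the cost of the minimiser by twice its penalty, so nothing is lost.\<close>
  have val: "C (\<mu> n) \<le> (\<Sum>i<N. m n i) + (\<Sum>j<n. a n j * b j)" for n
  proof -
    have "(\<Sum>i<N. m n i) = C (\<mu> n) - (\<Sum>j<n. a n j * G (\<mu> n) j)"
      unfolding m_def C_def G_def sum_subtractf sum_distrib_left
      by (subst (2) sum.swap) (rule refl)
    then have "(\<Sum>i<N. m n i) + (\<Sum>j<n. a n j * b j)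
        = C (\<mu> n) + ((\<Sum>j<n. a n j * b j) - (\<Sum>j<n. a n j * G (\<mu> n) j))" by simp
    also have "(\<Sum>j<n. a n j * b j) - (\<Sum>j<n. a n j * G (\<mu> n) j)
        = (\<Sum>j<n. 2 * real n * (G (\<mu> n) j - b j)\<^sup>2)"
      unfolding sum_subtractf[symmetric]
      by (intro sum.cong refl) (simp add: a_def power2_eq_square algebra_simps)
    finally show ?thesis by (simp add: sum_nonneg)
  qed
  from prob_on_weakly_compact_tuple[of K N \<mu>, OF K \<mu>(1)]
  obtain r where "\<exists>\<gamma>. strict_mono (r :: nat \<Rightarrow> nat) \<and>
    (\<forall>i<N. \<gamma> i \<in> prob_on K \<and> (\<forall>f :: 'b \<Rightarrow> real. continuous_on UNIV f \<longrightarrow>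
       (\<lambda>n. integral\<^sup>L (\<mu> (r n) i) f) \<longlonglongrightarrow> integral\<^sup>L (\<gamma> i) f))" ..
  then obtain \<gamma> where r\<gamma>: "strict_mono (r :: nat \<Rightarrow> nat) \<and>
    (\<forall>i<N. \<gamma> i \<in> prob_on K \<and> (\<forall>f :: 'b \<Rightarrow> real. continuous_on UNIV f \<longrightarrow>
       (\<lambda>n. integral\<^sup>L (\<mu> (r n) i) f) \<longlonglongrightarrow> integral\<^sup>L (\<gamma> i) f))" ..
  have r: "strict_mono r" using r\<gamma> by simp
  have lim: "(\<lambda>n. integral\<^sup>L (\<mu> (r n) i) h) \<longlonglongrightarrow> integral\<^sup>L (\<gamma> i) h"
    if "i < N" "continuous_on UNIV h" for i and h :: "'b \<Rightarrow> real" using r\<gamma> that by simp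
  have \<gamma>: "\<gamma> i \<in> prob_on K" if "i < N" for i using r\<gamma> that by simp
  have feas: "G \<gamma> j = b j" for j
  proof -
    \<comment> \<open>Comparison with the feasible tuple \<open>\<gamma>0\<close>, whose penalty is
      zero, makes the squared violation at most a constant over n; constraint j is penalised only
      when j < n.\<close>
    have bnd: "(G (\<mu> n) j - b j)\<^sup>2 \<le> C \<gamma>0 * (1 / real n)" if n: "j < n" for n
    proof -
      have "0 \<le> C (\<mu> n)" unfolding C_def using cnn \<mu>(1) by (intro sum_nonneg) auto
      moreover have "real n * (G (\<mu> n) j - b j)\<^sup>2 \<le> real n * (\<Sum>j<n. (G (\<mu> n) j - b j)\<^sup>2)"
        by (intro mult_left_mono member_le_sum) (use n in auto)
      moreover have "J n (\<mu> n) \<le> J n \<gamma>0" by (rule \<mu>(2)[OF \<gamma>0(1)])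
      moreover have "J n \<gamma>0 = C \<gamma>0" by (simp add: J_def \<gamma>0(2) G_def)
      ultimately have "real n * (G (\<mu> n) j - b j)\<^sup>2 \<le> C \<gamma>0" unfolding J_def by linarith
      then show ?thesis using n by (simp add: field_simps)
    qed
    have "(\<lambda>k. (G (\<mu> (r k)) j - b j)\<^sup>2) \<longlonglongrightarrow> (G \<gamma> j - b j)\<^sup>2"
      unfolding G_def by (intro tendsto_intros lim f) auto
    moreover have "(\<lambda>k. C \<gamma>0 * (1 / real (r k))) \<longlonglongrightarrow> C \<gamma>0 * 0"
      using LIMSEQ_subseq_LIMSEQ[OF lim_1_over_n[where 'a = real] r]
      by (intro tendsto_intros) (simp add: o_def)
    moreover have "\<exists>N. \<forall>k\<ge>N. (G (\<mu> (r k)) j - b j)\<^sup>2 \<le> C \<gamma>0 * (1 / real (r k))"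
    proof (intro exI[of _ "Suc j"] allI impI bnd)
      fix k assume "Suc j \<le> k"
      then show "j < r k" using seq_suble[OF r, of k] by linarith
    qed
    ultimately have "(G \<gamma> j - b j)\<^sup>2 \<le> C \<gamma>0 * 0" by (rule LIMSEQ_le)
    then show ?thesis by simp
  qed
  have "\<exists>n a m. (\<forall>i<N. \<forall>z\<in>K. m i + (\<Sum>j<n. a j * f j i z) \<le> c i z) \<and>
        C \<gamma> - \<delta> \<le> (\<Sum>i<N. m i) + (\<Sum>j<n. a j * b j)" if "\<delta> > 0" for \<delta>
  proof -
    have "(\<lambda>k. C (\<mu> (r k))) \<longlonglongrightarrow> C \<gamma>"
      unfolding C_def by (intro tendsto_intros lim c) auto
    then have "\<forall>\<^sub>F k in sequentially. C \<gamma> - \<delta> < C (\<mu> (r k))"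
      using that by (intro order_tendstoD(1)) auto
    then obtain k where "C \<gamma> - \<delta> < C (\<mu> (r k))"
      using eventually_happens' sequentially_bot by blast
    with val[of "r k"] dual[of _ _ "r k"] show ?thesis
      by (intro exI[of _ "r k"] exI[of _ "a (r k)"] exI[of _ "m (r k)"]) auto
  qed
  then show thesis using that[of \<gamma>] feas \<gamma> by (auto simp: C_def G_def)
qed

section \<open>Countable families of continuous test functions\<close>

definition determining :: "(nat \<Rightarrow> 'a::euclidean_space \<Rightarrow> real) \<Rightarrow> bool" where
  "determining H \<longleftrightarrow> (\<forall>j. continuous_on UNIV (H j)) \<and>
     (\<forall>M N. prob_space M \<longrightarrow> sets M = sets borel \<longrightarrow> prob_space N \<longrightarrow> sets N = sets borel \<longrightarrow>
        (\<forall>j. integral\<^sup>L M (H j) = integral\<^sup>L N (H j)) \<longrightarrow> M = N)"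

text \<open>Finite intersections of a countable basis form a countable intersection-stable generator
  of the Borel sets, and the indicator of an open set is a pointwise limit of truncated multiples of
  the distance to its complement. Equality of marginals thereby becomes a sequence of moment
  constraints.\<close>

lemma ex_determining: "\<exists>H :: nat \<Rightarrow> 'a::euclidean_space \<Rightarrow> real. determining H"
proof -
  obtain B :: "'a set set" where B: "countable B" "topological_basis B"
    using ex_countable_basis by blast
  define E where "E = Inter ` {F. finite F \<and> F \<subseteq> B}"
  have cE: "countable E" unfolding E_def
    by (intro countable_image countable_Collect_finite_subset B)
  have oE: "open V" if "V \<in> E" for V
    using that B(2) unfolding E_def by (auto intro!: open_Inter dest: topological_basis_open)
  have UE: "UNIV \<in> E" unfolding E_def by (auto intro!: image_eqI[of _ _ "{}"])
  have "B \<subseteq> E" unfolding E_def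
  proof
    fix b assume "b \<in> B"
    then show "b \<in> Inter ` {F. finite F \<and> F \<subseteq> B}" by (intro image_eqI[of _ _ "{b}"]) auto
  qed
  have tE: "topological_basis E"
  proof (rule topological_basisI[OF oE])
    fix U and x :: 'a assume "open U" "x \<in> U"
    then show "\<exists>V\<in>E. x \<in> V \<and> V \<subseteq> U"
      using topological_basisE[OF B(2)] \<open>B \<subseteq> E\<close> by (metis subsetD)
  qed
  have IE: "Int_stable E"
  proof (rule Int_stableI)
    fix V W assume "V \<in> E" "W \<in> E"
    then obtain F G where "finite F" "F \<subseteq> B" "V = \<Inter>F" "finite G" "G \<subseteq> B" "W = \<Inter>G"
      by (auto simp: E_def)
    then show "V \<inter> W \<in> E" unfolding E_def
      by (intro image_eqI[of _ _ "F \<union> G"]) auto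
  qed
  \<comment> \<open>The whole space is treated apart because its complement is empty and
    \<open>infdist\<close> to the empty set is 0, which would give the zero function instead of
    1.\<close>
  define h :: "'a set \<Rightarrow> nat \<Rightarrow> 'a \<Rightarrow> real"
    where "h V n x = (if V = UNIV then 1 else min 1 (real n * infdist x (- V)))" for V n x
  define H where "H j = (case prod_decode j of (i, n) \<Rightarrow> h (from_nat_into E i) n)" for j
  have hc: "continuous_on UNIV (h V n)" for V n
    unfolding h_def by (cases "V = UNIV") (auto intro!: continuous_intros)
  have hlim: "(\<lambda>n. h V n x) \<longlonglongrightarrow> indicator V x" if V: "open V" for V x
  proof (cases "V = UNIV \<or> x \<notin> V")
    case True
    then have "h V n x = (indicator V x :: real)" if "n \<ge> 1" for n
      using that by (cases "V = UNIV") (auto simp: h_def)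
    then show ?thesis
      by (intro tendsto_eventually) (auto simp: eventually_sequentially intro!: exI[of _ 1])
  next
    case False
    then have "0 < infdist x (- V)"
      using V infdist_pos_not_in_closed[of "- V" x] by auto
    then obtain n0 :: nat where n0: "1 < real n0 * infdist x (- V)"
      using reals_Archimedean3 by blast
    have "h V n x = 1" if "n \<ge> n0" for n
    proof -
      have "real n0 * infdist x (- V) \<le> real n * infdist x (- V)"
        using that by (intro mult_right_mono) (auto simp: infdist_nonneg)
      with n0 show ?thesis by (simp add: h_def)
    qed
    then show ?thesis using False
      by (intro tendsto_eventually) (auto simp: eventually_sequentially intro!: exI[of _ n0])
  qed
  have main: "M = N" if M: "prob_space M" "sets M = sets borel" and N: "prob_space N" "sets N = sets borel"
    and eq: "\<forall>j. integral\<^sup>L M (H j) = integral\<^sup>L N (H j)" for M N :: "'a measure"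
  proof -
    have int: "(\<lambda>n. integral\<^sup>L L (h V n)) \<longlonglongrightarrow> measure L V"
      if L: "prob_space L" "sets L = sets borel" and V: "V \<in> E" for L V
    proof -
      interpret L: prob_space L by fact
      have hm: "h V n \<in> borel_measurable L" for n
        using borel_measurable_continuous_onI[OF hc] measurable_cong_sets[OF L(2) refl] by blast
      have Vs: "V \<in> sets L" using oE[OF V] L(2) by (auto intro: borel_open)
      have "(\<lambda>n. integral\<^sup>L L (h V n)) \<longlonglongrightarrow> integral\<^sup>L L (indicator V)"
        by (rule integral_dominated_convergence[where w = "\<lambda>_. 1"])
           (use hm Vs hlim[OF oE[OF V]] in \<open>auto simp: h_def infdist_nonneg\<close>)
      then show ?thesis using Vs by (simp add: Int_absorb2 sets.sets_into_space)
    qed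
    have ME: "measure M V = measure N V" if V: "V \<in> E" for V
    proof -
      obtain i where i: "from_nat_into E i = V"
        using from_nat_into_surj[OF cE V] by blast
      have "integral\<^sup>L M (h V n) = integral\<^sup>L N (h V n)" for n
        using eq[rule_format, of "prod_encode (i, n)"] by (simp add: H_def i)
      then show ?thesis using int[OF M V] int[OF N V] LIMSEQ_unique by simp
    qed
    have borelE: "sets borel = sigma_sets UNIV E"
      by (subst borel_eq_countable_basis[OF cE tE]) simp
    interpret M: prob_space M by fact
    interpret N: prob_space N by fact
    show "M = N"
    proof (rule measure_eqI_generator_eq[OF IE, where \<Omega> = UNIV and A = "\<lambda>_. UNIV"])
      show "emeasure M X = emeasure N X" if "X \<in> E" for X
        using ME[OF that] by (simp add: M.emeasure_eq_measure N.emeasure_eq_measure)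
    qed (use M N borelE UE in auto)
  qed
  have "continuous_on UNIV (H j)" for j
    unfolding H_def using hc by (auto split: prod.split)
  with main show ?thesis unfolding determining_def by blast
qed

section \<open>Kantorovich duality\<close>

lemma sets_borel_pair:
  "sets (borel \<Otimes>\<^sub>M borel) = sets (borel :: ('a::euclidean_space \<times> 'b::euclidean_space) measure)"
  by (subst borel_prod) (rule refl)

lemma lipschitz_on_UNIV_continuous:
  fixes u :: "'a::metric_space \<Rightarrow> 'b::metric_space"
  assumes "C-lipschitz_on UNIV u" shows "continuous_on UNIV u"
  using assms by (rule lipschitz_on_continuous_on)

text \<open>An infimum of 1-Lipschitz cones is 1-Lipschitz; the lower bound on g makes the real
  infimum meaningful. This one construction yields both the extension of Lipschitz functions and the
  repair of dual multipliers.\<close>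

lemma inf_convolution_lipschitz:
  fixes g :: "'a::metric_space \<Rightarrow> real"
  assumes S: "S \<noteq> {}" and B: "\<And>y. y \<in> S \<Longrightarrow> B \<le> g y"
  shows "1-lipschitz_on UNIV (\<lambda>x. INF y\<in>S. g y + dist x y)"
    and "\<And>x y. y \<in> S \<Longrightarrow> (INF y\<in>S. g y + dist x y) \<le> g y + dist x y"
proof -
  have bdd: "bdd_below ((\<lambda>y. g y + dist x y) ` S)" for x
    using B by (intro bdd_belowI[of _ B]) (auto intro: add_increasing2)
  show le: "(INF y\<in>S. g y + dist x y) \<le> g y + dist x y" if "y \<in> S" for x y
    using that by (intro cINF_lower bdd)
  have half: "(INF y\<in>S. g y + dist x y) - (INF y\<in>S. g y + dist x' y) \<le> dist x x'" for x x'
  proof -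
    have "(INF y\<in>S. g y + dist x y) - dist x x' \<le> (INF y\<in>S. g y + dist x' y)"
    proof (rule cINF_greatest[OF S])
      fix y assume "y \<in> S"
      from le[OF this, of x] dist_triangle[of x y x']
      show "(INF y\<in>S. g y + dist x y) - dist x x' \<le> g y + dist x' y" by linarith
    qed
    then show ?thesis by linarith
  qed
  show "1-lipschitz_on UNIV (\<lambda>x. INF y\<in>S. g y + dist x y)"
  proof (rule lipschitz_onI)
    fix x y
    show "dist (INF z\<in>S. g z + dist x z) (INF z\<in>S. g z + dist y z) \<le> 1 * dist x y"
      using half[of x y] half[of y x] by (simp add: dist_real_def dist_commute abs_le_iff)
  qed simp
qed

text \<open>McShane's extension, the lowest cone over the values on S; compactness supplies the
  lower bound that the infimum needs.\<close>

lemma lipschitz_extension: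
  fixes u :: "'a::metric_space \<Rightarrow> real"
  assumes u: "1-lipschitz_on S u" and S: "compact S" "S \<noteq> {}"
  shows "\<exists>v. 1-lipschitz_on UNIV v \<and> (\<forall>x\<in>S. v x = u x)"
proof -
  have "compact (u ` S)"
    using compact_continuous_image[OF lipschitz_on_continuous_on[OF u] S(1)] .
  then obtain B where "\<And>y. y \<in> S \<Longrightarrow> \<bar>u y\<bar> \<le> B"
    using compact_imp_bounded[of "u ` S"] by (auto simp: bounded_iff)
  then have B: "- B \<le> u y" if "y \<in> S" for y using that by (force simp: abs_le_iff)
  have "(INF y\<in>S. u y + dist x y) = u x" if x: "x \<in> S" for x
  proof (rule antisym)
    show "(INF y\<in>S. u y + dist x y) \<le> u x"
      using inf_convolution_lipschitz(2)[OF S(2), of "- B" u x x, OF B x] by simp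
    show "u x \<le> (INF y\<in>S. u y + dist x y)"
    proof (rule cINF_greatest[OF S(2)])
      fix y assume "y \<in> S"
      from lipschitz_onD[OF u x this] show "u x \<le> u y + dist x y"
        by (simp add: dist_real_def abs_le_iff)
    qed
  qed
  with inf_convolution_lipschitz(1)[OF S(2), of "- B" u, OF B]
  show ?thesis by (intro exI[of _ "\<lambda>x. INF y\<in>S. u y + dist x y"]) auto
qed

lemma coupling_distr:
  assumes "\<gamma> \<in> couplings \<mu> \<nu>"
  shows "sets \<gamma> = sets borel" "distr \<gamma> borel fst = \<mu>" "distr \<gamma> borel snd = \<nu>"
    "fst \<in> borel_measurable \<gamma>" "snd \<in> borel_measurable \<gamma>"
proof -
  show s: "sets \<gamma> = sets borel" using assms by (simp add: couplings_def sets_borel_pair)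
  show "distr \<gamma> borel fst = \<mu>" "distr \<gamma> borel snd = \<nu>" using assms by (auto simp: couplings_def)
  show "fst \<in> borel_measurable \<gamma>" "snd \<in> borel_measurable \<gamma>"
    unfolding measurable_cong_sets[OF s refl]
    by (auto intro!: borel_measurable_continuous_onI continuous_intros)
qed

lemma coupling_prob_on:
  assumes \<gamma>: "\<gamma> \<in> couplings \<mu> \<nu>" and \<mu>: "\<mu> \<in> prob_on \<Omega>" and \<nu>: "\<nu> \<in> prob_on \<Omega>" and \<Omega>: "closed \<Omega>"
  shows "\<gamma> \<in> prob_on (\<Omega> \<times> \<Omega>)"
proof -
  note g = coupling_distr[OF \<gamma>]
  have "AE x in distr \<gamma> borel fst. x \<in> \<Omega>" unfolding g(2) by (rule prob_on_AE[OF \<mu> \<Omega>])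
  then have 1: "AE z in \<gamma>. fst z \<in> \<Omega>" using \<Omega> by (subst (asm) AE_distr_iff[OF g(4)]) auto
  have "AE x in distr \<gamma> borel snd. x \<in> \<Omega>" unfolding g(3) by (rule prob_on_AE[OF \<nu> \<Omega>])
  then have 2: "AE z in \<gamma>. snd z \<in> \<Omega>" using \<Omega> by (subst (asm) AE_distr_iff[OF g(5)]) auto
  from 1 2 have "AE z in \<gamma>. z \<in> \<Omega> \<times> \<Omega>" by eventually_elim (auto simp: mem_Times_iff)
  then have "emeasure \<gamma> (- (\<Omega> \<times> \<Omega>)) = 0"
    using closed_Times[OF \<Omega> \<Omega>] sets_eq_imp_space_eq[OF g(1)]
    by (subst (asm) AE_iff_measurable[of "- (\<Omega> \<times> \<Omega>)"]) (auto simp: g(1) intro: borel_open)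
  moreover have "prob_space \<gamma>"
  proof
    have "emeasure \<gamma> (space \<gamma>) = emeasure (distr \<gamma> borel fst) UNIV"
      by (subst emeasure_distr[OF g(4)]) auto
    also have "\<dots> = 1"
      using prob_space.emeasure_space_1[OF prob_onD(1)[OF \<mu>]] prob_onD(3)[OF \<mu>] g(2) by simp
    finally show "emeasure \<gamma> (space \<gamma>) = 1" .
  qed
  ultimately show ?thesis using g(1) by (simp add: prob_on_def)
qed

lemma coupling_integral:
  fixes f :: "'a::euclidean_space \<Rightarrow> real"
  assumes \<gamma>: "\<gamma> \<in> couplings \<mu> \<nu>" and f: "f \<in> borel_measurable borel"
  shows "(\<integral>z. f (fst z) \<partial>\<gamma>) = integral\<^sup>L \<mu> f" "(\<integral>z. f (snd z) \<partial>\<gamma>) = integral\<^sup>L \<nu> f"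
  using integral_distr[OF coupling_distr(4)[OF \<gamma>] f] integral_distr[OF coupling_distr(5)[OF \<gamma>] f]
    coupling_distr(2,3)[OF \<gamma>] by simp_all

text \<open>Supplies the feasible plan that \<open>moment_duality\<close> needs to start
  from.\<close>

lemma pair_measure_coupling:
  assumes \<mu>: "\<mu> \<in> prob_on \<Omega>" and \<nu>: "\<nu> \<in> prob_on \<Omega>"
  shows "\<mu> \<Otimes>\<^sub>M \<nu> \<in> couplings \<mu> \<nu>"
proof -
  interpret \<mu>: prob_space \<mu> by (rule prob_onD(1)[OF \<mu>])
  interpret \<nu>: prob_space \<nu> by (rule prob_onD(1)[OF \<nu>])
  have s: "sets \<mu> = sets borel" "sets \<nu> = sets borel" "space \<mu> = UNIV" "space \<nu> = UNIV"
    using prob_onD[OF \<mu>] prob_onD[OF \<nu>] by auto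
  have "distr (\<mu> \<Otimes>\<^sub>M \<nu>) borel fst = distr (\<mu> \<Otimes>\<^sub>M \<nu>) \<mu> fst"
    by (rule distr_cong) (auto simp: s)
  also have "\<dots> = \<mu>" by (rule \<nu>.distr_pair_fst)
  finally have 1: "distr (\<mu> \<Otimes>\<^sub>M \<nu>) borel fst = \<mu>" .
  have "distr (\<mu> \<Otimes>\<^sub>M \<nu>) borel snd = \<nu>"
  proof (rule measure_eqI)
    fix A assume "A \<in> sets (distr (\<mu> \<Otimes>\<^sub>M \<nu>) borel snd)"
    then have A: "A \<in> sets \<nu>" by (simp add: s)
    have sm: "snd \<in> borel_measurable (\<mu> \<Otimes>\<^sub>M \<nu>)"
      using measurable_snd[of \<mu> \<nu>] measurable_cong_sets[OF refl s(2)] by blast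
    have "emeasure (distr (\<mu> \<Otimes>\<^sub>M \<nu>) borel snd) A = emeasure (\<mu> \<Otimes>\<^sub>M \<nu>) (space \<mu> \<times> A)"
      using A by (subst emeasure_distr[OF sm])
        (auto simp: s space_pair_measure intro!: arg_cong2[where f = emeasure])
    also have "\<dots> = emeasure \<nu> A"
      using A by (subst \<nu>.emeasure_pair_measure_Times) (auto simp: \<mu>.emeasure_space_1)
    finally show "emeasure (distr (\<mu> \<Otimes>\<^sub>M \<nu>) borel snd) A = emeasure \<nu> A" .
  qed (simp add: s)
  with 1 show ?thesis
    using sets_pair_measure_cong[OF s(1,2)] by (simp add: couplings_def)
qed

lemma lipschitz_integral_le_coupling:
  assumes \<gamma>: "\<gamma> \<in> couplings \<mu> \<nu>" and \<mu>: "\<mu> \<in> prob_on \<Omega>" and \<nu>: "\<nu> \<in> prob_on \<Omega>"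
    and \<Omega>: "compact \<Omega>" and u: "1-lipschitz_on UNIV u"
  shows "integral\<^sup>L \<mu> u - integral\<^sup>L \<nu> u \<le> (\<integral>z. dist (fst z) (snd z) \<partial>\<gamma>)"
    (is "_ \<le> ?D")
proof -
  have g: "\<gamma> \<in> prob_on (\<Omega> \<times> \<Omega>)"
    by (rule coupling_prob_on[OF \<gamma> \<mu> \<nu> compact_imp_closed[OF \<Omega>]])
  have uc: "continuous_on UNIV u" by (rule lipschitz_on_UNIV_continuous[OF u])
  have uc1: "continuous_on UNIV (\<lambda>z. u (fst z))" and uc2: "continuous_on UNIV (\<lambda>z. u (snd z))"
    by (auto intro!: continuous_on_compose2[OF uc] continuous_intros)
  have i1: "integrable \<gamma> (\<lambda>z. u (fst z))" and i2: "integrable \<gamma> (\<lambda>z. u (snd z))"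
    and i3: "integrable \<gamma> (\<lambda>z. dist (fst z) (snd z))"
    using compact_Times[OF \<Omega> \<Omega>]
    by (auto intro!: prob_on_integrable[OF g] uc1 uc2 continuous_intros)
  have um: "u \<in> borel_measurable borel" by (rule borel_measurable_continuous_onI[OF uc])
  have "integral\<^sup>L \<mu> u - integral\<^sup>L \<nu> u = (\<integral>z. u (fst z) - u (snd z) \<partial>\<gamma>)"
    using i1 i2 coupling_integral[OF \<gamma> um] by simp
  also have "\<dots> \<le> ?D"
  proof (rule integral_mono)
    show "u (fst z) - u (snd z) \<le> dist (fst z) (snd z)" for z
      using lipschitz_onD[OF u, of "fst z" "snd z"] by (simp add: dist_real_def abs_le_iff)
  qed (use i1 i2 i3 in auto)
  finally show ?thesis .
qed

lemma couplingI:
  fixes \<gamma> :: "('a::euclidean_space \<times> 'a) measure"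
  assumes H: "determining H"
    and \<gamma>: "prob_space \<gamma>" "sets \<gamma> = sets borel"
    and \<mu>: "prob_space \<mu>" "sets \<mu> = sets borel" and \<nu>: "prob_space \<nu>" "sets \<nu> = sets borel"
    and 1: "\<And>j. (\<integral>z. H j (fst z) \<partial>\<gamma>) = integral\<^sup>L \<mu> (H j)"
    and 2: "\<And>j. (\<integral>z. H j (snd z) \<partial>\<gamma>) = integral\<^sup>L \<nu> (H j)"
  shows "\<gamma> \<in> couplings \<mu> \<nu>"
proof -
  have m: "fst \<in> borel_measurable \<gamma>" "snd \<in> borel_measurable \<gamma>"
    unfolding measurable_cong_sets[OF \<gamma>(2) refl]
    by (auto intro!: borel_measurable_continuous_onI continuous_intros)
  have Hm: "H j \<in> borel_measurable borel" for j
    using H by (intro borel_measurable_continuous_onI) (simp add: determining_def)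
  have eqI: "M = L" if "prob_space M" "sets M = sets borel" "prob_space L" "sets L = sets borel"
    "\<And>j. integral\<^sup>L M (H j) = integral\<^sup>L L (H j)" for M L
    using H that unfolding determining_def by blast
  have "distr \<gamma> borel fst = \<mu>"
    by (rule eqI) (simp_all add: prob_space.prob_space_distr[OF \<gamma>(1) m(1)] \<mu> integral_distr[OF m(1) Hm] 1)
  moreover have "distr \<gamma> borel snd = \<nu>"
    by (rule eqI) (simp_all add: prob_space.prob_space_distr[OF \<gamma>(1) m(2)] \<nu> integral_distr[OF m(2) Hm] 2)
  ultimately show ?thesis using \<gamma>(2) by (simp add: couplings_def sets_borel_pair)
qed

text \<open>The case of a single plan in \<open>moment_duality\<close>. The plan is attained and is
  the same for every \<delta>, while the potential is only nearly optimal; that is enough to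
  identify \<open>W1\<close> and to bound it by flows.\<close>

lemma kantorovich_duality:
  fixes \<Omega> :: "'a::euclidean_space set"
  assumes \<Omega>: "compact \<Omega>" and \<mu>: "\<mu> \<in> prob_on \<Omega>" and \<nu>: "\<nu> \<in> prob_on \<Omega>"
  obtains \<gamma> where "\<gamma> \<in> couplings \<mu> \<nu>"
    "\<forall>\<delta>>0. \<exists>u. 1-lipschitz_on UNIV u \<and>
       (\<integral>z. dist (fst z) (snd z) \<partial>\<gamma>) - \<delta> \<le> integral\<^sup>L \<mu> u - integral\<^sup>L \<nu> u"
proof -
  obtain H :: "nat \<Rightarrow> 'a \<Rightarrow> real" where H: "determining H"
    using ex_determining by blast
  have Hc: "continuous_on UNIV (H j)" for j using H by (simp add: determining_def)
  \<comment> \<open>Even indices test the first marginal and odd indices the second, so both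
    families of marginal constraints fit into one sequence.\<close>
  define F where "F j = (\<lambda>z :: 'a \<times> 'a. if even j then H (j div 2) (fst z) else H (j div 2) (snd z))" for j
  define b where "b j = (if even j then integral\<^sup>L \<mu> (H (j div 2)) else integral\<^sup>L \<nu> (H (j div 2)))" for j
  have cl: "closed \<Omega>" by (rule compact_imp_closed[OF \<Omega>])
  have Fc: "continuous_on UNIV (F j)" for j
    unfolding F_def by (cases "even j") (auto intro!: continuous_on_compose2[OF Hc] continuous_intros)
  note Hm = borel_measurable_continuous_onI[OF Hc]
  note pc = pair_measure_coupling[OF \<mu> \<nu>]
  have Fb: "integral\<^sup>L (\<mu> \<Otimes>\<^sub>M \<nu>) (F j) = b j" for j
    unfolding F_def b_def using coupling_integral[OF pc Hm[of "j div 2"]] by (cases "even j") auto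
  define c where "c = (\<lambda>(_ :: nat) (z :: 'a \<times> 'a). dist (fst z) (snd z))"
  define F1 where "F1 = (\<lambda>j (_ :: nat). F j)"
  define \<gamma>0 where "\<gamma>0 = (\<lambda>_ :: nat. \<mu> \<Otimes>\<^sub>M \<nu>)"
  have "continuous_on UNIV (c i)" "z \<in> \<Omega> \<times> \<Omega> \<Longrightarrow> 0 \<le> c i z" "continuous_on UNIV (F1 j i)"
    "\<forall>i<1. \<gamma>0 i \<in> prob_on (\<Omega> \<times> \<Omega>)" "(\<Sum>i<1. integral\<^sup>L (\<gamma>0 i) (F1 j i)) = b j" for i j z
    using coupling_prob_on[OF pc \<mu> \<nu> cl] Fb Fc
    by (auto simp: c_def F1_def \<gamma>0_def intro!: continuous_intros)
  note prems = this
  obtain g where g: "\<forall>i<1. g i \<in> prob_on (\<Omega> \<times> \<Omega>)" "\<forall>j. (\<Sum>i<1. integral\<^sup>L (g i) (F1 j i)) = b j"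
    "\<forall>\<delta>>0. \<exists>n a m. (\<forall>i<1. \<forall>z\<in>\<Omega> \<times> \<Omega>. m i + (\<Sum>j<n. a j * F1 j i z) \<le> c i z) \<and>
        (\<Sum>i<1. integral\<^sup>L (g i) (c i)) - \<delta> \<le> (\<Sum>i<1. m i) + (\<Sum>j<n. a j * b j)"
    by (rule moment_duality[of "\<Omega> \<times> \<Omega>" c F1 1 \<gamma>0 b, OF compact_Times[OF \<Omega> \<Omega>] prems])
  define \<gamma> where "\<gamma> = g 0"
  have \<gamma>: "\<gamma> \<in> prob_on (\<Omega> \<times> \<Omega>)" and eq: "integral\<^sup>L \<gamma> (F j) = b j" for j
    using g(1,2) by (auto simp: \<gamma>_def F1_def)
  have dual: "\<exists>n a m. (\<forall>z\<in>\<Omega> \<times> \<Omega>. m + (\<Sum>j<n. a j * F j z) \<le> dist (fst z) (snd z)) \<and>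
        (\<integral>z. dist (fst z) (snd z) \<partial>\<gamma>) - \<delta> \<le> m + (\<Sum>j<n. a j * b j)" if dpos: "\<delta> > 0" for \<delta>
  proof -
    obtain n a and m :: "nat \<Rightarrow> real" where
      1: "\<forall>i<1. \<forall>z\<in>\<Omega> \<times> \<Omega>. m i + (\<Sum>j<n. a j * F1 j i z) \<le> c i z"
      and 2: "(\<Sum>i<1. integral\<^sup>L (g i) (c i)) - \<delta> \<le> (\<Sum>i<1. m i) + (\<Sum>j<n. a j * b j)"
      using g(3) dpos by blast
    show ?thesis
      using 1 2 by (intro exI[of _ n] exI[of _ a] exI[of _ "m 0"]) (auto simp: F1_def c_def \<gamma>_def)
  qed
  have "\<gamma> \<in> couplings \<mu> \<nu>"
  proof (rule couplingI[OF H])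
    fix j
    show "(\<integral>z. H j (fst z) \<partial>\<gamma>) = integral\<^sup>L \<mu> (H j)" using eq[of "2 * j"] by (simp add: F_def b_def)
    show "(\<integral>z. H j (snd z) \<partial>\<gamma>) = integral\<^sup>L \<nu> (H j)" using eq[of "2 * j + 1"] by (simp add: F_def b_def)
  qed (use prob_onD[OF \<gamma>] prob_onD[OF \<mu>] prob_onD[OF \<nu>] in auto)
  moreover have "\<exists>u. 1-lipschitz_on UNIV u \<and>
       (\<integral>z. dist (fst z) (snd z) \<partial>\<gamma>) - \<delta> \<le> integral\<^sup>L \<mu> u - integral\<^sup>L \<nu> u" if pos: "\<delta> > 0" for \<delta>
  proof -
    obtain n a m where le: "\<And>z. z \<in> \<Omega> \<times> \<Omega> \<Longrightarrow> m + (\<Sum>j<n. a j * F j z) \<le> dist (fst z) (snd z)"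
      and val: "(\<integral>z. dist (fst z) (snd z) \<partial>\<gamma>) - \<delta> \<le> m + (\<Sum>j<n. a j * b j)"
      using dual[OF pos] by blast
    define \<Phi> where "\<Phi> x = (\<Sum>j<n. (if even j then a j else 0) * H (j div 2) x)" for x
    define \<Psi> where "\<Psi> x = (\<Sum>j<n. (if even j then 0 else a j) * H (j div 2) x)" for x
    have \<Phi>c: "continuous_on UNIV \<Phi>" and \<Psi>c: "continuous_on UNIV \<Psi>"
      unfolding \<Phi>_def \<Psi>_def by (intro continuous_intros Hc)+
    have le': "m + \<Phi> x + \<Psi> y \<le> dist x y" if "x \<in> \<Omega>" "y \<in> \<Omega>" for x y
    proof -
      have "(\<Sum>j<n. a j * F j (x, y)) = \<Phi> x + \<Psi> y"
        unfolding \<Phi>_def \<Psi>_def sum.distrib[symmetric] by (intro sum.cong) (auto simp: F_def)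
      with le[of "(x, y)"] that show ?thesis by simp
    qed
    have i\<Phi>: "integral\<^sup>L \<mu> \<Phi> = (\<Sum>j<n. (if even j then a j else 0) * integral\<^sup>L \<mu> (H (j div 2)))"
      unfolding \<Phi>_def using prob_on_integrable[OF \<mu> \<Omega> Hc] by simp
    have i\<Psi>: "integral\<^sup>L \<nu> \<Psi> = (\<Sum>j<n. (if even j then 0 else a j) * integral\<^sup>L \<nu> (H (j div 2)))"
      unfolding \<Psi>_def using prob_on_integrable[OF \<nu> \<Omega> Hc] by simp
    have ab: "(\<Sum>j<n. a j * b j) = integral\<^sup>L \<mu> \<Phi> + integral\<^sup>L \<nu> \<Psi>"
      unfolding i\<Phi> i\<Psi> sum.distrib[symmetric] by (intro sum.cong) (auto simp: b_def)
    have ne: "\<Omega> \<noteq> {}" by (rule prob_on_nonempty[OF \<mu>])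
    then obtain x0 where x0: "x0 \<in> \<Omega>" by blast
    have "compact ((\<lambda>y. - \<Psi> y) ` \<Omega>)"
      by (intro compact_continuous_image \<Omega> continuous_intros continuous_on_subset[OF \<Psi>c]) auto
    then obtain B where "\<And>y. y \<in> \<Omega> \<Longrightarrow> \<bar>- \<Psi> y\<bar> \<le> B"
      using compact_imp_bounded[of "(\<lambda>y. - \<Psi> y) ` \<Omega>"] by (auto simp: bounded_iff)
    then have B: "- B \<le> - \<Psi> y" if "y \<in> \<Omega>" for y using that by (force simp: abs_le_iff)
    \<comment> \<open>On \<Omega> this function lies above \<open>m + \<Phi>\<close> by the dual
      inequality and below \<open>- \<Psi>\<close> by taking the infimum at the point itself. A
      single 1-Lipschitz function thus replaces the pair without lowering the dual value.\<close>
    define u where "u x = (INF y\<in>\<Omega>. - \<Psi> y + dist x y)" for x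
    have ulip: "1-lipschitz_on UNIV u"
      unfolding u_def by (rule inf_convolution_lipschitz(1)[OF ne, of "- B"]) (rule B)
    have uc: "continuous_on UNIV u" by (rule lipschitz_on_UNIV_continuous[OF ulip])
    have u1: "m + \<Phi> x \<le> u x" if "x \<in> \<Omega>" for x
      unfolding u_def by (rule cINF_greatest[OF ne]) (use le'[OF that] in \<open>simp add: algebra_simps\<close>)
    have u2: "u y \<le> - \<Psi> y" if "y \<in> \<Omega>" for y
      using inf_convolution_lipschitz(2)[OF ne, of "- B" "\<lambda>y. - \<Psi> y" y y, OF B that] by (simp add: u_def)
    interpret \<mu>: prob_space \<mu> by (rule prob_onD(1)[OF \<mu>])
    have "m + integral\<^sup>L \<mu> \<Phi> = (\<integral>x. m + \<Phi> x \<partial>\<mu>)"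
      using prob_on_integrable[OF \<mu> \<Omega> \<Phi>c] by (simp add: \<mu>.prob_space)
    also have "\<dots> \<le> integral\<^sup>L \<mu> u"
      using prob_on_integrable[OF \<mu> \<Omega>] \<Phi>c uc prob_on_AE[OF \<mu> cl]
      by (intro integral_mono_AE) (auto intro!: continuous_intros elim!: eventually_mono u1)
    finally have 1: "m + integral\<^sup>L \<mu> \<Phi> \<le> integral\<^sup>L \<mu> u" .
    have "integral\<^sup>L \<nu> u \<le> (\<integral>x. - \<Psi> x \<partial>\<nu>)"
      using prob_on_integrable[OF \<nu> \<Omega>] \<Psi>c uc prob_on_AE[OF \<nu> cl]
      by (intro integral_mono_AE) (auto intro!: continuous_intros elim!: eventually_mono u2)
    then have 2: "integral\<^sup>L \<nu> u \<le> - integral\<^sup>L \<nu> \<Psi>" by simp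
    show ?thesis using ulip val ab 1 2 by (intro exI[of _ u]) linarith
  qed
  ultimately show thesis using that by blast
qed

lemma nn_integral_dist_coupling:
  assumes "\<gamma> \<in> couplings \<mu> \<nu>" "\<mu> \<in> prob_on \<Omega>" "\<nu> \<in> prob_on \<Omega>" "compact \<Omega>"
  shows "(\<integral>\<^sup>+ z. ennreal (dist (fst z) (snd z)) \<partial>\<gamma>) = ennreal (\<integral>z. dist (fst z) (snd z) \<partial>\<gamma>)"
  using coupling_prob_on[OF assms(1-3) compact_imp_closed[OF assms(4)]] compact_Times[OF assms(4,4)]
  by (intro nn_integral_eq_integral prob_on_integrable) (auto intro!: continuous_intros)

text \<open>The nearly optimal potentials bound the cost of every competing plan from below, so the
  plan from duality attains the infimum and the extended-real distance becomes an ordinary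
  integral.\<close>

lemma W1_optimal_coupling:
  fixes \<Omega> :: "'a::euclidean_space set"
  assumes \<Omega>: "compact \<Omega>" and \<mu>: "\<mu> \<in> prob_on \<Omega>" and \<nu>: "\<nu> \<in> prob_on \<Omega>"
  obtains \<gamma> where "\<gamma> \<in> couplings \<mu> \<nu>"
    "W1 \<mu> \<nu> = ennreal (\<integral>z. dist (fst z) (snd z) \<partial>\<gamma>)"
    "\<forall>\<delta>>0. \<exists>u. 1-lipschitz_on UNIV u \<and>
       (\<integral>z. dist (fst z) (snd z) \<partial>\<gamma>) - \<delta> \<le> integral\<^sup>L \<mu> u - integral\<^sup>L \<nu> u"
proof -
  obtain \<gamma> where \<gamma>: "\<gamma> \<in> couplings \<mu> \<nu>" and
    dual: "\<forall>\<delta>>0. \<exists>u. 1-lipschitz_on UNIV u \<and>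
       (\<integral>z. dist (fst z) (snd z) \<partial>\<gamma>) - \<delta> \<le> integral\<^sup>L \<mu> u - integral\<^sup>L \<nu> u"
    by (rule kantorovich_duality[OF \<Omega> \<mu> \<nu>])
  have "W1 \<mu> \<nu> = ennreal (\<integral>z. dist (fst z) (snd z) \<partial>\<gamma>)"
  proof (rule antisym)
    show "W1 \<mu> \<nu> \<le> ennreal (\<integral>z. dist (fst z) (snd z) \<partial>\<gamma>)"
      unfolding W1_def nn_integral_dist_coupling[OF \<gamma> \<mu> \<nu> \<Omega>, symmetric] by (rule INF_lower[OF \<gamma>])
    show "ennreal (\<integral>z. dist (fst z) (snd z) \<partial>\<gamma>) \<le> W1 \<mu> \<nu>"
      unfolding W1_def
    proof (rule INF_greatest)
      fix \<gamma>' assume g': "\<gamma>' \<in> couplings \<mu> \<nu>"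
      have "(\<integral>z. dist (fst z) (snd z) \<partial>\<gamma>) \<le> (\<integral>z. dist (fst z) (snd z) \<partial>\<gamma>')"
      proof (rule field_le_epsilon)
        fix \<delta> :: real assume "\<delta> > 0"
        with dual obtain u where "1-lipschitz_on UNIV u"
          "(\<integral>z. dist (fst z) (snd z) \<partial>\<gamma>) - \<delta> \<le> integral\<^sup>L \<mu> u - integral\<^sup>L \<nu> u" by blast
        with lipschitz_integral_le_coupling[OF g' \<mu> \<nu> \<Omega>, of u]
        show "(\<integral>z. dist (fst z) (snd z) \<partial>\<gamma>) \<le> (\<integral>z. dist (fst z) (snd z) \<partial>\<gamma>') + \<delta>" by linarith
      qed
      then show "ennreal (\<integral>z. dist (fst z) (snd z) \<partial>\<gamma>) \<le> (\<integral>\<^sup>+ z. ennreal (dist (fst z) (snd z)) \<partial>\<gamma>')"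
        unfolding nn_integral_dist_coupling[OF g' \<mu> \<nu> \<Omega>] by (rule ennreal_leI)
    qed
  qed
  with that \<gamma> dual show thesis by blast
qed

lemma lipschitz_integral_le_W1:
  assumes \<Omega>: "compact \<Omega>" and \<mu>: "\<mu> \<in> prob_on \<Omega>" and \<nu>: "\<nu> \<in> prob_on \<Omega>" and u: "1-lipschitz_on UNIV u"
  shows "ennreal (integral\<^sup>L \<mu> u - integral\<^sup>L \<nu> u) \<le> W1 \<mu> \<nu>"
proof -
  obtain \<gamma> where "\<gamma> \<in> couplings \<mu> \<nu>" "W1 \<mu> \<nu> = ennreal (\<integral>z. dist (fst z) (snd z) \<partial>\<gamma>)"
    by (rule W1_optimal_coupling[OF \<Omega> \<mu> \<nu>])
  then show ?thesis using lipschitz_integral_le_coupling[OF _ \<mu> \<nu> \<Omega> u] by (simp add: ennreal_leI)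
qed

section \<open>Duality for Wasserstein medians\<close>

text \<open>The common second marginal is not prescribed; the plans are only required to agree on
  it. Hence the multipliers \<open>\<Psi> i\<close> of the agreement constraints sum to zero, and
  this cancellation is the origin of the constraint on the weighted sum of potentials in
  (D).\<close>

lemma barycentre_duality_approx:
  fixes \<Omega> :: "'a::euclidean_space set" and N :: nat and lam :: "nat \<Rightarrow> real"
  assumes \<Omega>: "compact \<Omega>" and lam: "\<And>i. i < N \<Longrightarrow> lam i > 0" and N: "N > 0"
    and \<nu>s: "\<And>i. i < N \<Longrightarrow> \<nu>s i \<in> prob_on \<Omega>"
  obtains \<mu> \<gamma> where "\<mu> \<in> prob_on \<Omega>" "\<forall>i<N. \<gamma> i \<in> couplings (\<nu>s i) \<mu>"
    "\<forall>\<delta>>0. \<exists>u. (\<forall>i. 1-lipschitz_on UNIV (u i)) \<and> (\<forall>x\<in>\<Omega>. (\<Sum>i<N. lam i * u i x) \<le> 0) \<and>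
       (\<Sum>i<N. lam i * (\<integral>z. dist (fst z) (snd z) \<partial>(\<gamma> i))) - \<delta> \<le> (\<Sum>i<N. lam i * integral\<^sup>L (\<nu>s i) (u i))"
proof -
  obtain H :: "nat \<Rightarrow> 'a \<Rightarrow> real" where H: "determining H"
    using ex_determining by blast
  have Hc: "continuous_on UNIV (H j)" for j using H by (simp add: determining_def)
  have cl: "closed \<Omega>" by (rule compact_imp_closed[OF \<Omega>])
  have cK: "compact (\<Omega> \<times> \<Omega>)" by (rule compact_Times[OF \<Omega> \<Omega>])
  note Hm = borel_measurable_continuous_onI[OF Hc]
  text \<open>With \<open>j div 2\<close> coding a pair \<open>(i, l)\<close>, the constraint with even index \<open>j\<close> tests the first
    marginal of the \<open>i\<close>-th plan against \<open>H l\<close>, and the one with odd index tests whether the second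
    marginals of the \<open>i\<close>-th and \<open>0\<close>-th plans agree on \<open>H l\<close>.\<close>
  define T where "T j = even j" for j :: nat
  \<comment> \<open>Reduction modulo N makes every code denote a valid plan; repeated constraints do
    no harm.\<close>
  define I where "I j = fst (prod_decode (j div 2)) mod N" for j
  define h where "h j = H (snd (prod_decode (j div 2)))" for j
  have I: "I j < N" for j using N by (simp add: I_def)
  have hc: "continuous_on UNIV (h j)" for j unfolding h_def by (rule Hc)
  have idx: "T (2 * prod_encode (i, l)) \<and> \<not> T (2 * prod_encode (i, l) + 1) \<and>
      I (2 * prod_encode (i, l)) = i \<and> I (2 * prod_encode (i, l) + 1) = i \<and>
      h (2 * prod_encode (i, l)) = H l \<and> h (2 * prod_encode (i, l) + 1) = H l" if "i < N" for i l
    using that by (simp add: T_def I_def h_def)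
  define e where "e j i = (if I j = i then 1 else 0 :: real)" for j i
  \<comment> \<open>Plan \<open>I j\<close> minus plan 0. These coefficients sum to zero over i,
    which is what cancels in \<open>sum\<Psi>\<close>.\<close>
  define d where "d j i = e j i - (if i = 0 then 1 else 0 :: real)" for j i
  define F where "F j i = (\<lambda>z :: 'a \<times> 'a. if T j then e j i * h j (fst z) else d j i * h j (snd z))" for j i
  define b where "b j = (if T j then integral\<^sup>L (\<nu>s (I j)) (h j) else 0)" for j
  \<comment> \<open>Weights are known to be positive only for i < N; the absolute value makes the
    cost nonnegative for every index, as \<open>moment_duality\<close> asks.\<close>
  define c where "c i = (\<lambda>z :: 'a \<times> 'a. \<bar>lam i\<bar> * dist (fst z) (snd z))" for i
  have se: "(\<Sum>i<N. e j i * X i) = X (I j)" for j and X :: "nat \<Rightarrow> real"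
    using I[of j] by (simp add: e_def if_distrib[of "\<lambda>x. x * _"] sum.delta cong: if_cong)
  have sd: "(\<Sum>i<N. d j i * X i) = X (I j) - X 0" for j and X :: "nat \<Rightarrow> real"
    using N unfolding d_def left_diff_distrib sum_subtractf se
    by (simp add: if_distrib[of "\<lambda>x. x * _"] sum.delta cong: if_cong)
  have cc: "continuous_on UNIV (c i)" for i unfolding c_def by (intro continuous_intros)
  have c0: "z \<in> \<Omega> \<times> \<Omega> \<Longrightarrow> 0 \<le> c i z" for i z by (simp add: c_def)
  have Fc: "continuous_on UNIV (F j i)" for j i
    unfolding F_def by (cases "T j")
      (auto intro!: continuous_intros continuous_on_compose2[OF hc])
  \<comment> \<open>Product plans with second factor \<open>\<nu>s 0\<close> share a second
    marginal, hence satisfy all constraints.\<close>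
  define \<gamma>0 where "\<gamma>0 i = \<nu>s i \<Otimes>\<^sub>M \<nu>s 0" for i
  have pc: "\<gamma>0 i \<in> couplings (\<nu>s i) (\<nu>s 0)" if "i < N" for i
    unfolding \<gamma>0_def by (rule pair_measure_coupling[OF \<nu>s[OF that] \<nu>s[OF N]])
  have g0: "\<forall>i<N. \<gamma>0 i \<in> prob_on (\<Omega> \<times> \<Omega>)"
    using coupling_prob_on[OF pc \<nu>s \<nu>s[OF N] cl] by blast
  have Fint: "(\<Sum>i<N. integral\<^sup>L (\<gamma> i) (F j i)) =
     (if T j then (\<integral>z. h j (fst z) \<partial>\<gamma> (I j)) else (\<integral>z. h j (snd z) \<partial>\<gamma> (I j)) - (\<integral>z. h j (snd z) \<partial>\<gamma> 0))"
    for \<gamma> :: "nat \<Rightarrow> ('a \<times> 'a) measure" and j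
  proof -
    have "integral\<^sup>L (\<gamma> i) (F j i) =
        (if T j then e j i * (\<integral>z. h j (fst z) \<partial>\<gamma> i) else d j i * (\<integral>z. h j (snd z) \<partial>\<gamma> i))" for i
      unfolding F_def by simp
    then show ?thesis by (simp add: se sd)
  qed
  have Fb: "(\<Sum>i<N. integral\<^sup>L (\<gamma>0 i) (F j i)) = b j" for j
    unfolding Fint b_def
    using coupling_integral[OF pc[OF I] borel_measurable_continuous_onI[OF hc]]
      coupling_integral[OF pc[OF N] borel_measurable_continuous_onI[OF hc]] by simp
  obtain \<gamma> where \<gamma>: "\<forall>i<N. \<gamma> i \<in> prob_on (\<Omega> \<times> \<Omega>)"
    and eq: "\<forall>j. (\<Sum>i<N. integral\<^sup>L (\<gamma> i) (F j i)) = b j"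
    and dual: "\<forall>\<delta>>0. \<exists>n a m. (\<forall>i<N. \<forall>z\<in>\<Omega> \<times> \<Omega>. m i + (\<Sum>j<n. a j * F j i z) \<le> c i z) \<and>
        (\<Sum>i<N. integral\<^sup>L (\<gamma> i) (c i)) - \<delta> \<le> (\<Sum>i<N. m i) + (\<Sum>j<n. a j * b j)"
    by (rule moment_duality[of "\<Omega> \<times> \<Omega>" c F N \<gamma>0 b, OF cK cc c0 Fc g0 Fb])
  have g1: "(\<integral>z. H l (fst z) \<partial>\<gamma> i) = integral\<^sup>L (\<nu>s i) (H l)" if "i < N" for i l
    using eq[rule_format, of "2 * prod_encode (i, l)"] idx[OF that, of l] by (simp add: Fint b_def)
  have g2: "(\<integral>z. H l (snd z) \<partial>\<gamma> i) = (\<integral>z. H l (snd z) \<partial>\<gamma> 0)" if "i < N" for i l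
    using eq[rule_format, of "2 * prod_encode (i, l) + 1"] idx[OF that, of l] by (simp add: Fint b_def)
  define \<mu> where "\<mu> = distr (\<gamma> 0) borel snd"
  have sm: "snd \<in> borel_measurable (borel :: ('a \<times> 'a) measure)"
    by (auto intro!: borel_measurable_continuous_onI continuous_intros)
  have g0\<gamma>: "\<gamma> 0 \<in> prob_on (\<Omega> \<times> \<Omega>)" using \<gamma> N by simp
  have \<mu>: "\<mu> \<in> prob_on \<Omega>"
    unfolding \<mu>_def by (rule prob_on_distr[OF g0\<gamma> compact_imp_closed[OF cK] sm _ cl]) auto
  have g3: "(\<integral>z. H l (snd z) \<partial>\<gamma> i) = integral\<^sup>L \<mu> (H l)" if "i < N" for i l
    using g2[OF that] integral_distr[OF prob_on_measurable[OF g0\<gamma> sm] Hm] by (simp add: \<mu>_def)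
  have gc: "\<forall>i<N. \<gamma> i \<in> couplings (\<nu>s i) \<mu>"
  proof (intro allI impI)
    fix i assume i: "i < N"
    then have "\<gamma> i \<in> prob_on (\<Omega> \<times> \<Omega>)" using \<gamma> by simp
    from prob_onD(1,2)[OF this] prob_onD(1,2)[OF \<nu>s[OF i]] prob_onD(1,2)[OF \<mu>]
    show "\<gamma> i \<in> couplings (\<nu>s i) \<mu>" by (rule couplingI[OF H]) (simp_all add: g1 g3 i)
  qed
  have "\<exists>u. (\<forall>i. 1-lipschitz_on UNIV (u i)) \<and> (\<forall>x\<in>\<Omega>. (\<Sum>i<N. lam i * u i x) \<le> 0) \<and>
       (\<Sum>i<N. lam i * (\<integral>z. dist (fst z) (snd z) \<partial>(\<gamma> i))) - \<delta> \<le> (\<Sum>i<N. lam i * integral\<^sup>L (\<nu>s i) (u i))"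
    if pos: "\<delta> > 0" for \<delta>
  proof -
    obtain n a m where le: "\<And>i z. i < N \<Longrightarrow> z \<in> \<Omega> \<times> \<Omega> \<Longrightarrow> m i + (\<Sum>j<n. a j * F j i z) \<le> c i z"
      and val: "(\<Sum>i<N. integral\<^sup>L (\<gamma> i) (c i)) - \<delta> \<le> (\<Sum>i<N. m i) + (\<Sum>j<n. a j * b j)"
      using dual[rule_format, OF pos] by blast
    define \<Phi> where "\<Phi> i x = (\<Sum>j<n. (if T j then a j else 0) * (e j i * h j x))" for i x
    define \<Psi> where "\<Psi> i x = (\<Sum>j<n. (if T j then 0 else a j) * (d j i * h j x))" for i x
    have \<Phi>c: "continuous_on UNIV (\<Phi> i)" for i
      unfolding \<Phi>_def by (intro continuous_intros hc)
    have sum\<Psi>: "(\<Sum>i<N. \<Psi> i y) = 0" for y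
      unfolding \<Psi>_def by (subst sum.swap) (simp add: sum_distrib_left[symmetric] sd)
    have le': "m i + \<Phi> i x + \<Psi> i y \<le> lam i * dist x y" if "i < N" "x \<in> \<Omega>" "y \<in> \<Omega>" for i x y
    proof -
      have "(\<Sum>j<n. a j * F j i (x, y)) = \<Phi> i x + \<Psi> i y"
        unfolding \<Phi>_def \<Psi>_def sum.distrib[symmetric] by (intro sum.cong) (auto simp: F_def)
      with le[of i "(x, y)"] that lam[of i] show ?thesis by (simp add: c_def)
    qed
    have ab: "(\<Sum>j<n. a j * b j) = (\<Sum>i<N. integral\<^sup>L (\<nu>s i) (\<Phi> i))"
    proof -
      have "integral\<^sup>L (\<nu>s i) (\<Phi> i) = (\<Sum>j<n. (if T j then a j else 0) * (e j i * integral\<^sup>L (\<nu>s i) (h j)))"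
        if "i < N" for i
        unfolding \<Phi>_def using prob_on_integrable[OF \<nu>s[OF that] \<Omega> hc] by simp
      then have "(\<Sum>i<N. integral\<^sup>L (\<nu>s i) (\<Phi> i))
          = (\<Sum>i<N. \<Sum>j<n. (if T j then a j else 0) * (e j i * integral\<^sup>L (\<nu>s i) (h j)))" by simp
      also have "\<dots> = (\<Sum>j<n. a j * b j)"
        by (subst sum.swap) (auto simp: sum_distrib_left[symmetric] se b_def intro!: sum.cong)
      finally show ?thesis by simp
    qed
    have ne: "\<Omega> \<noteq> {}" by (rule prob_on_nonempty[OF \<mu>])
    define g where "g i y = - (m i + \<Phi> i y) / lam i" for i y
    have gB: "\<exists>B. \<forall>y\<in>\<Omega>. B \<le> g i y" for i
    proof -
      have "compact (g i ` \<Omega>)" unfolding g_def divide_inverse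
        by (intro compact_continuous_image \<Omega> continuous_intros continuous_on_subset[OF \<Phi>c]) auto
      then obtain B where "\<And>y. y \<in> \<Omega> \<Longrightarrow> \<bar>g i y\<bar> \<le> B"
        using compact_imp_bounded[of "g i ` \<Omega>"] by (auto simp: bounded_iff)
      then show ?thesis by (intro exI[of _ "-B"]) (force simp: abs_le_iff)
    qed
    \<comment> \<open>Its negative \<open>u i\<close> is squeezed between
      \<open>(m i + \<Phi> i) / lam i\<close> and \<open>- \<Psi> i / lam i\<close> on \<Omega>: the
      lower bound preserves the dual value, the upper one gives feasibility because the \<Psi> sum
      to zero.\<close>
    define v where "v i y = (INF x\<in>\<Omega>. g i x + dist y x)" for i y
    define u where "u i y = - v i y" for i y
    have vlip: "1-lipschitz_on UNIV (v i)" for i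
      unfolding v_def using gB[of i] inf_convolution_lipschitz(1)[OF ne, of _ "g i"] by blast
    have ulip: "1-lipschitz_on UNIV (u i)" for i
    proof (rule lipschitz_onI)
      show "dist (u i x) (u i y) \<le> 1 * dist x y" for x y
        using lipschitz_onD[OF vlip[of i], of x y] by (simp add: u_def dist_minus)
    qed simp
    have v1: "\<Psi> i y / lam i \<le> v i y" if "i < N" "y \<in> \<Omega>" for i y
      unfolding v_def
    proof (rule cINF_greatest[OF ne])
      fix x assume "x \<in> \<Omega>"
      from le'[OF that(1) this that(2)] lam[OF that(1)]
      show "\<Psi> i y / lam i \<le> g i x + dist y x"
        by (simp add: g_def field_simps dist_commute)
    qed
    have v2: "(m i + \<Phi> i x) / lam i \<le> u i x" if x: "x \<in> \<Omega>" for i x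
    proof -
      obtain B where "\<forall>y\<in>\<Omega>. B \<le> g i y" using gB by blast
      then have "v i x \<le> g i x + dist x x"
        unfolding v_def using x by (intro inf_convolution_lipschitz(2)[OF ne, of B "g i"]) auto
      then show ?thesis unfolding u_def g_def minus_divide_left[symmetric] dist_self by linarith
    qed
    have neg: "(\<Sum>i<N. lam i * u i x) \<le> 0" if x: "x \<in> \<Omega>" for x
    proof -
      have "(\<Sum>i<N. lam i * u i x) \<le> (\<Sum>i<N. - \<Psi> i x)"
      proof (rule sum_mono)
        fix i assume "i \<in> {..<N}"
        with v1[of i x] x lam[of i] show "lam i * u i x \<le> - \<Psi> i x"
          by (simp add: u_def field_simps)
      qed
      then show ?thesis by (simp add: sum_negf sum\<Psi>)
    qed
    have ige: "m i + integral\<^sup>L (\<nu>s i) (\<Phi> i) \<le> lam i * integral\<^sup>L (\<nu>s i) (u i)" if i: "i < N" for i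
    proof -
      interpret prob_space "\<nu>s i" by (rule prob_onD(1)[OF \<nu>s[OF i]])
      have uc: "continuous_on UNIV (u i)" by (rule lipschitz_on_UNIV_continuous[OF ulip])
      have "m i + integral\<^sup>L (\<nu>s i) (\<Phi> i) = (\<integral>x. m i + \<Phi> i x \<partial>\<nu>s i)"
        using prob_on_integrable[OF \<nu>s[OF i] \<Omega> \<Phi>c] by (simp add: prob_space)
      also have "\<dots> \<le> (\<integral>x. lam i * u i x \<partial>\<nu>s i)"
      proof (rule integral_mono_AE)
        show "AE x in \<nu>s i. m i + \<Phi> i x \<le> lam i * u i x"
          using prob_on_AE[OF \<nu>s[OF i] cl]
        proof eventually_elim
          case (elim x)
          from v2[OF this, of i] lam[OF i] show ?case by (simp add: field_simps)
        qed
      qed (auto intro!: prob_on_integrable[OF \<nu>s[OF i] \<Omega>] continuous_intros \<Phi>c uc)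
      finally show ?thesis by simp
    qed
    have "(\<Sum>i<N. m i) + (\<Sum>j<n. a j * b j) \<le> (\<Sum>i<N. lam i * integral\<^sup>L (\<nu>s i) (u i))"
      unfolding ab sum.distrib[symmetric] by (intro sum_mono ige) auto
    moreover have "(\<Sum>i<N. integral\<^sup>L (\<gamma> i) (c i)) = (\<Sum>i<N. lam i * (\<integral>z. dist (fst z) (snd z) \<partial>(\<gamma> i)))"
      using lam by (intro sum.cong) (auto simp: c_def less_imp_le)
    ultimately show ?thesis using val ulip neg by (intro exI[of _ u]) auto
  qed
  then show thesis using that \<mu> gc by blast
qed

text \<open>Uniform Lipschitz bounds give compactness only after normalisation. Shifts by constants
  with zero weighted sum change neither the constraint nor the value, so the individual potentials
  can be pinned together at one point.\<close>

lemma dual_potentials_limit: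
  fixes \<Omega> :: "'a::euclidean_space set" and N :: nat and lam :: "nat \<Rightarrow> real"
  assumes \<Omega>: "compact \<Omega>" and lam: "\<And>i. i < N \<Longrightarrow> lam i > 0" "(\<Sum>i<N. lam i) = 1"
    and \<nu>s: "\<And>i. i < N \<Longrightarrow> \<nu>s i \<in> prob_on \<Omega>"
    and P: "\<forall>\<delta>>0. \<exists>u. (\<forall>i. 1-lipschitz_on UNIV (u i)) \<and> (\<forall>x\<in>\<Omega>. (\<Sum>i<N. lam i * u i x) \<le> 0) \<and>
       P - \<delta> \<le> (\<Sum>i<N. lam i * integral\<^sup>L (\<nu>s i) (u i))"
  shows "\<exists>u. (\<forall>i<N. 1-lipschitz_on UNIV (u i)) \<and> (\<forall>x\<in>\<Omega>. (\<Sum>i<N. lam i * u i x) \<le> 0) \<and>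
       P \<le> (\<Sum>i<N. lam i * integral\<^sup>L (\<nu>s i) (u i))"
proof -
  have N: "N > 0" using lam(2) by (cases N) auto
  have cl: "closed \<Omega>" by (rule compact_imp_closed[OF \<Omega>])
  have ne: "\<Omega> \<noteq> {}" by (rule prob_on_nonempty[OF \<nu>s[OF N]])
  then obtain x0 where x0: "x0 \<in> \<Omega>" by blast
  define D where "D = diameter \<Omega>"
  have D: "dist x y \<le> D" if "x \<in> \<Omega>" "y \<in> \<Omega>" for x y
    unfolding D_def using diameter_bounded_bound[OF compact_imp_bounded[OF \<Omega>]] that by blast
  have "\<forall>n. \<exists>u. (\<forall>i. 1-lipschitz_on UNIV (u i)) \<and> (\<forall>x\<in>\<Omega>. (\<Sum>i<N. lam i * u i x) \<le> 0) \<and>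
       P - 1 / Suc n \<le> (\<Sum>i<N. lam i * integral\<^sup>L (\<nu>s i) (u i))"
  proof
    fix n show "\<exists>u. (\<forall>i. 1-lipschitz_on UNIV (u i)) \<and> (\<forall>x\<in>\<Omega>. (\<Sum>i<N. lam i * u i x) \<le> 0) \<and>
       P - 1 / Suc n \<le> (\<Sum>i<N. lam i * integral\<^sup>L (\<nu>s i) (u i))"
      by (rule P[rule_format]) simp
  qed
  then obtain U where U: "\<forall>n. (\<forall>i. 1-lipschitz_on UNIV (U n i)) \<and> (\<forall>x\<in>\<Omega>. (\<Sum>i<N. lam i * U n i x) \<le> 0) \<and>
       P - 1 / Suc n \<le> (\<Sum>i<N. lam i * integral\<^sup>L (\<nu>s i) (U n i))"
    unfolding choice_iff ..
  have U1: "1-lipschitz_on UNIV (U n i)" and U2: "x \<in> \<Omega> \<Longrightarrow> (\<Sum>i<N. lam i * U n i x) \<le> 0"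
    and U3: "P - 1 / Suc n \<le> (\<Sum>i<N. lam i * integral\<^sup>L (\<nu>s i) (U n i))" for n i x
    using U by blast+
  define t where "t n = (\<Sum>i<N. lam i * U n i x0)" for n
  \<comment> \<open>All components now take the common value \<open>t n\<close> at
    \<open>x0\<close>; since the weights sum to 1, the total shift cancels.\<close>
  define w where "w n i x = U n i x - U n i x0 + t n" for n i x
  have w1: "1-lipschitz_on UNIV (w n i)" for n i
  proof (rule lipschitz_onI)
    show "dist (w n i x) (w n i y) \<le> 1 * dist x y" for x y
      using lipschitz_onD[OF U1[of n i], of x y] by (simp add: w_def dist_real_def)
  qed simp
  have wc: "continuous_on UNIV (w n i)" for n i by (rule lipschitz_on_UNIV_continuous[OF w1])
  have shift: "(\<Sum>i<N. lam i * (X i - U n i x0 + t n)) = (\<Sum>i<N. lam i * X i)" for X n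
  proof -
    have "(\<Sum>i<N. lam i * (X i - U n i x0 + t n)) = (\<Sum>i<N. lam i * X i) - t n + (\<Sum>i<N. lam i) * t n"
      unfolding t_def sum_subtractf[symmetric] sum_distrib_right sum.distrib[symmetric]
      by (intro sum.cong refl) (simp add: algebra_simps)
    then show ?thesis by (simp add: lam(2))
  qed
  have w2: "(\<Sum>i<N. lam i * w n i x) \<le> 0" if "x \<in> \<Omega>" for n x
    unfolding w_def shift by (rule U2[OF that])
  have wint: "integral\<^sup>L (\<nu>s i) (w n i) = integral\<^sup>L (\<nu>s i) (U n i) - U n i x0 + t n" if i: "i < N" for n i
  proof -
    interpret prob_space "\<nu>s i" by (rule prob_onD(1)[OF \<nu>s[OF i]])
    show ?thesis unfolding w_def
      using prob_on_integrable[OF \<nu>s[OF i] \<Omega> lipschitz_on_UNIV_continuous[OF U1]] by (simp add: prob_space)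
  qed
  have w3: "P - 1 / Suc n \<le> (\<Sum>i<N. lam i * integral\<^sup>L (\<nu>s i) (w n i))" for n
  proof -
    have "(\<Sum>i<N. lam i * integral\<^sup>L (\<nu>s i) (w n i)) = (\<Sum>i<N. lam i * integral\<^sup>L (\<nu>s i) (U n i))"
      unfolding shift[of "\<lambda>i. integral\<^sup>L (\<nu>s i) (U n i)" n, symmetric]
      by (intro sum.cong refl) (simp add: wint)
    then show ?thesis using U3 by simp
  qed
  have wt: "\<bar>w n i x - t n\<bar> \<le> D" if "x \<in> \<Omega>" for n i x
    using lipschitz_onD[OF U1[of n i], of x x0] D[OF that x0] by (simp add: w_def dist_real_def)
  have t0: "t n \<le> 0" for n unfolding t_def by (rule U2[OF x0])
  \<comment> \<open>Each integral is at most \<open>t n + D\<close>, so a value close to P prevents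
    \<open>t n\<close> from drifting to minus infinity; feasibility at \<open>x0\<close> bounds it
    above by 0.\<close>
  have t1: "P - 1 - D \<le> t n" for n
  proof -
    have "integral\<^sup>L (\<nu>s i) (w n i) \<le> t n + D" if i: "i < N" for i
    proof -
      interpret prob_space "\<nu>s i" by (rule prob_onD(1)[OF \<nu>s[OF i]])
      have "integral\<^sup>L (\<nu>s i) (w n i) \<le> (\<integral>x. t n + D \<partial>\<nu>s i)"
      proof (rule integral_mono_AE)
        show "AE x in \<nu>s i. w n i x \<le> t n + D"
          using prob_on_AE[OF \<nu>s[OF i] cl]
        proof eventually_elim
          case (elim x)
          from wt[OF this, of n i] show ?case by (simp add: abs_le_iff)
        qed
      qed (auto intro!: prob_on_integrable[OF \<nu>s[OF i] \<Omega> wc])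
      then show ?thesis by (simp add: prob_space)
    qed
    then have "(\<Sum>i<N. lam i * integral\<^sup>L (\<nu>s i) (w n i)) \<le> (\<Sum>i<N. lam i * (t n + D))"
      using lam(1) by (intro sum_mono mult_left_mono) (auto simp: less_imp_le)
    also have "\<dots> = t n + D" by (simp add: sum_distrib_right[symmetric] lam(2))
    finally have "P - 1 / Suc n \<le> t n + D" using w3[of n] by linarith
    moreover have "1 / real (Suc n) \<le> 1" by simp
    ultimately show ?thesis by linarith
  qed
  \<comment> \<open>The common value is at most \<open>\<bar>P\<bar> + 1 + D\<close> in size, and
    the oscillation over \<Omega> adds another D.\<close>
  define B where "B = \<bar>P\<bar> + 1 + 2 * D"
  have D0: "0 \<le> D" using D[OF x0 x0] by simp
  have wB: "\<bar>w n i x\<bar> \<le> B" if "x \<in> \<Omega>" for n i x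
    using wt[OF that, of n i] t0[of n] t1[of n] D0 unfolding B_def by linarith
  \<comment> \<open>The index becomes a real coordinate, so that one application of Arzela-Ascoli
    extracts a subsequence for all components at once.\<close>
  define S where "S = real ` {..<N} \<times> \<Omega>"
  have S: "compact S" unfolding S_def by (intro compact_Times finite_imp_compact \<Omega>) auto
  define F where "F n p = w n (nat \<lfloor>fst p\<rfloor>) (snd p)" for n and p :: "real \<times> 'a"
  have FB: "norm (F n p) \<le> B" if "p \<in> S" for n p
    using that wB by (auto simp: S_def F_def)
  have eq: "\<exists>d. 0 < d \<and> (\<forall>n q. q \<in> S \<and> norm (p - q) < d \<longrightarrow> norm (F n p - F n q) < e)"
    if p: "p \<in> S" and e: "0 < e" for p e
  \<comment> \<open>Distinct indices are at distance at least 1, so the bound 1 forces both points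
    into the same copy of \<Omega>, where the 1-Lipschitz bound gives e.\<close>
  proof (intro exI[of _ "min 1 e"] conjI allI impI)
    fix n q assume q: "q \<in> S \<and> norm (p - q) < min 1 e"
    obtain i x where ix: "p = (real i, x)" using p by (auto simp: S_def)
    obtain j y where jy: "q = (real j, y)" using q by (auto simp: S_def)
    have "\<bar>real i - real j\<bar> < 1" using norm_fst_le[where x = "real i - real j" and y = "x - y"] q by (simp add: ix jy)
    then have "i = j" by linarith
    have "\<bar>w n i x - w n i y\<bar> \<le> norm (x - y)"
      using lipschitz_onD[OF w1[of n i], of x y] by (simp add: dist_real_def dist_norm)
    also have "\<dots> < e" using norm_snd_le[where x = "real i - real j" and y = "x - y"] q by (simp add: ix jy)
    finally show "norm (F n p - F n q) < e" by (simp add: F_def ix jy \<open>i = j\<close>)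
  qed (use e in simp)
  define conv where "conv g k \<longleftrightarrow> strict_mono k \<and>
      (\<forall>e>0. \<exists>M. \<forall>n p. n \<ge> M \<and> p \<in> S \<longrightarrow> norm (F (k n) p - g p) < e)" for g and k :: "nat \<Rightarrow> nat"
  have "\<exists>g k. conv g k"
  proof (rule Arzela_Ascoli[of S F B, OF S FB eq])
    fix g k assume "strict_mono (k :: nat \<Rightarrow> nat)"
      "\<And>e. 0 < e \<Longrightarrow> \<exists>M. \<forall>n p. n \<ge> M \<and> p \<in> S \<longrightarrow> norm (F (k n) p - g p) < e"
    then have "conv g k" by (simp add: conv_def)
    then show ?thesis by blast
  qed
  then obtain g k where gk: "conv g k" by blast
  have k: "strict_mono k" using gk by (simp add: conv_def)
  have lim: "(\<lambda>n. w (k n) i x) \<longlonglongrightarrow> g (real i, x)" if "i < N" "x \<in> \<Omega>" for i x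
  proof (rule LIMSEQ_I)
    fix e :: real assume "0 < e"
    then obtain M where "\<forall>n p. n \<ge> M \<and> p \<in> S \<longrightarrow> norm (F (k n) p - g p) < e"
      using gk unfolding conv_def by auto
    moreover have "(real i, x) \<in> S" using that by (auto simp: S_def)
    ultimately have "\<forall>n\<ge>M. norm (F (k n) (real i, x) - g (real i, x)) < e" by auto
    then show "\<exists>M. \<forall>n\<ge>M. norm (w (k n) i x - g (real i, x)) < e" by (auto simp: F_def)
  qed
  have glip: "1-lipschitz_on \<Omega> (\<lambda>x. g (real i, x))" if i: "i < N" for i
  proof (rule lipschitz_onI)
    fix x y assume xy: "x \<in> \<Omega>" "y \<in> \<Omega>"
    have "(\<lambda>n. dist (w (k n) i x) (w (k n) i y)) \<longlonglongrightarrow> dist (g (real i, x)) (g (real i, y))"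
      by (intro tendsto_dist lim i xy)
    then show "dist (g (real i, x)) (g (real i, y)) \<le> 1 * dist x y"
      by (rule LIMSEQ_le_const2) (use lipschitz_onD[OF w1, of x y] in auto)
  qed simp
  have "\<forall>i. \<exists>v. i < N \<longrightarrow> 1-lipschitz_on UNIV v \<and> (\<forall>x\<in>\<Omega>. v x = g (real i, x))"
  proof
    fix i show "\<exists>v. i < N \<longrightarrow> 1-lipschitz_on UNIV v \<and> (\<forall>x\<in>\<Omega>. v x = g (real i, x))"
      using lipschitz_extension[OF glip \<Omega> ne, of i] by (cases "i < N") auto
  qed
  then obtain v where *: "\<forall>i. i < N \<longrightarrow> 1-lipschitz_on UNIV (v i) \<and> (\<forall>x\<in>\<Omega>. v i x = g (real i, x))"
    unfolding choice_iff ..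
  have v: "1-lipschitz_on UNIV (v i)" and vg: "x \<in> \<Omega> \<Longrightarrow> v i x = g (real i, x)" if "i < N" for i x
    using * that by simp_all
  have limv: "(\<lambda>n. w (k n) i x) \<longlonglongrightarrow> v i x" if "i < N" "x \<in> \<Omega>" for i x
    using lim[OF that] vg[OF that] by simp
  have "(\<Sum>i<N. lam i * v i x) \<le> 0" if x: "x \<in> \<Omega>" for x
  proof (rule LIMSEQ_le_const2)
    show "(\<lambda>n. \<Sum>i<N. lam i * w (k n) i x) \<longlonglongrightarrow> (\<Sum>i<N. lam i * v i x)"
      by (intro tendsto_intros limv x) auto
  qed (use w2[OF x] in auto)
  moreover have "P \<le> (\<Sum>i<N. lam i * integral\<^sup>L (\<nu>s i) (v i))"
  proof -
    have il: "(\<lambda>n. integral\<^sup>L (\<nu>s i) (w (k n) i)) \<longlonglongrightarrow> integral\<^sup>L (\<nu>s i) (v i)" if i: "i < N" for i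
    proof (rule integral_dominated_convergence[where w = "\<lambda>_. B"])
      interpret prob_space "\<nu>s i" by (rule prob_onD(1)[OF \<nu>s[OF i]])
      show "integrable (\<nu>s i) (\<lambda>_. B)" by simp
      show "v i \<in> borel_measurable (\<nu>s i)"
        by (intro prob_on_measurable[OF \<nu>s[OF i]] borel_measurable_continuous_onI lipschitz_on_UNIV_continuous[OF v[OF i]])
      show "w (k n) i \<in> borel_measurable (\<nu>s i)" for n
        by (intro prob_on_measurable[OF \<nu>s[OF i]] borel_measurable_continuous_onI wc)
      show "AE x in \<nu>s i. (\<lambda>n. w (k n) i x) \<longlonglongrightarrow> v i x"
        using prob_on_AE[OF \<nu>s[OF i] cl] by eventually_elim (rule limv[OF i])
      show "AE x in \<nu>s i. norm (w (k n) i x) \<le> B" for n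
        using prob_on_AE[OF \<nu>s[OF i] cl] by eventually_elim (simp add: wB)
    qed
    have 1: "(\<lambda>n. \<Sum>i<N. lam i * integral\<^sup>L (\<nu>s i) (w (k n) i)) \<longlonglongrightarrow> (\<Sum>i<N. lam i * integral\<^sup>L (\<nu>s i) (v i))"
      by (intro tendsto_intros il) auto
    have 2: "(\<lambda>n. P - 1 / Suc (k n)) \<longlonglongrightarrow> P - 0"
      using LIMSEQ_subseq_LIMSEQ[OF LIMSEQ_inverse_real_of_nat k]
      by (intro tendsto_intros) (simp add: o_def inverse_eq_divide)
    have "P - 0 \<le> (\<Sum>i<N. lam i * integral\<^sup>L (\<nu>s i) (v i))"
      by (rule LIMSEQ_le[OF 2 1]) (use w3 in auto)
    then show ?thesis by simp
  qed
  ultimately show ?thesis using v by (intro exI[of _ v]) simp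
qed

lemma barycentre_duality:
  fixes \<Omega> :: "'a::euclidean_space set" and N :: nat and lam :: "nat \<Rightarrow> real"
  assumes \<Omega>: "compact \<Omega>" and lam: "\<And>i. i < N \<Longrightarrow> lam i > 0" "(\<Sum>i<N. lam i) = 1"
    and \<nu>s: "\<And>i. i < N \<Longrightarrow> \<nu>s i \<in> prob_on \<Omega>"
  obtains \<mu> \<gamma> u where "\<mu> \<in> prob_on \<Omega>" "\<forall>i<N. \<gamma> i \<in> couplings (\<nu>s i) \<mu>"
    "\<forall>i<N. 1-lipschitz_on UNIV (u i)" "\<forall>x\<in>\<Omega>. (\<Sum>i<N. lam i * u i x) \<le> 0"
    "(\<Sum>i<N. lam i * (\<integral>z. dist (fst z) (snd z) \<partial>(\<gamma> i))) \<le> (\<Sum>i<N. lam i * integral\<^sup>L (\<nu>s i) (u i))"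
proof -
  have N: "N > 0" using lam(2) by (cases N) auto
  obtain \<mu> \<gamma> where \<mu>: "\<mu> \<in> prob_on \<Omega>" "\<forall>i<N. \<gamma> i \<in> couplings (\<nu>s i) \<mu>" and
    P: "\<forall>\<delta>>0. \<exists>u. (\<forall>i. 1-lipschitz_on UNIV (u i)) \<and> (\<forall>x\<in>\<Omega>. (\<Sum>i<N. lam i * u i x) \<le> 0) \<and>
       (\<Sum>i<N. lam i * (\<integral>z. dist (fst z) (snd z) \<partial>(\<gamma> i))) - \<delta> \<le> (\<Sum>i<N. lam i * integral\<^sup>L (\<nu>s i) (u i))"
    by (rule barycentre_duality_approx[of \<Omega> N lam \<nu>s, OF \<Omega> lam(1) N \<nu>s])
  from dual_potentials_limit[OF \<Omega> lam \<nu>s P] obtain u where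
    "(\<forall>i<N. 1-lipschitz_on UNIV (u i)) \<and> (\<forall>x\<in>\<Omega>. (\<Sum>i<N. lam i * u i x) \<le> 0) \<and>
     (\<Sum>i<N. lam i * (\<integral>z. dist (fst z) (snd z) \<partial>(\<gamma> i))) \<le> (\<Sum>i<N. lam i * integral\<^sup>L (\<nu>s i) (u i))" ..
  with that[OF \<mu>, of u] show thesis by simp
qed

section \<open>Smooth potentials and flows\<close>

lemma C1_grad_continuous:
  assumes "C1_grad \<phi> G"
  shows "continuous_on UNIV \<phi>" "continuous_on UNIV G"
proof -
  have "(\<phi> has_derivative (\<lambda>h. G x \<bullet> h)) (at x)" for x using assms by (simp add: C1_grad_def)
  then show "continuous_on UNIV \<phi>"
    by (rule has_derivative_continuous_on[OF has_derivative_at_withinI])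
  show "continuous_on UNIV G" using assms by (simp add: C1_grad_def)
qed

text \<open>A 1-Lipschitz function is an infimum of cones over a finite net up to a small error;
  smoothing the cones and replacing the minimum by a soft minimum makes it C1 without increasing
  the Lipschitz constant.\<close>

lemma lipschitz_smooth_approx:
  fixes \<Omega> :: "'a::euclidean_space set" and u :: "'a \<Rightarrow> real"
  assumes \<Omega>: "compact \<Omega>" "\<Omega> \<noteq> {}" and u: "1-lipschitz_on UNIV u" and \<epsilon>: "\<epsilon> > 0"
  shows "\<exists>U G. C1_grad U G \<and> (\<forall>x. norm (G x) \<le> 1) \<and> 1-lipschitz_on UNIV U \<and>
     (\<forall>x\<in>\<Omega>. \<bar>U x - u x\<bar> \<le> \<epsilon>)"
proof -
  obtain Z where Z: "Z \<subseteq> \<Omega>" "finite Z" "\<Omega> \<subseteq> (\<Union>z\<in>Z. ball z (\<epsilon> / 4))"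
    using compactE_image[OF \<Omega>(1), of \<Omega> "\<lambda>z. ball z (\<epsilon> / 4)"] \<epsilon> by force
  then have Z0: "Z \<noteq> {}" using \<Omega>(2) by auto
  have cZ: "1 \<le> real (card Z)" using Z(2) Z0 by (simp add: Suc_leI card_gt_0_iff)
  define l where "l = ln (real (card Z))"
  have l: "0 \<le> l" using cZ by (simp add: l_def)
  \<comment> \<open>Smoothing a cone costs \<delta>, and the soft minimum over \<open>Z\<close>
    costs \<delta> times the logarithm of its cardinality; both are kept below a quarter of
    \<epsilon>.\<close>
  define \<delta> where "\<delta> = \<epsilon> / (4 * (1 + l))"
  have \<delta>: "0 < \<delta>" "\<delta> \<le> \<epsilon> / 4" "\<delta> * l \<le> \<epsilon> / 4"
    using \<epsilon> l by (auto simp: \<delta>_def field_simps)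
  define r where "r z x = sqrt ((x - z) \<bullet> (x - z) + \<delta>\<^sup>2)" for z x :: 'a
  define g where "g z x = u z + r z x" for z x
  define E where "E x = (\<Sum>z\<in>Z. exp (- g z x / \<delta>))" for x
  define U where "U x = - \<delta> * ln (E x)" for x
  \<comment> \<open>The gradient of the soft minimum is a convex combination of the gradients of the
    smoothed cones, so its norm is at most 1.\<close>
  define G where "G x = (\<Sum>z\<in>Z. (exp (- g z x / \<delta>) / E x) *\<^sub>R ((x - z) /\<^sub>R r z x))" for x
  have q0: "0 < (x - z) \<bullet> (x - z) + \<delta>\<^sup>2" for x z :: 'a
    using \<delta>(1) by (intro add_nonneg_pos) auto
  have r0: "0 < r z x" for z x using q0 by (simp add: r_def)
  have rn: "norm (x - z) \<le> r z x" for z x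
    unfolding r_def norm_eq_sqrt_inner by simp
  have rn2: "r z x \<le> norm (x - z) + \<delta>" for z x
    unfolding r_def norm_eq_sqrt_inner
    using sqrt_add_le_add_sqrt[of "(x - z) \<bullet> (x - z)" "\<delta>\<^sup>2"] \<delta>(1) by simp
  have E0: "0 < E x" for x unfolding E_def using Z(2) Z0 by (intro sum_pos) auto
  have gd: "(g z has_derivative (\<lambda>h. ((x - z) /\<^sub>R r z x) \<bullet> h)) (at x)" for z x
  proof -
    have "((\<lambda>x. x - z) has_derivative (\<lambda>h. h)) (at x)"
      using has_derivative_diff[OF has_derivative_ident has_derivative_const, of z "at x"] by simp
    from has_derivative_add[OF has_derivative_inner[OF this this] has_derivative_const[of "\<delta>\<^sup>2"]]
    have "((\<lambda>x. (x - z) \<bullet> (x - z) + \<delta>\<^sup>2) has_derivative (\<lambda>h. 2 * ((x - z) \<bullet> h))) (at x)"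
      by (simp add: inner_commute)
    from DERIV_compose_FDERIV[OF DERIV_real_sqrt[OF q0] this]
    have "(r z has_derivative (\<lambda>h. 2 * ((x - z) \<bullet> h) * (inverse (r z x) / 2))) (at x)"
      unfolding r_def .
    from has_derivative_add[OF has_derivative_const[of "u z"] this]
    show ?thesis unfolding g_def[abs_def] by (simp add: mult.commute)
  qed
  have Ed: "(E has_derivative (\<lambda>h. \<Sum>z\<in>Z. - ((((x - z) /\<^sub>R r z x) \<bullet> h) / \<delta>) * exp (- g z x / \<delta>))) (at x)" for x
    unfolding E_def[abs_def]
  proof (rule has_derivative_sum)
    fix z
    have "((\<lambda>x. - g z x / \<delta>) has_derivative (\<lambda>h. - ((((x - z) /\<^sub>R r z x) \<bullet> h) / \<delta>))) (at x)"
      using has_derivative_mult_right[OF gd[of z x], of "- 1 / \<delta>"] by simp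
    from DERIV_compose_FDERIV[OF DERIV_exp this]
    show "((\<lambda>x. exp (- g z x / \<delta>)) has_derivative (\<lambda>h. - ((((x - z) /\<^sub>R r z x) \<bullet> h) / \<delta>) * exp (- g z x / \<delta>))) (at x)" .
  qed
  have Ud: "(U has_derivative (\<lambda>h. G x \<bullet> h)) (at x)" for x
  proof -
    have "(U has_derivative (\<lambda>h. - \<delta> * ((\<Sum>z\<in>Z. - ((((x - z) /\<^sub>R r z x) \<bullet> h) / \<delta>) * exp (- g z x / \<delta>)) * inverse (E x)))) (at x)"
      unfolding U_def[abs_def]
      by (rule has_derivative_mult_right[OF DERIV_compose_FDERIV[OF DERIV_ln[OF E0] Ed]])
    moreover have "- \<delta> * ((\<Sum>z\<in>Z. - ((((x - z) /\<^sub>R r z x) \<bullet> h) / \<delta>) * exp (- g z x / \<delta>)) * inverse (E x)) = G x \<bullet> h" for h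
    proof -
      have alg: "- \<delta> * (- (q / \<delta>) * e * inverse c) = e / c * q" for q e c
        using \<delta>(1) by (simp add: field_simps)
      show ?thesis
        unfolding G_def inner_sum_left sum_distrib_left sum_distrib_right
        by (intro sum.cong refl) (simp only: alg inner_scaleR_left)
    qed
    ultimately show ?thesis by simp
  qed
  have gc: "continuous_on UNIV (g z)" for z
    by (rule has_derivative_continuous_on[OF has_derivative_at_withinI[OF gd]])
  have Ec: "continuous_on UNIV E"
    by (rule has_derivative_continuous_on[OF has_derivative_at_withinI[OF Ed]])
  have rc: "continuous_on UNIV (r z)" for z
    unfolding r_def by (intro continuous_intros)
  have "continuous_on UNIV G"
    unfolding G_def using E0 r0 \<delta>(1)
    by (intro continuous_intros gc Ec rc) (auto simp: less_le)
  with Ud have C1: "C1_grad U G" by (auto simp: C1_grad_def)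
  have Gn: "norm (G x) \<le> 1" for x
  proof -
    have "norm (G x) \<le> (\<Sum>z\<in>Z. exp (- g z x / \<delta>) / E x)"
      unfolding G_def
    proof (rule sum_norm_le)
      fix z
      have n1: "norm ((x - z) /\<^sub>R r z x) \<le> 1"
        unfolding norm_scaleR using rn[of x z] r0[of z x] by (simp add: field_simps)
      have "norm ((exp (- g z x / \<delta>) / E x) *\<^sub>R ((x - z) /\<^sub>R r z x))
          = exp (- g z x / \<delta>) / E x * norm ((x - z) /\<^sub>R r z x)"
        unfolding norm_scaleR[of "exp (- g z x / \<delta>) / E x"] using E0[of x] by simp
      also have "\<dots> \<le> exp (- g z x / \<delta>) / E x"
        by (rule mult_left_le[OF n1]) (use E0[of x] in \<open>simp add: less_imp_le\<close>)
      finally show "norm ((exp (- g z x / \<delta>) / E x) *\<^sub>R ((x - z) /\<^sub>R r z x)) \<le> exp (- g z x / \<delta>) / E x" .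
    qed
    also have "\<dots> = 1" unfolding sum_divide_distrib[symmetric] using E0[of x] by (simp add: E_def)
    finally show ?thesis .
  qed
  have Ulip: "1-lipschitz_on UNIV U"
  proof (rule lipschitz_onI)
    fix x y
    have "norm (U x - U y) \<le> 1 * norm (x - y)"
    proof (rule differentiable_bound[of UNIV U "\<lambda>x h. G x \<bullet> h"])
      show "onorm (\<lambda>h. G z \<bullet> h) \<le> 1" for z
      proof (rule onorm_le)
        fix h
        have "\<bar>G z \<bullet> h\<bar> \<le> norm (G z) * norm h" by (rule Cauchy_Schwarz_ineq2)
        also have "\<dots> \<le> 1 * norm h" by (intro mult_right_mono Gn) simp
        finally show "norm (G z \<bullet> h) \<le> 1 * norm h" by simp
      qed
    qed (use Ud in auto)
    then show "dist (U x) (U y) \<le> 1 * dist x y" by (simp add: dist_norm)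
  qed simp
  have "\<bar>U x - u x\<bar> \<le> \<epsilon>" if x: "x \<in> \<Omega>" for x
  proof -
    \<comment> \<open>Upper bound: the cone at a net point within \<epsilon>/4 contributes
      \<epsilon>/4 from the Lipschitz bound, \<epsilon>/4 from the distance and \<delta> from
      smoothing. Lower bound: every smoothed cone lies above u, so only the entropy term
      \<open>\<delta> * l\<close> is lost.\<close>
    obtain z where z: "z \<in> Z" "dist z x < \<epsilon> / 4" using Z(3) x by auto
    have "exp (- g z x / \<delta>) \<le> E x"
      unfolding E_def by (rule member_le_sum[OF z(1)]) (use Z(2) in auto)
    then have "- g z x / \<delta> \<le> ln (E x)" using E0[of x] by (subst ln_ge_iff) auto
    then have "U x \<le> g z x" using \<delta>(1) by (simp add: U_def field_simps)
    moreover have "u z \<le> u x + dist z x"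
      using lipschitz_onD[OF u, of z x] by (simp add: dist_real_def abs_le_iff)
    ultimately have up: "U x \<le> u x + \<epsilon>"
      using rn2[of z x] z(2) \<delta>(2) \<epsilon>
      unfolding g_def dist_norm norm_minus_commute[of z x] by linarith
    have "E x \<le> (\<Sum>z\<in>Z. exp (- u x / \<delta>))"
      unfolding E_def
    proof (rule sum_mono)
      fix z
      have "u x \<le> u z + norm (x - z)"
        using lipschitz_onD[OF u, of x z] by (simp add: dist_real_def abs_le_iff dist_norm)
      also have "\<dots> \<le> g z x" using rn[of x z] by (simp add: g_def)
      finally show "exp (- g z x / \<delta>) \<le> exp (- u x / \<delta>)" using \<delta>(1) by (simp add: field_simps)
    qed
    also have "\<dots> = real (card Z) * exp (- u x / \<delta>)" by simp
    finally have "ln (E x) \<le> ln (real (card Z) * exp (- u x / \<delta>))"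
      using E0[of x] by (intro ln_mono) auto
    also have "\<dots> = l - u x / \<delta>" using cZ by (subst ln_mult) (auto simp: l_def)
    finally have "\<delta> * ln (E x) \<le> \<delta> * l - u x" using \<delta>(1) by (simp add: field_simps)
    then have "u x - \<epsilon> \<le> U x" using \<delta>(3) \<epsilon> by (simp add: U_def)
    with up show ?thesis by linarith
  qed
  with C1 Gn Ulip show ?thesis by (intro exI[of _ U] exI[of _ G]) simp
qed

lemma prob_on_integral_close:
  fixes f g :: "'a::euclidean_space \<Rightarrow> real"
  assumes M: "M \<in> prob_on \<Omega>" and \<Omega>: "compact \<Omega>" and c: "continuous_on UNIV f" "continuous_on UNIV g"
    and le: "\<And>x. x \<in> \<Omega> \<Longrightarrow> \<bar>f x - g x\<bar> \<le> e"
  shows "\<bar>integral\<^sup>L M f - integral\<^sup>L M g\<bar> \<le> e"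
proof -
  interpret prob_space M by (rule prob_onD(1)[OF M])
  have i: "integrable M f" "integrable M g" using prob_on_integrable[OF M \<Omega>] c by auto
  have "\<bar>integral\<^sup>L M f - integral\<^sup>L M g\<bar> = \<bar>\<integral>x. f x - g x \<partial>M\<bar>" using i by simp
  also have "\<dots> \<le> (\<integral>x. \<bar>f x - g x\<bar> \<partial>M)" using integral_norm_bound[of M "\<lambda>x. f x - g x"] by simp
  also have "\<dots> \<le> (\<integral>x. e \<partial>M)"
    using prob_on_AE[OF M compact_imp_closed[OF \<Omega>]] i
    by (intro integral_mono_AE) (auto elim!: eventually_mono intro: le)
  finally show ?thesis by (simp add: prob_space)
qed

section \<open>Flows tested against Lipschitz potentials\<close>

lemma fmeas_onD:
  assumes "M \<in> fmeas_on \<Omega>"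
  shows "finite_measure M" "sets M = sets borel" "space M = UNIV" "emeasure M (- \<Omega>) = 0"
  using assms sets_eq_imp_space_eq[of M borel] by (auto simp: fmeas_on_def)

lemma fmeas_on_measurable:
  assumes "M \<in> fmeas_on \<Omega>" "f \<in> borel_measurable borel"
  shows "f \<in> borel_measurable M"
  using assms measurable_cong_sets[of M borel borel borel] by (auto simp: fmeas_on_def)

text \<open>The divergence equation accepts only C1 test functions, so v is replaced by a smooth
  function with gradient at most 1; Cauchy-Schwarz then bounds the pairing pointwise by the norm of
  g.\<close>

lemma lipschitz_integral_le_flow:
  fixes \<Omega> :: "'a::euclidean_space set"
  assumes \<Omega>: "compact \<Omega>" and m: "m \<in> fmeas_on \<Omega>" and g: "g \<in> borel_measurable borel"
    and gi: "integrable m (\<lambda>x. norm (g x))" and dv: "div_eq m g \<alpha> \<beta>"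
    and \<alpha>: "\<alpha> \<in> prob_on \<Omega>" and \<beta>: "\<beta> \<in> prob_on \<Omega>" and v: "1-lipschitz_on UNIV v"
  shows "integral\<^sup>L \<alpha> v - integral\<^sup>L \<beta> v \<le> (\<integral>x. norm (g x) \<partial>m)"
proof (rule field_le_epsilon)
  fix e :: real assume "e > 0"
  then obtain U G where U: "C1_grad U G" "\<And>x. norm (G x) \<le> 1" "\<And>x. x \<in> \<Omega> \<Longrightarrow> \<bar>U x - v x\<bar> \<le> e / 2"
    using lipschitz_smooth_approx[OF \<Omega> prob_on_nonempty[OF \<alpha>] v, of "e / 2"] by auto
  note cont = C1_grad_continuous[OF U(1)] lipschitz_on_UNIV_continuous[OF v]
  have "integral\<^sup>L \<alpha> U - integral\<^sup>L \<beta> U = (\<integral>x. G x \<bullet> g x \<partial>m)"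
    using dv U(1) by (simp add: div_eq_def)
  also have "\<dots> \<le> (\<integral>x. norm (g x) \<partial>m)"
  proof -
    have Gm: "G \<in> borel_measurable borel" by (rule borel_measurable_continuous_onI[OF cont(2)])
    have le: "\<bar>G x \<bullet> g x\<bar> \<le> norm (g x)" for x
      using Cauchy_Schwarz_ineq2[of "G x" "g x"] mult_right_mono[OF U(2)[of x], of "norm (g x)"] by simp
    have "(\<lambda>x. G x \<bullet> g x) \<in> borel_measurable m"
      using fmeas_on_measurable[OF m Gm] fmeas_on_measurable[OF m g] by measurable
    then have "integrable m (\<lambda>x. G x \<bullet> g x)"
      by (rule Bochner_Integration.integrable_bound[OF gi]) (use le in auto)
    then show ?thesis by (rule integral_mono[OF _ gi]) (use le in \<open>auto simp: abs_le_iff\<close>)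
  qed
  finally have "integral\<^sup>L \<alpha> U - integral\<^sup>L \<beta> U \<le> (\<integral>x. norm (g x) \<partial>m)" .
  moreover have "\<bar>integral\<^sup>L \<alpha> U - integral\<^sup>L \<alpha> v\<bar> \<le> e / 2"
    by (rule prob_on_integral_close[OF \<alpha> \<Omega> cont(1,3) U(3)])
  moreover have "\<bar>integral\<^sup>L \<beta> U - integral\<^sup>L \<beta> v\<bar> \<le> e / 2"
    by (rule prob_on_integral_close[OF \<beta> \<Omega> cont(1,3) U(3)])
  ultimately show "integral\<^sup>L \<alpha> v - integral\<^sup>L \<beta> v \<le> (\<integral>x. norm (g x) \<partial>m) + e" by linarith
qed

lemma MK_witness_unit:
  assumes \<rho>: "\<rho> \<in> fmeas_on \<Omega>" and MK: "MK_witness \<Omega> u \<rho> \<alpha> \<beta> s"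
  shows "integrable \<rho> (\<lambda>x. norm (s x))" "(\<integral>x. norm (s x) \<partial>\<rho>) = measure \<rho> UNIV"
proof -
  interpret finite_measure \<rho> by (rule fmeas_onD(1)[OF \<rho>])
  have ae: "AE x in \<rho>. norm (s x) = 1" and sm: "s \<in> borel_measurable borel"
    using MK by (auto simp: MK_witness_def)
  have nm: "(\<lambda>x. norm (s x)) \<in> borel_measurable \<rho>"
    using fmeas_on_measurable[OF \<rho> sm] by measurable
  show "integrable \<rho> (\<lambda>x. norm (s x))"
    by (rule integrable_const_bound[of _ 1]) (use ae nm in \<open>auto elim: eventually_mono\<close>)
  have "(\<integral>x. norm (s x) \<partial>\<rho>) = (\<integral>x. 1 \<partial>\<rho>)"
    by (rule integral_cong_AE) (use ae nm in auto)
  then show "(\<integral>x. norm (s x) \<partial>\<rho>) = measure \<rho> UNIV" using fmeas_onD(3)[OF \<rho>] by simp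
qed

text \<open>Only this inequality needs the system itself: as the gradients approach a unit field in
  L2, their pairing with that field approaches the full mass of \<rho>. The reverse bound holds for
  any flow by \<open>lipschitz_integral_le_flow\<close>.\<close>

lemma MK_witness_mass_le:
  fixes \<Omega> :: "'a::euclidean_space set"
  assumes \<Omega>: "compact \<Omega>" and \<rho>: "\<rho> \<in> fmeas_on \<Omega>" and MK: "MK_witness \<Omega> u \<rho> \<alpha> \<beta> s"
    and \<alpha>: "\<alpha> \<in> prob_on \<Omega>" and \<beta>: "\<beta> \<in> prob_on \<Omega>" and u: "1-lipschitz_on UNIV u"
  shows "measure \<rho> UNIV \<le> integral\<^sup>L \<alpha> u - integral\<^sup>L \<beta> u"
proof -
  interpret finite_measure \<rho> by (rule fmeas_onD(1)[OF \<rho>])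
  define M where "M = measure \<rho> UNIV"
  have M0: "0 \<le> M" by (simp add: M_def)
  have sp: "space \<rho> = UNIV" by (rule fmeas_onD(3)[OF \<rho>])
  obtain U G where UG: "\<And>\<epsilon>. \<epsilon> > 0 \<Longrightarrow> C1_grad (U \<epsilon>) (G \<epsilon>)"
    and ul: "uniform_limit \<Omega> U u (at_right (0::real))"
    and L2: "((\<lambda>\<epsilon>. \<integral>\<^sup>+ x. ennreal ((norm (G \<epsilon> x - s x))\<^sup>2) \<partial>\<rho>) \<longlongrightarrow> 0) (at_right 0)"
    using MK unfolding MK_witness_def by blast
  have sm: "s \<in> borel_measurable \<rho>" and ae: "AE x in \<rho>. norm (s x) = 1" and dv: "div_eq \<rho> s \<alpha> \<beta>"
    using MK by (auto simp: MK_witness_def intro: fmeas_on_measurable[OF \<rho>])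
  \<comment> \<open>The error collects \<eta> from each of the two uniform approximations and
    \<open>\<eta> + \<eta> * M\<close> from the L1 distance of the gradients.\<close>
  have key: "M \<le> integral\<^sup>L \<alpha> u - integral\<^sup>L \<beta> u + \<eta> * (3 + M)" if \<eta>: "\<eta> > 0" for \<eta>
  proof -
    have "\<forall>\<^sub>F \<epsilon> in at_right 0. \<forall>x\<in>\<Omega>. dist (U \<epsilon> x) (u x) < \<eta>" by (rule uniform_limitD[OF ul \<eta>])
    moreover have "\<forall>\<^sub>F \<epsilon> in at_right 0. (\<integral>\<^sup>+ x. ennreal ((norm (G \<epsilon> x - s x))\<^sup>2) \<partial>\<rho>) < ennreal (\<eta>\<^sup>2)"
      by (rule order_tendstoD(2)[OF L2]) (use \<eta> in simp)
    moreover have "\<forall>\<^sub>F \<epsilon> in at_right (0::real). \<epsilon> > 0" by (rule eventually_at_right_less)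
    ultimately have "\<forall>\<^sub>F \<epsilon> in at_right (0::real). (\<forall>x\<in>\<Omega>. dist (U \<epsilon> x) (u x) < \<eta>) \<and>
        (\<integral>\<^sup>+ x. ennreal ((norm (G \<epsilon> x - s x))\<^sup>2) \<partial>\<rho>) < ennreal (\<eta>\<^sup>2) \<and> \<epsilon> > 0"
      by eventually_elim simp
    then obtain \<epsilon> :: real where \<epsilon>: "\<epsilon> > 0" and close: "\<And>x. x \<in> \<Omega> \<Longrightarrow> dist (U \<epsilon> x) (u x) < \<eta>"
      and small: "(\<integral>\<^sup>+ x. ennreal ((norm (G \<epsilon> x - s x))\<^sup>2) \<partial>\<rho>) < ennreal (\<eta>\<^sup>2)"
      using eventually_happens'[OF trivial_limit_at_right_real] by blast
    note cont = C1_grad_continuous[OF UG[OF \<epsilon>]] lipschitz_on_UNIV_continuous[OF u]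
    have Gm: "G \<epsilon> \<in> borel_measurable \<rho>"
      by (intro fmeas_on_measurable[OF \<rho>] borel_measurable_continuous_onI cont)
    define f where "f x = norm (G \<epsilon> x - s x)" for x
    have fm: "f \<in> borel_measurable \<rho>" unfolding f_def using Gm sm by measurable
    have f2m: "(\<lambda>x. (f x)\<^sup>2) \<in> borel_measurable \<rho>" using fm by measurable
    have f2: "integrable \<rho> (\<lambda>x. (f x)\<^sup>2)"
      using small by (intro integrableI_bounded f2m) (auto simp: f_def top.not_eq_extremum intro: less_trans)
    have f2v: "(\<integral>x. (f x)\<^sup>2 \<partial>\<rho>) \<le> \<eta>\<^sup>2"
    proof -
      have "ennreal (\<integral>x. (f x)\<^sup>2 \<partial>\<rho>) \<le> ennreal (\<eta>\<^sup>2)"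
        using small nn_integral_eq_integral[OF f2] by (simp add: f_def less_imp_le)
      then show ?thesis by (simp add: ennreal_le_iff)
    qed
    \<comment> \<open>A Young-type inequality in place of Cauchy-Schwarz: with the squared L2 norm
      at most \<open>\<eta>\<^sup>2\<close>, integration gives an L1 bound of order \<eta> on the
      finite measure \<rho>.\<close>
    have fle: "f x \<le> ((f x)\<^sup>2 / \<eta> + \<eta>)" for x
    proof -
      have "0 \<le> (f x - \<eta>)\<^sup>2 + f x * \<eta>" using \<eta> by (auto simp: f_def)
      then have "f x * \<eta> \<le> (f x)\<^sup>2 + \<eta> * \<eta>" by (simp add: power2_eq_square algebra_simps)
      then show ?thesis using \<eta> by (simp add: field_simps)
    qed
    have hi: "integrable \<rho> (\<lambda>x. (f x)\<^sup>2 / \<eta> + \<eta>)" using f2 by simp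
    have fi: "integrable \<rho> f"
      by (rule Bochner_Integration.integrable_bound[OF hi fm])
         (use fle \<eta> in \<open>auto simp: f_def intro!: add_nonneg_nonneg\<close>)
    have "integral\<^sup>L \<rho> f \<le> (\<integral>x. (f x)\<^sup>2 / \<eta> + \<eta> \<partial>\<rho>)" by (rule integral_mono[OF fi hi fle])
    also have "\<dots> = (\<integral>x. (f x)\<^sup>2 \<partial>\<rho>) / \<eta> + \<eta> * M" using f2 by (simp add: M_def sp)
    also have "\<dots> \<le> \<eta>\<^sup>2 / \<eta> + \<eta> * M" using f2v \<eta> by (intro add_mono divide_right_mono) auto
    finally have fv: "integral\<^sup>L \<rho> f \<le> \<eta> + \<eta> * M" using \<eta> by (simp add: power2_eq_square)
    \<comment> \<open>Where s is a unit vector, the pairing of G with s differs from 1 by that of G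
      - s with s, which is at most \<open>f\<close>.\<close>
    have ge: "AE x in \<rho>. 1 - f x \<le> G \<epsilon> x \<bullet> s x \<and> \<bar>G \<epsilon> x \<bullet> s x\<bar> \<le> 1 + f x"
      using ae
    proof eventually_elim
      case (elim x)
      have "\<bar>(G \<epsilon> x - s x) \<bullet> s x\<bar> \<le> f x"
        using Cauchy_Schwarz_ineq2[of "G \<epsilon> x - s x" "s x"] elim by (simp add: f_def)
      moreover have "s x \<bullet> s x = 1" using elim by (simp add: dot_square_norm)
      ultimately have "\<bar>G \<epsilon> x \<bullet> s x - 1\<bar> \<le> f x" by (simp add: inner_diff_left)
      then show ?case by (intro conjI) linarith+
    qed
    have "integrable \<rho> (\<lambda>x. 1 + f x)" using fi by simp
    then have Gi: "integrable \<rho> (\<lambda>x. G \<epsilon> x \<bullet> s x)"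
    proof (rule Bochner_Integration.integrable_bound)
      show "(\<lambda>x. G \<epsilon> x \<bullet> s x) \<in> borel_measurable \<rho>" using Gm sm by measurable
      show "AE x in \<rho>. norm (G \<epsilon> x \<bullet> s x) \<le> norm (1 + f x)"
        using ge by eventually_elim (simp add: f_def)
    qed
    have "M - integral\<^sup>L \<rho> f = (\<integral>x. 1 - f x \<partial>\<rho>)" using fi by (simp add: M_def sp)
    also have "\<dots> \<le> (\<integral>x. G \<epsilon> x \<bullet> s x \<partial>\<rho>)"
      by (rule integral_mono_AE) (use fi Gi ge in \<open>auto elim: eventually_mono\<close>)
    also have "\<dots> = integral\<^sup>L \<alpha> (U \<epsilon>) - integral\<^sup>L \<beta> (U \<epsilon>)"
      using dv UG[OF \<epsilon>] by (simp add: div_eq_def)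
    finally have 1: "M - integral\<^sup>L \<rho> f \<le> integral\<^sup>L \<alpha> (U \<epsilon>) - integral\<^sup>L \<beta> (U \<epsilon>)" .
    have le: "\<bar>U \<epsilon> x - u x\<bar> \<le> \<eta>" if "x \<in> \<Omega>" for x
      using close[OF that] by (simp add: dist_real_def)
    have 2: "\<bar>integral\<^sup>L \<alpha> (U \<epsilon>) - integral\<^sup>L \<alpha> u\<bar> \<le> \<eta>" "\<bar>integral\<^sup>L \<beta> (U \<epsilon>) - integral\<^sup>L \<beta> u\<bar> \<le> \<eta>"
      using prob_on_integral_close[OF \<alpha> \<Omega> cont(1,3) le] prob_on_integral_close[OF \<beta> \<Omega> cont(1,3) le] by auto
    have "\<eta> * (3 + M) = 2 * \<eta> + (\<eta> + \<eta> * M)" by (simp add: algebra_simps)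
    with 1 2 fv show ?thesis by linarith
  qed
  have "M \<le> integral\<^sup>L \<alpha> u - integral\<^sup>L \<beta> u"
  proof (rule field_le_epsilon)
    fix e :: real assume "e > 0"
    then show "M \<le> integral\<^sup>L \<alpha> u - integral\<^sup>L \<beta> u + e"
      using key[of "e / (3 + M)"] M0 by simp
  qed
  then show ?thesis by (simp add: M_def)
qed

section \<open>The support of a measure\<close>

lemma emeasure_compl_spt:
  fixes \<nu> :: "'a::euclidean_space measure"
  assumes s: "sets \<nu> = sets borel"
  shows "emeasure \<nu> (- spt \<nu>) = 0" "- spt \<nu> \<in> sets \<nu>"
proof -
  define F where "F = {ball x e | x e. 0 < e \<and> emeasure \<nu> (ball x e) = 0}"
  have "- spt \<nu> = \<Union>F"
  proof safe
    fix x assume "x \<notin> spt \<nu>"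
    then obtain e where "e > 0" "emeasure \<nu> (ball x e) = 0" by (auto simp: spt_def not_gr_zero)
    then show "x \<in> \<Union>F" unfolding F_def by (intro UnionI[of "ball x e"]) auto
  next
    fix x B assume x: "x \<in> spt \<nu>" and "B \<in> F" "x \<in> B"
    then obtain y e where B: "B = ball y e" "emeasure \<nu> B = 0" by (auto simp: F_def)
    obtain d where d: "d > 0" "ball x d \<subseteq> B" using \<open>x \<in> B\<close> B(1) openE[OF open_ball] by metis
    have "emeasure \<nu> (ball x d) \<le> emeasure \<nu> B" by (rule emeasure_mono) (use d B s in auto)
    then show False using x d(1) B(2) by (auto simp: spt_def)
  qed
  \<comment> \<open>The complement of the support is a union of null balls; the Lindelof property
    leaves countably many of them.\<close>
  moreover obtain F' where F': "F' \<subseteq> F" "countable F'" "\<Union>F' = \<Union>F"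
    using Lindelof[of F] by (auto simp: F_def)
  ultimately have eq: "- spt \<nu> = \<Union>F'" by simp
  have "B \<in> sets \<nu> \<and> emeasure \<nu> B = 0" if "B \<in> F'" for B
    using that F'(1) s by (auto simp: F_def)
  then have "\<Union>F' \<in> null_sets \<nu>"
    using null_sets_UN'[OF F'(2), of "\<lambda>B. B"] by (auto simp: null_sets_def)
  then show "emeasure \<nu> (- spt \<nu>) = 0" "- spt \<nu> \<in> sets \<nu>" by (auto simp: eq null_sets_def)
qed

lemma spt_subset:
  assumes \<nu>: "\<nu> \<in> prob_on \<Omega>" and \<Omega>: "closed \<Omega>"
  shows "spt \<nu> \<subseteq> \<Omega>"
proof
  fix x assume x: "x \<in> spt \<nu>"
  show "x \<in> \<Omega>"
  proof (rule ccontr)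
    assume "x \<notin> \<Omega>"
    then obtain e where e: "e > 0" "ball x e \<subseteq> - \<Omega>"
      using openE[of "- \<Omega>" x] \<Omega> by auto
    have "emeasure \<nu> (ball x e) \<le> emeasure \<nu> (- \<Omega>)"
      by (rule emeasure_mono[OF e(2)]) (use prob_onD[OF \<nu>] \<Omega> in \<open>auto intro: borel_open\<close>)
    then show False using x e(1) prob_onD(4)[OF \<nu>] by (auto simp: spt_def)
  qed
qed

section \<open>The transport density\<close>

lemma pair_measure_prob_on:
  fixes M :: "'a::euclidean_space measure" and L :: "'b::euclidean_space measure"
  assumes M: "M \<in> prob_on A" "closed A" and L: "L \<in> prob_on B" "closed B"
  shows "M \<Otimes>\<^sub>M L \<in> prob_on (A \<times> B)"
proof -
  interpret M: prob_space M by (rule prob_onD(1)[OF M(1)])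
  interpret L: prob_space L by (rule prob_onD(1)[OF L(1)])
  interpret pair_prob_space M L ..
  have s: "sets (M \<Otimes>\<^sub>M L) = sets borel"
    using sets_pair_measure_cong[OF prob_onD(2)[OF M(1)] prob_onD(2)[OF L(1)]]
    by (simp add: sets_borel_pair)
  have "AE z in M \<Otimes>\<^sub>M L. z \<in> A \<times> B"
  proof (rule AE_pair_measure)
    have "A \<times> B \<in> sets (M \<Otimes>\<^sub>M L)" unfolding s using closed_Times[OF M(2) L(2)] by (rule borel_closed)
    moreover have "{z \<in> space (M \<Otimes>\<^sub>M L). z \<in> A \<times> B} = A \<times> B"
      using sets_eq_imp_space_eq[OF s] by simp
    ultimately show "{z \<in> space (M \<Otimes>\<^sub>M L). z \<in> A \<times> B} \<in> sets (M \<Otimes>\<^sub>M L)" by simp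
    show "AE x in M. AE y in L. (x, y) \<in> A \<times> B"
      using prob_on_AE[OF M]
    proof eventually_elim
      case (elim x)
      show ?case using prob_on_AE[OF L] by eventually_elim (simp add: elim)
    qed
  qed
  then have "emeasure (M \<Otimes>\<^sub>M L) (- (A \<times> B)) = 0"
    using closed_Times[OF M(2) L(2)] sets_eq_imp_space_eq[OF s]
    by (subst (asm) AE_iff_measurable[of "- (A \<times> B)"]) (auto simp: s intro: borel_open)
  then show ?thesis using s prob_space_axioms by (simp add: prob_on_def)
qed

definition unif01 :: "real measure" where
  "unif01 = density lborel (indicator {0..1})"

lemma unif01_prob_on: "unif01 \<in> prob_on {0..1}"
proof -
  have "emeasure unif01 UNIV = 1"
    unfolding unif01_def by (subst emeasure_density) (auto simp: nn_integral_indicator)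
  then have "prob_space unif01" by (intro prob_spaceI) (simp add: unif01_def)
  moreover have "emeasure unif01 (- {0..1}) = 0"
    unfolding unif01_def
    by (subst emeasure_density) (auto simp: indicator_inter_arith[symmetric] intro: borel_open)
  ultimately show ?thesis by (simp add: prob_on_def unif01_def)
qed

text \<open>The fundamental theorem of calculus along the segment from y at time 0 to x at time 1;
  this orientation matches the sign convention of \<open>div_eq\<close>.\<close>

lemma integral_unif01_gradient:
  fixes x y :: "'a::euclidean_space"
  assumes C1: "C1_grad \<phi> G"
  shows "(\<integral>t. G (y + t *\<^sub>R (x - y)) \<bullet> (x - y) \<partial>unif01) = \<phi> x - \<phi> y"
proof -
  define f where "f t = G (y + t *\<^sub>R (x - y)) \<bullet> (x - y)" for t
  have fc: "continuous_on UNIV f" unfolding f_def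
    by (intro continuous_intros continuous_on_compose2[OF C1_grad_continuous(2)[OF C1]]) auto
  have d: "((\<lambda>t. \<phi> (y + t *\<^sub>R (x - y))) has_vector_derivative f t) (at t within {0..1})" for t
  proof -
    have 1: "((\<lambda>t. y + t *\<^sub>R (x - y)) has_derivative (\<lambda>h. h *\<^sub>R (x - y))) (at t within {0..1})"
      by (auto intro!: derivative_eq_intros)
    have "(\<phi> has_derivative (\<lambda>h. G (y + t *\<^sub>R (x - y)) \<bullet> h)) (at (y + t *\<^sub>R (x - y)))"
      using C1 by (simp add: C1_grad_def)
    from has_derivative_compose[OF 1 this] show ?thesis
      by (simp add: has_vector_derivative_def f_def mult.commute)
  qed
  have "integral\<^sup>L unif01 f = (\<integral>t. indicator {0..1} t *\<^sub>R f t \<partial>lborel)"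
  proof -
    have 1: "unif01 = density lborel (\<lambda>t. ennreal (indicator {0..1} t))"
      by (simp add: unif01_def ennreal_indicator)
    have "f \<in> borel_measurable lborel"
      using borel_measurable_continuous_onI[OF fc] by simp
    then show ?thesis unfolding 1 by (subst integral_density) auto
  qed
  also have "\<dots> = \<phi> (y + 1 *\<^sub>R (x - y)) - \<phi> (y + 0 *\<^sub>R (x - y))"
    by (rule integral_FTC_Icc) (use d continuous_on_subset[OF fc] in auto)
  finally have "integral\<^sup>L unif01 f = \<phi> x - \<phi> y" by simp
  then show ?thesis unfolding f_def[abs_def] .
qed

text \<open>The transport density is the average of arc length along the segments of an optimal plan. Its
  direction field comes without disintegration: complementary slackness forces the gradients of
  smooth approximations of the potential, pulled back to the segments, to converge in L2 to the
  directions of the segments, so these directions only depend on the position.\<close>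

lemma MK_system_of_optimal_plan:
  fixes \<Omega> :: "'a::euclidean_space set"
  assumes \<Omega>: "compact \<Omega>" "convex \<Omega>" and \<alpha>: "\<alpha> \<in> prob_on \<Omega>" and \<beta>: "\<beta> \<in> prob_on \<Omega>"
    and \<gamma>: "\<gamma> \<in> couplings \<alpha> \<beta>" and u: "1-lipschitz_on UNIV u"
    and opt: "(\<integral>z. dist (fst z) (snd z) \<partial>\<gamma>) = integral\<^sup>L \<alpha> u - integral\<^sup>L \<beta> u"
  shows "\<exists>\<rho>\<in>fmeas_on \<Omega>. MK_system \<Omega> u \<rho> \<alpha> \<beta>"
proof -
  have cl: "closed \<Omega>" by (rule compact_imp_closed[OF \<Omega>(1)])
  have gp: "\<gamma> \<in> prob_on (\<Omega> \<times> \<Omega>)" by (rule coupling_prob_on[OF \<gamma> \<alpha> \<beta> cl])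
  define K where "K = (\<Omega> \<times> \<Omega>) \<times> {0..1::real}"
  define Q where "Q = \<gamma> \<Otimes>\<^sub>M unif01"
  have cK: "compact K" unfolding K_def by (intro compact_Times \<Omega>) simp
  have Q: "Q \<in> prob_on K"
    unfolding Q_def K_def by (intro pair_measure_prob_on gp unif01_prob_on closed_Times cl) simp
  have sQ: "sets Q = sets borel" and spQ: "space Q = UNIV" by (rule prob_onD[OF Q])+
  interpret \<gamma>: prob_space \<gamma> by (rule prob_onD(1)[OF gp])
  interpret U: prob_space unif01 by (rule prob_onD(1)[OF unif01_prob_on])
  interpret pair_prob_space \<gamma> unif01 ..
  define X where "X z = fst (fst z)" for z :: "('a \<times> 'a) \<times> real"
  define Y where "Y z = snd (fst z)" for z :: "('a \<times> 'a) \<times> real"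
  define \<pi> where "\<pi> z = Y z + snd z *\<^sub>R (X z - Y z)" for z
  \<comment> \<open>The direction points from target to source, along which the potential increases.
    It is 0 for pairs that do not move, and these receive no mass under \<open>P\<close>.\<close>
  define e where "e z = sgn (X z - Y z)" for z
  define D where "D z = dist (X z) (Y z)" for z
  have Xc: "continuous_on UNIV X" and Yc: "continuous_on UNIV Y"
    unfolding X_def[abs_def] Y_def[abs_def] by (auto intro!: continuous_intros)
  have \<pi>c: "continuous_on UNIV \<pi>" unfolding \<pi>_def by (intro continuous_intros Xc Yc)
  have Dc: "continuous_on UNIV D" unfolding D_def by (intro continuous_intros Xc Yc)
  have Xm: "X \<in> borel_measurable Q" and Ym: "Y \<in> borel_measurable Q" and \<pi>m: "\<pi> \<in> borel_measurable Q"
    and Dm: "D \<in> borel_measurable Q"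
    by (auto intro!: prob_on_measurable[OF Q] borel_measurable_continuous_onI Xc Yc \<pi>c Dc)
  have em: "e \<in> borel_measurable Q" unfolding e_def sgn_div_norm using Xm Ym by measurable
  have D0: "0 \<le> D z" for z by (simp add: D_def)
  have en: "norm (e z) \<le> 1" for z by (simp add: e_def norm_sgn)
  have De: "D z * (v \<bullet> e z) = v \<bullet> (X z - Y z)" for v z
    by (cases "X z = Y z") (simp_all add: D_def e_def sgn_div_norm dist_norm)
  \<comment> \<open>Weighting by the length of the segment turns uniform time into arc length, and
    turns the unit direction into the full displacement when tested against
    \<open>Q\<close>.\<close>
  define P where "P = density Q (\<lambda>z. ennreal (D z))"
  have sP: "sets P = sets Q" "space P = space Q" by (auto simp: P_def)
  have Pint: "integral\<^sup>L P f = (\<integral>z. D z * f z \<partial>Q)" if "f \<in> borel_measurable Q" for f :: "_ \<Rightarrow> real"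
    unfolding P_def by (subst integral_density) (use that Dm D0 in auto)
  have Pm: "f \<in> borel_measurable P \<longleftrightarrow> f \<in> borel_measurable Q" for f :: "_ \<Rightarrow> 'c::topological_space"
    by (rule arg_cong[of _ _ "\<lambda>S. f \<in> S"], rule measurable_cong_sets) (auto simp: sP)
  have Di: "integrable Q D" by (rule prob_on_integrable[OF Q cK Dc])
  interpret P: finite_measure P
  proof
    have "emeasure P (space P) = (\<integral>\<^sup>+ z. ennreal (D z) \<partial>Q)"
      unfolding P_def using Dm by (subst emeasure_density) (auto intro!: nn_integral_cong simp: indicator_def)
    also have "\<dots> = ennreal (integral\<^sup>L Q D)"
      by (rule nn_integral_eq_integral[OF Di]) (simp add: D0)
    finally show "emeasure P (space P) \<noteq> \<infinity>" by simp
  qed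
  have transport: "(\<integral>z. G (\<pi> z) \<bullet> (X z - Y z) \<partial>Q) = integral\<^sup>L \<alpha> \<phi> - integral\<^sup>L \<beta> \<phi>" if C1: "C1_grad \<phi> G" for \<phi> G
  proof -
    note c = C1_grad_continuous[OF C1]
    have fm: "\<phi> \<in> borel_measurable borel" by (rule borel_measurable_continuous_onI[OF c(1)])
    have "continuous_on UNIV (\<lambda>z. G (\<pi> z) \<bullet> (X z - Y z))"
      by (intro continuous_intros Xc Yc continuous_on_compose2[OF c(2) \<pi>c]) auto
    then have "integrable Q (\<lambda>z. G (\<pi> z) \<bullet> (X z - Y z))" by (rule prob_on_integrable[OF Q cK])
    then have "integrable (\<gamma> \<Otimes>\<^sub>M unif01) (\<lambda>(p, t). G (\<pi> (p, t)) \<bullet> (X (p, t) - Y (p, t)))"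
      by (simp add: Q_def case_prod_beta')
    from integral_fst[OF this]
    have "(\<integral>z. G (\<pi> z) \<bullet> (X z - Y z) \<partial>Q) = (\<integral>p. (\<integral>t. G (\<pi> (p, t)) \<bullet> (X (p, t) - Y (p, t)) \<partial>unif01) \<partial>\<gamma>)"
      by (simp add: Q_def case_prod_beta')
    also have "\<dots> = (\<integral>p. \<phi> (fst p) - \<phi> (snd p) \<partial>\<gamma>)"
      using integral_unif01_gradient[OF C1] by (simp add: \<pi>_def X_def Y_def)
    also have "\<dots> = (\<integral>p. \<phi> (fst p) \<partial>\<gamma>) - (\<integral>p. \<phi> (snd p) \<partial>\<gamma>)"
      by (intro Bochner_Integration.integral_diff prob_on_integrable[OF gp compact_Times[OF \<Omega>(1) \<Omega>(1)]]
          continuous_on_compose2[OF c(1)] continuous_intros) auto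
    finally show ?thesis using coupling_integral[OF \<gamma> fm] by simp
  qed
  have w: "integral\<^sup>L Q D = integral\<^sup>L \<alpha> u - integral\<^sup>L \<beta> u"
  proof -
    have "integrable (\<gamma> \<Otimes>\<^sub>M unif01) (\<lambda>(p, t). D (p, t))" using Di by (simp add: Q_def case_prod_beta')
    from integral_fst[OF this] have "integral\<^sup>L Q D = (\<integral>p. (\<integral>t. D (p, t) \<partial>unif01) \<partial>\<gamma>)"
      by (simp add: Q_def case_prod_beta')
    also have "\<dots> = (\<integral>p. dist (fst p) (snd p) \<partial>\<gamma>)"
      by (simp add: D_def X_def Y_def U.prob_space)
    finally show ?thesis using opt by simp
  qed
  have "\<forall>\<epsilon>. \<exists>U G. \<epsilon> > 0 \<longrightarrow> C1_grad U G \<and> (\<forall>x. norm (G x) \<le> 1) \<and> 1-lipschitz_on UNIV U \<and>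
     (\<forall>x\<in>\<Omega>. \<bar>U x - u x\<bar> \<le> \<epsilon>)"
    using lipschitz_smooth_approx[OF \<Omega>(1) prob_on_nonempty[OF \<alpha>] u] by simp
  then obtain U G where UG: "\<forall>\<epsilon>. \<epsilon> > 0 \<longrightarrow> C1_grad (U \<epsilon>) (G \<epsilon>) \<and> (\<forall>x. norm (G \<epsilon> x) \<le> 1) \<and>
     1-lipschitz_on UNIV (U \<epsilon>) \<and> (\<forall>x\<in>\<Omega>. \<bar>U \<epsilon> x - u x\<bar> \<le> \<epsilon>)"
    unfolding choice_iff by auto
  have C1: "C1_grad (U \<epsilon>) (G \<epsilon>)" and G1: "norm (G \<epsilon> x) \<le> 1" and Ulip: "1-lipschitz_on UNIV (U \<epsilon>)"
    and Uu: "x \<in> \<Omega> \<Longrightarrow> \<bar>U \<epsilon> x - u x\<bar> \<le> \<epsilon>" if "\<epsilon> > 0" for \<epsilon> x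
    using UG that by auto
  have Gm: "G \<epsilon> \<in> borel_measurable borel" if "\<epsilon> > 0" for \<epsilon>
    by (intro borel_measurable_continuous_onI C1_grad_continuous(2)[OF C1[OF that]])
  define f where "f \<epsilon> z = (norm (G \<epsilon> (\<pi> z) - e z))\<^sup>2" for \<epsilon> z
  have fm: "f \<epsilon> \<in> borel_measurable Q" if "\<epsilon> > 0" for \<epsilon>
    unfolding f_def using Gm[OF that] \<pi>m em by measurable
  have fb: "\<bar>f \<epsilon> z\<bar> \<le> 4" if "\<epsilon> > 0" for \<epsilon> z
  proof -
    have "norm (G \<epsilon> (\<pi> z) - e z) \<le> 2"
      using norm_triangle_ineq4[of "G \<epsilon> (\<pi> z)" "e z"] G1[OF that, of "\<pi> z"] en[of z] by linarith
    then have "(norm (G \<epsilon> (\<pi> z) - e z))\<^sup>2 \<le> 2\<^sup>2" by (intro power_mono) auto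
    then show ?thesis by (simp add: f_def)
  qed
  have fi: "integrable P (f \<epsilon>)" if "\<epsilon> > 0" for \<epsilon>
    by (rule P.integrable_const_bound[of _ 4]) (use fb[OF that] fm[OF that] Pm in auto)
  \<comment> \<open>Expanding the square gives \<open>f \<epsilon> \<le> 2 - 2 * (G \<epsilon>
    (\<pi> z) \<bullet> e z)\<close>. After integration the right side is twice the transport cost
    minus the dual value of \<open>U \<epsilon>\<close>; optimality of u leaves two uniform errors
    of size \<epsilon>, doubled.\<close>
  have L2: "integral\<^sup>L P (f \<epsilon>) \<le> 4 * \<epsilon>" if \<epsilon>: "\<epsilon> > 0" for \<epsilon>
  proof -
    note c = C1_grad_continuous[OF C1[OF \<epsilon>]]
    define g where "g z = G \<epsilon> (\<pi> z) \<bullet> (X z - Y z)" for z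
    have "continuous_on UNIV g"
      unfolding g_def by (intro continuous_intros Xc Yc continuous_on_compose2[OF c(2) \<pi>c]) auto
    then have gi: "integrable Q g" by (rule prob_on_integrable[OF Q cK])
    have gt: "integral\<^sup>L Q g = integral\<^sup>L \<alpha> (U \<epsilon>) - integral\<^sup>L \<beta> (U \<epsilon>)"
      unfolding g_def[abs_def] by (rule transport[OF C1[OF \<epsilon>]])
    have le: "D z * f \<epsilon> z \<le> 2 * D z - 2 * g z" for z
    proof -
      have "(norm (G \<epsilon> (\<pi> z)))\<^sup>2 \<le> 1" "(norm (e z))\<^sup>2 \<le> 1"
        using G1[OF \<epsilon>, of "\<pi> z"] en[of z] by (auto intro: power_le_one)
      then have "f \<epsilon> z \<le> 2 - 2 * (G \<epsilon> (\<pi> z) \<bullet> e z)"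
        unfolding f_def power2_norm_eq_inner by (simp add: inner_diff_left inner_diff_right inner_commute)
      from mult_left_mono[OF this D0[of z]] show ?thesis
        unfolding g_def De[of z "G \<epsilon> (\<pi> z)", symmetric] by (simp add: algebra_simps)
    qed
    have i1: "integrable Q (\<lambda>z. D z * 4)" using Di by simp
    have m1: "(\<lambda>z. D z * f \<epsilon> z) \<in> borel_measurable Q" using Dm fm[OF \<epsilon>] by measurable
    have n1: "norm (D z * f \<epsilon> z) \<le> norm (D z * 4)" for z
      using mult_left_mono[OF fb[OF \<epsilon>, of z] D0[of z]] D0[of z] by (simp add: abs_mult)
    have i2: "integrable Q (\<lambda>z. D z * f \<epsilon> z)"
      by (rule Bochner_Integration.integrable_bound[OF i1 m1 AE_I2[OF n1]])
    have i3: "integrable Q (\<lambda>z. 2 * D z - 2 * g z)" using Di gi by simp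
    have "integral\<^sup>L P (f \<epsilon>) = (\<integral>z. D z * f \<epsilon> z \<partial>Q)" by (rule Pint[OF fm[OF \<epsilon>]])
    also have "\<dots> \<le> (\<integral>z. 2 * D z - 2 * g z \<partial>Q)" by (rule integral_mono[OF i2 i3 le])
    also have "\<dots> = 2 * integral\<^sup>L Q D - 2 * integral\<^sup>L Q g" using Di gi by simp
    also have "\<dots> = 2 * integral\<^sup>L Q D - 2 * (integral\<^sup>L \<alpha> (U \<epsilon>) - integral\<^sup>L \<beta> (U \<epsilon>))"
      by (simp only: gt)
    also have "\<dots> \<le> 4 * \<epsilon>"
    proof -
      have a: "\<bar>integral\<^sup>L \<alpha> (U \<epsilon>) - integral\<^sup>L \<alpha> u\<bar> \<le> \<epsilon>"
        by (rule prob_on_integral_close[OF \<alpha> \<Omega>(1) c(1) lipschitz_on_UNIV_continuous[OF u] Uu[OF \<epsilon>]])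
      have b: "\<bar>integral\<^sup>L \<beta> (U \<epsilon>) - integral\<^sup>L \<beta> u\<bar> \<le> \<epsilon>"
        by (rule prob_on_integral_close[OF \<beta> \<Omega>(1) c(1) lipschitz_on_UNIV_continuous[OF u] Uu[OF \<epsilon>]])
      have "2 * (p - q) - 2 * (p' - q') \<le> 4 * \<epsilon>" if "\<bar>p' - p\<bar> \<le> \<epsilon>" "\<bar>q' - q\<bar> \<le> \<epsilon>" for p q p' q' :: real
        using that by (simp add: abs_le_iff)
      from this[OF a b] show ?thesis by (simp only: w)
    qed
    finally show ?thesis .
  qed
  define E where "E n = 1 / real (Suc n)" for n
  have E0: "E n > 0" for n by (simp add: E_def)
  have nf: "norm (f \<epsilon> z) = f \<epsilon> z" for \<epsilon> z by (simp add: f_def)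
  have "(\<lambda>n. \<integral>z. norm (f (E n) z) \<partial>P) \<longlonglongrightarrow> 0"
  proof (rule tendsto_sandwich[OF _ _ tendsto_const])
    show "\<forall>\<^sub>F n in sequentially. 0 \<le> (\<integral>z. norm (f (E n) z) \<partial>P)" by simp
    show "\<forall>\<^sub>F n in sequentially. (\<integral>z. norm (f (E n) z) \<partial>P) \<le> 4 * E n"
      unfolding nf by (intro always_eventually allI L2 E0)
    have "(\<lambda>n. 4 * E n) \<longlonglongrightarrow> 4 * 0"
      unfolding E_def using LIMSEQ_inverse_real_of_nat by (intro tendsto_intros) (simp add: inverse_eq_divide)
    then show "(\<lambda>n. 4 * E n) \<longlonglongrightarrow> 0" by simp
  qed
  from tendsto_L1_AE_subseq[OF fi[OF E0] this] obtain r where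
    r: "AE z in P. (\<lambda>n. f (E (r n)) z) \<longlonglongrightarrow> 0" by blast
  \<comment> \<open>A pointwise limit of continuous fields is Borel whatever \<open>lim\<close>
    returns off the convergence set; by \<open>se\<close> it agrees with the segment direction at
    \<open>\<pi> z\<close> for P-almost every z.\<close>
  define s where "s x = lim (\<lambda>n. G (E (r n)) x)" for x
  have sm: "s \<in> borel_measurable borel"
    unfolding s_def by (intro borel_measurable_lim_metric Gm E0)
  have se: "AE z in P. s (\<pi> z) = e z"
    using r
  proof eventually_elim
    case (elim z)
    then have "(\<lambda>n. sqrt (f (E (r n)) z)) \<longlonglongrightarrow> sqrt 0" by (rule tendsto_real_sqrt)
    then have "(\<lambda>n. norm (G (E (r n)) (\<pi> z) - e z)) \<longlonglongrightarrow> 0" by (simp add: f_def)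
    then have "(\<lambda>n. G (E (r n)) (\<pi> z)) \<longlonglongrightarrow> e z" by (simp add: tendsto_norm_zero_iff LIM_zero_iff)
    then show ?case unfolding s_def by (rule limI)
  qed
  define \<rho> where "\<rho> = distr P borel \<pi>"
  have \<pi>P: "\<pi> \<in> borel_measurable P" using \<pi>m Pm by blast
  have s\<pi>: "(\<lambda>z. s (\<pi> z)) \<in> borel_measurable P" using sm \<pi>P by measurable
  have eP: "e \<in> borel_measurable P" using em Pm by blast
  have "AE z in P. \<pi> z \<in> \<Omega>"
  proof -
    have "AE z in Q. \<pi> z \<in> \<Omega>"
      using prob_on_AE[OF Q compact_imp_closed[OF cK]]
    proof eventually_elim
      case (elim z)
      then have "(1 - snd z) *\<^sub>R Y z + snd z *\<^sub>R X z \<in> \<Omega>"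
        by (intro convexD[OF \<Omega>(2)]) (auto simp: K_def X_def Y_def)
      then show ?case by (simp add: \<pi>_def algebra_simps)
    qed
    then show ?thesis unfolding P_def using Dm by (subst AE_density) (auto elim: eventually_mono)
  qed
  then have "AE x in \<rho>. x \<in> \<Omega>" unfolding \<rho>_def using cl by (subst AE_distr_iff[OF \<pi>P]) auto
  then have "emeasure \<rho> (- \<Omega>) = 0"
    using cl by (subst (asm) AE_iff_measurable[of "- \<Omega>"]) (auto simp: \<rho>_def intro: borel_open)
  then have \<rho>: "\<rho> \<in> fmeas_on \<Omega>"
    using P.finite_measure_distr[OF \<pi>P] by (simp add: fmeas_on_def \<rho>_def)
  have "div_eq \<rho> s \<alpha> \<beta>"
    unfolding div_eq_def
  proof (intro allI impI)
    fix \<phi> and H :: "'a \<Rightarrow> 'a" assume H: "C1_grad \<phi> H"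
    have Hm: "H \<in> borel_measurable borel"
      by (intro borel_measurable_continuous_onI C1_grad_continuous(2)[OF H])
    have "(\<integral>x. H x \<bullet> s x \<partial>\<rho>) = (\<integral>z. H (\<pi> z) \<bullet> s (\<pi> z) \<partial>P)"
      unfolding \<rho>_def by (rule integral_distr[OF \<pi>P]) (use Hm sm in measurable)
    also have "\<dots> = (\<integral>z. H (\<pi> z) \<bullet> e z \<partial>P)"
    proof (rule integral_cong_AE)
      show "(\<lambda>z. H (\<pi> z) \<bullet> s (\<pi> z)) \<in> borel_measurable P" using Hm \<pi>P s\<pi> by measurable
      show "(\<lambda>z. H (\<pi> z) \<bullet> e z) \<in> borel_measurable P" using Hm \<pi>P eP by measurable
      show "AE z in P. H (\<pi> z) \<bullet> s (\<pi> z) = H (\<pi> z) \<bullet> e z" using se by eventually_elim simp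
    qed
    also have "\<dots> = (\<integral>z. D z * (H (\<pi> z) \<bullet> e z) \<partial>Q)"
      by (rule Pint) (use Hm \<pi>m em in measurable)
    also have "\<dots> = integral\<^sup>L \<alpha> \<phi> - integral\<^sup>L \<beta> \<phi>" unfolding De by (rule transport[OF H])
    finally show "(\<integral>x. H x \<bullet> s x \<partial>\<rho>) = integral\<^sup>L \<alpha> \<phi> - integral\<^sup>L \<beta> \<phi>" .
  qed
  moreover have "AE x in \<rho>. norm (s x) = 1"
  proof -
    have Dm': "(\<lambda>z. ennreal (D z)) \<in> borel_measurable Q" using Dm by measurable
    have "norm (e z) = 1" if "0 < ennreal (D z)" for z
      using that by (auto simp: D_def e_def norm_sgn)
    then have "AE z in P. norm (e z) = 1" unfolding P_def AE_density[OF Dm'] by simp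
    with se have "AE z in P. norm (s (\<pi> z)) = 1" by eventually_elim simp
    moreover have "{x. norm (s x) = 1} \<in> sets borel" using sm by measurable
    ultimately show ?thesis unfolding \<rho>_def by (subst AE_distr_iff[OF \<pi>P]) auto
  qed
  \<comment> \<open>The subsequence served only to define s. Convergence along all \<epsilon>
    follows because \<open>L2\<close> is a bound for every \<epsilon>, in which the direction may
    now be replaced by s.\<close>
  moreover have "((\<lambda>\<epsilon>. \<integral>\<^sup>+ x. ennreal ((norm (G \<epsilon> x - s x))\<^sup>2) \<partial>\<rho>) \<longlongrightarrow> 0) (at_right 0)"
  proof (rule tendsto_sandwich[OF _ _ tendsto_const])
    show "\<forall>\<^sub>F \<epsilon> in at_right (0::real). 0 \<le> (\<integral>\<^sup>+ x. ennreal ((norm (G \<epsilon> x - s x))\<^sup>2) \<partial>\<rho>)" by simp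
    show "\<forall>\<^sub>F \<epsilon> in at_right (0::real). (\<integral>\<^sup>+ x. ennreal ((norm (G \<epsilon> x - s x))\<^sup>2) \<partial>\<rho>) \<le> ennreal (4 * \<epsilon>)"
      using eventually_at_right_less
    proof eventually_elim
      case (elim \<epsilon>)
      have "(\<integral>\<^sup>+ x. ennreal ((norm (G \<epsilon> x - s x))\<^sup>2) \<partial>\<rho>)
          = (\<integral>\<^sup>+ z. ennreal ((norm (G \<epsilon> (\<pi> z) - s (\<pi> z)))\<^sup>2) \<partial>P)"
        unfolding \<rho>_def by (rule nn_integral_distr[OF \<pi>P]) (use Gm[OF elim] sm in measurable)
      also have "\<dots> = (\<integral>\<^sup>+ z. ennreal (f \<epsilon> z) \<partial>P)"
        by (rule nn_integral_cong_AE) (use se in \<open>auto simp: f_def elim: eventually_mono\<close>)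
      also have "\<dots> = ennreal (integral\<^sup>L P (f \<epsilon>))"
        by (rule nn_integral_eq_integral[OF fi[OF elim]]) (simp add: f_def)
      also have "\<dots> \<le> ennreal (4 * \<epsilon>)" by (rule ennreal_leI[OF L2[OF elim]])
      finally show ?case .
    qed
    have "((\<lambda>\<epsilon>::real. ennreal (4 * \<epsilon>)) \<longlongrightarrow> ennreal (4 * 0)) (at_right 0)"
      by (intro tendsto_intros)
    then show "((\<lambda>\<epsilon>::real. ennreal (4 * \<epsilon>)) \<longlongrightarrow> 0) (at_right 0)" by simp
  qed
  moreover have "uniform_limit \<Omega> U u (at_right 0)"
  proof (rule uniform_limitI)
    fix d :: real assume "d > 0"
    then have "\<forall>\<^sub>F \<epsilon> in at_right (0::real). \<epsilon> < d" by (rule eventually_at_right_real[THEN eventually_mono]) auto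
    with eventually_at_right_less[of "0::real"]
    show "\<forall>\<^sub>F \<epsilon> in at_right 0. \<forall>x\<in>\<Omega>. dist (U \<epsilon> x) (u x) < d"
    proof eventually_elim
      case (elim \<epsilon>)
      then show ?case using Uu[OF elim(1)] by (fastforce simp: dist_real_def)
    qed
  qed
  moreover have "\<forall>\<epsilon>>0. C1_grad (U \<epsilon>) (G \<epsilon>) \<and> 1-lipschitz_on \<Omega> (U \<epsilon>)"
    using C1 Ulip lipschitz_on_subset[OF _ subset_UNIV] by blast
  ultimately have "MK_witness \<Omega> u \<rho> \<alpha> \<beta> s"
    unfolding MK_witness_def using sm by (intro conjI exI[of _ U] exI[of _ G])
  then show ?thesis using \<rho> by (auto simp: MK_system_def)
qed

section \<open>Medians and Monge--Kantorovich systems\<close>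

text \<open>Any flow dominates every dual pairing, and the dual pairings exhaust \<open>W1\<close>;
  no plan has to be built from the flow.\<close>

lemma W1_le_flow:
  fixes \<Omega> :: "'a::euclidean_space set"
  assumes \<Omega>: "compact \<Omega>" and m: "m \<in> fmeas_on \<Omega>" and g: "g \<in> borel_measurable borel"
    and gi: "integrable m (\<lambda>x. norm (g x))" and dv: "div_eq m g \<alpha> \<beta>"
    and \<alpha>: "\<alpha> \<in> prob_on \<Omega>" and \<beta>: "\<beta> \<in> prob_on \<Omega>"
  shows "W1 \<alpha> \<beta> \<le> ennreal (\<integral>x. norm (g x) \<partial>m)"
proof -
  obtain \<gamma> where "\<gamma> \<in> couplings \<alpha> \<beta>" and \<gamma>: "W1 \<alpha> \<beta> = ennreal (\<integral>z. dist (fst z) (snd z) \<partial>\<gamma>)" and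
    dual: "\<forall>\<delta>>0. \<exists>u. 1-lipschitz_on UNIV u \<and>
       (\<integral>z. dist (fst z) (snd z) \<partial>\<gamma>) - \<delta> \<le> integral\<^sup>L \<alpha> u - integral\<^sup>L \<beta> u"
    by (rule W1_optimal_coupling[OF \<Omega> \<alpha> \<beta>])
  have "(\<integral>z. dist (fst z) (snd z) \<partial>\<gamma>) \<le> (\<integral>x. norm (g x) \<partial>m)"
  proof (rule field_le_epsilon)
    fix \<delta> :: real assume "\<delta> > 0"
    with dual obtain u where u: "1-lipschitz_on UNIV u"
      "(\<integral>z. dist (fst z) (snd z) \<partial>\<gamma>) - \<delta> \<le> integral\<^sup>L \<alpha> u - integral\<^sup>L \<beta> u" by blast
    from lipschitz_integral_le_flow[OF \<Omega> m g gi dv \<alpha> \<beta> u(1)] u(2)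
    show "(\<integral>z. dist (fst z) (snd z) \<partial>\<gamma>) \<le> (\<integral>x. norm (g x) \<partial>m) + \<delta>" by linarith
  qed
  then show ?thesis unfolding \<gamma> by (rule ennreal_leI)
qed

text \<open>Values of u off \<Omega> are arbitrary and may be non-measurable; restriction of the
  integral to \<Omega> hides them, so a continuous extension can be integrated instead.\<close>

lemma set_integral_prob_on:
  assumes M: "M \<in> prob_on \<Omega>" and \<Omega>: "compact \<Omega>" and v: "continuous_on UNIV v"
    and eq: "\<And>x. x \<in> \<Omega> \<Longrightarrow> v x = (u x :: real)"
  shows "(LINT x:\<Omega>|M. u x) = integral\<^sup>L M v"
proof -
  have cl: "closed \<Omega>" by (rule compact_imp_closed[OF \<Omega>])
  have vm: "v \<in> borel_measurable M"
    by (intro prob_on_measurable[OF M] borel_measurable_continuous_onI v)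
  have "(LINT x:\<Omega>|M. u x) = (\<integral>x. indicator \<Omega> x *\<^sub>R v x \<partial>M)"
    unfolding set_lebesgue_integral_def
    by (intro Bochner_Integration.integral_cong refl) (auto simp: eq indicator_def)
  also have "\<dots> = integral\<^sup>L M v"
  proof (rule integral_cong_AE)
    have "\<Omega> \<in> sets M" using cl prob_onD(2)[OF M] by auto
    then show "(\<lambda>x. indicator \<Omega> x *\<^sub>R v x) \<in> borel_measurable M" using vm by measurable
    show "AE x in M. indicator \<Omega> x *\<^sub>R v x = v x"
      using prob_on_AE[OF M cl] by eventually_elim simp
  qed (rule vm)
  finally show ?thesis .
qed

text \<open>Lets a potential given on \<Omega> be exchanged for its globally Lipschitz
  extension.\<close>

lemma MK_witness_cong:
  assumes "MK_witness \<Omega> u \<rho> \<alpha> \<beta> s" "\<And>x. x \<in> \<Omega> \<Longrightarrow> u x = v x"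
  shows "MK_witness \<Omega> v \<rho> \<alpha> \<beta> s"
proof -
  have "uniform_limit \<Omega> U u F \<longleftrightarrow> uniform_limit \<Omega> U v F" for U :: "real \<Rightarrow> _" and F
    by (rule uniform_limit_cong') (use assms(2) in auto)
  with assms(1) show ?thesis unfolding MK_witness_def by simp
qed

section \<open>Weak duality and certificates of optimality\<close>

locale median_setting =
  fixes \<Omega> :: "'a::euclidean_space set" and N :: nat and lam :: "nat \<Rightarrow> real"
    and \<nu>s :: "nat \<Rightarrow> 'a measure"
  assumes \<Omega>: "compact \<Omega>" and lam: "\<And>i. i < N \<Longrightarrow> lam i > 0" "(\<Sum>i<N. lam i) = 1"
    and \<nu>s: "\<And>i. i < N \<Longrightarrow> \<nu>s i \<in> prob_on \<Omega>"
begin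

lemma closed_\<Omega>: "closed \<Omega>"
  by (rule compact_imp_closed[OF \<Omega>])

text \<open>Feasible points of (D) in globally Lipschitz form, so that they are continuous
  everywhere and can be integrated without restriction to \<Omega>.\<close>

definition potentials :: "(nat \<Rightarrow> 'a \<Rightarrow> real) \<Rightarrow> bool" where
  "potentials v \<longleftrightarrow> (\<forall>i<N. 1-lipschitz_on UNIV (v i)) \<and> (\<forall>x\<in>\<Omega>. (\<Sum>i<N. lam i * v i x) \<le> 0)"

definition dual_value :: "(nat \<Rightarrow> 'a \<Rightarrow> real) \<Rightarrow> real" where
  "dual_value v = (\<Sum>i<N. lam i * integral\<^sup>L (\<nu>s i) (v i))"

text \<open>The weighted sum is continuous, and nonpositive on \<Omega>. If its integral is zero it
  vanishes almost everywhere; a point of the support where it did not vanish would have a ball of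
  positive measure with the same property.\<close>

lemma potentials_integral_le:
  assumes v: "potentials v" and \<mu>: "\<mu> \<in> prob_on \<Omega>"
  shows "(\<Sum>i<N. lam i * integral\<^sup>L \<mu> (v i)) \<le> 0"
    and "\<forall>x\<in>spt \<mu>. (\<Sum>i<N. lam i * v i x) = 0 \<Longrightarrow> (\<Sum>i<N. lam i * integral\<^sup>L \<mu> (v i)) = 0"
    and "(\<Sum>i<N. lam i * integral\<^sup>L \<mu> (v i)) = 0 \<Longrightarrow> \<forall>x\<in>spt \<mu>. (\<Sum>i<N. lam i * v i x) = 0"
proof -
  define h where "h x = (\<Sum>i<N. lam i * v i x)" for x
  have vc: "continuous_on UNIV (v i)" if "i < N" for i
    by (rule lipschitz_on_UNIV_continuous[of 1]) (use v that in \<open>simp add: potentials_def\<close>)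
  have hc: "continuous_on UNIV h"
    unfolding h_def by (intro continuous_intros vc) simp
  have hi: "integrable \<mu> h" by (rule prob_on_integrable[OF \<mu> \<Omega> hc])
  have eq: "(\<Sum>i<N. lam i * integral\<^sup>L \<mu> (v i)) = integral\<^sup>L \<mu> h"
    unfolding h_def
    by (subst Bochner_Integration.integral_sum)
       (auto intro!: integrable_mult_right prob_on_integrable[OF \<mu> \<Omega>] vc)
  have h0: "AE x in \<mu>. h x \<le> 0"
    using prob_on_AE[OF \<mu> closed_\<Omega>] v by (auto simp: potentials_def h_def elim: eventually_mono)
  show "(\<Sum>i<N. lam i * integral\<^sup>L \<mu> (v i)) \<le> 0"
    unfolding eq using integral_nonneg_AE[of "\<lambda>x. - h x" \<mu>] h0 by simp
  note spt = emeasure_compl_spt[OF prob_onD(2)[OF \<mu>]]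
  have ae: "AE x in \<mu>. x \<in> spt \<mu>"
    by (rule AE_I[of _ _ "- spt \<mu>"]) (use spt in auto)
  show "(\<Sum>i<N. lam i * integral\<^sup>L \<mu> (v i)) = 0" if "\<forall>x\<in>spt \<mu>. (\<Sum>i<N. lam i * v i x) = 0"
  proof -
    have "AE x in \<mu>. h x = 0" using ae that by (auto simp: h_def elim: eventually_mono)
    then show ?thesis unfolding eq by (rule integral_eq_zero_AE)
  qed
  show "\<forall>x\<in>spt \<mu>. (\<Sum>i<N. lam i * v i x) = 0" if "(\<Sum>i<N. lam i * integral\<^sup>L \<mu> (v i)) = 0"
  proof (rule ccontr)
    assume "\<not> (\<forall>x\<in>spt \<mu>. (\<Sum>i<N. lam i * v i x) = 0)"
    then obtain x where x: "x \<in> spt \<mu>" "h x \<noteq> 0" by (auto simp: h_def)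
    have "integral\<^sup>L \<mu> (\<lambda>x. - h x) = 0" using that eq hi by simp
    then have "AE x in \<mu>. - h x = 0"
      using integral_nonneg_eq_0_iff_AE[of \<mu> "\<lambda>x. - h x"] hi h0 by auto
    then have ae0: "AE x in \<mu>. x \<notin> {x. h x \<noteq> 0}" by auto
    have o: "open {x. h x \<noteq> 0}"
      by (intro open_Collect_neq hc continuous_on_const)
    then obtain e where e: "e > 0" "ball x e \<subseteq> {x. h x \<noteq> 0}" using x(2) openE by (metis mem_Collect_eq)
    have "{x. h x \<noteq> 0} \<in> sets \<mu>" using o prob_onD(2)[OF \<mu>] by auto
    then have "emeasure \<mu> {x. h x \<noteq> 0} = 0"
      using ae0 prob_onD(3)[OF \<mu>] by (subst (asm) AE_iff_measurable[of "{x. h x \<noteq> 0}"]) auto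
    moreover have "emeasure \<mu> (ball x e) \<le> emeasure \<mu> {x. h x \<noteq> 0}"
      by (rule emeasure_mono[OF e(2)]) (use o prob_onD(2)[OF \<mu>] in auto)
    ultimately show False using x(1) e(1) by (auto simp: spt_def)
  qed
qed

lemma dual_value_le_flow:
  assumes v: "potentials v" and \<sigma>: "feasible_B \<Omega> N \<nu>s \<sigma> \<mu>"
  shows "dual_value v \<le> cost_B N lam \<sigma>"
proof -
  have \<mu>: "\<mu> \<in> prob_on \<Omega>" using \<sigma> by (simp add: feasible_B_def)
  have "lam i * integral\<^sup>L (\<nu>s i) (v i) - lam i * integral\<^sup>L \<mu> (v i)
      \<le> lam i * (\<integral>x. norm (snd (\<sigma> i) x) \<partial>(fst (\<sigma> i)))" if i: "i < N" for i
  proof -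
    have "integral\<^sup>L (\<nu>s i) (v i) - integral\<^sup>L \<mu> (v i) \<le> (\<integral>x. norm (snd (\<sigma> i) x) \<partial>(fst (\<sigma> i)))"
      using \<sigma> v i unfolding feasible_B_def potentials_def
      by (intro lipschitz_integral_le_flow[OF \<Omega> _ _ _ _ \<nu>s[OF i] \<mu>]) auto
    from mult_left_mono[OF this, of "lam i"] lam(1)[OF i] show ?thesis by (simp add: right_diff_distrib)
  qed
  then have "(\<Sum>i<N. lam i * integral\<^sup>L (\<nu>s i) (v i) - lam i * integral\<^sup>L \<mu> (v i)) \<le> cost_B N lam \<sigma>"
    unfolding cost_B_def by (intro sum_mono) auto
  then show ?thesis using potentials_integral_le(1)[OF v \<mu>] by (simp add: dual_value_def sum_subtractf)
qed

lemma dual_value_le_W1: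
  assumes v: "potentials v" and \<mu>: "\<mu> \<in> prob_on \<Omega>"
  shows "ennreal (dual_value v) \<le> (\<Sum>i<N. ennreal (lam i) * W1 (\<nu>s i) \<mu>)"
proof -
  \<comment> \<open>Each difference is cut off at 0 before the embedding, since
    \<open>ennreal\<close> sends negative reals to 0 and is additive only on nonnegative
    terms.\<close>
  have "dual_value v \<le> (\<Sum>i<N. lam i * max 0 (integral\<^sup>L (\<nu>s i) (v i) - integral\<^sup>L \<mu> (v i)))"
  proof -
    have "(\<Sum>i<N. lam i * (integral\<^sup>L (\<nu>s i) (v i) - integral\<^sup>L \<mu> (v i)))
        \<le> (\<Sum>i<N. lam i * max 0 (integral\<^sup>L (\<nu>s i) (v i) - integral\<^sup>L \<mu> (v i)))"
      using lam(1) by (intro sum_mono mult_left_mono) (auto simp: less_imp_le)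
    then show ?thesis using potentials_integral_le(1)[OF v \<mu>]
      by (simp add: dual_value_def sum_subtractf right_diff_distrib)
  qed
  then have "ennreal (dual_value v) \<le> ennreal (\<Sum>i<N. lam i * max 0 (integral\<^sup>L (\<nu>s i) (v i) - integral\<^sup>L \<mu> (v i)))"
    by (rule ennreal_leI)
  also have "\<dots> = (\<Sum>i<N. ennreal (lam i) * ennreal (max 0 (integral\<^sup>L (\<nu>s i) (v i) - integral\<^sup>L \<mu> (v i))))"
    using lam(1) by (subst sum_ennreal[symmetric]) (auto simp: ennreal_mult less_imp_le)
  also have "\<dots> \<le> (\<Sum>i<N. ennreal (lam i) * W1 (\<nu>s i) \<mu>)"
  proof (intro sum_mono mult_left_mono)
    fix i assume "i \<in> {..<N}"
    then have "ennreal (integral\<^sup>L (\<nu>s i) (v i) - integral\<^sup>L \<mu> (v i)) \<le> W1 (\<nu>s i) \<mu>"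
      using v by (intro lipschitz_integral_le_W1[OF \<Omega> \<nu>s \<mu>]) (auto simp: potentials_def)
    then show "ennreal (max 0 (integral\<^sup>L (\<nu>s i) (v i) - integral\<^sup>L \<mu> (v i))) \<le> W1 (\<nu>s i) \<mu>"
      by (auto simp: max_def)
  qed simp
  finally show ?thesis .
qed

lemma sum_W1_le:
  assumes "\<And>i. i < N \<Longrightarrow> W1 (\<nu>s i) \<mu> \<le> ennreal (d i)" "\<And>i. i < N \<Longrightarrow> 0 \<le> d i"
  shows "(\<Sum>i<N. ennreal (lam i) * W1 (\<nu>s i) \<mu>) \<le> ennreal (\<Sum>i<N. lam i * d i)"
proof -
  have "(\<Sum>i<N. ennreal (lam i) * W1 (\<nu>s i) \<mu>) \<le> (\<Sum>i<N. ennreal (lam i) * ennreal (d i))"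
    using assms(1) by (intro sum_mono mult_left_mono) auto
  also have "\<dots> = (\<Sum>i<N. ennreal (lam i * d i))"
    using lam(1) assms(2) by (intro sum.cong) (auto simp: ennreal_mult less_imp_le)
  also have "\<dots> = ennreal (\<Sum>i<N. lam i * d i)"
    using lam(1) assms(2) by (intro sum_ennreal) (auto simp: less_imp_le)
  finally show ?thesis .
qed

text \<open>The support condition removes the integrals against \<nu>, so the masses of the flows
  add up to at most the dual value. With weak duality, this one bound makes the flows, the
  potentials and \<nu> optimal together.\<close>

lemma MK_certificate:
  assumes v: "potentials v" and \<nu>: "\<nu> \<in> prob_on \<Omega>"
    and \<rho>: "\<And>i. i < N \<Longrightarrow> \<rho> i \<in> fmeas_on \<Omega>"
    and MK: "\<And>i. i < N \<Longrightarrow> MK_witness \<Omega> (v i) (\<rho> i) (\<nu>s i) \<nu> (s i)"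
    and spt: "\<forall>x\<in>spt \<nu>. (\<Sum>i<N. lam i * v i x) = 0"
  shows "feasible_B \<Omega> N \<nu>s (\<lambda>i. (\<rho> i, s i)) \<nu>"
    and "cost_B N lam (\<lambda>i. (\<rho> i, s i)) \<le> dual_value v"
    and "(\<Sum>i<N. ennreal (lam i) * W1 (\<nu>s i) \<nu>) \<le> ennreal (dual_value v)"
proof -
  have sm: "s i \<in> borel_measurable borel" and dv: "div_eq (\<rho> i) (s i) (\<nu>s i) \<nu>" if "i < N" for i
    using MK[OF that] by (auto simp: MK_witness_def)
  note unit = MK_witness_unit[OF \<rho> MK]
  show "feasible_B \<Omega> N \<nu>s (\<lambda>i. (\<rho> i, s i)) \<nu>"
    unfolding feasible_B_def using \<nu> \<rho> sm dv unit(1) by simp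
  have "(\<Sum>i<N. lam i * (\<integral>x. norm (s i x) \<partial>\<rho> i))
      \<le> (\<Sum>i<N. lam i * (integral\<^sup>L (\<nu>s i) (v i) - integral\<^sup>L \<nu> (v i)))"
  proof (intro sum_mono mult_left_mono)
    fix i assume "i \<in> {..<N}"
    then have i: "i < N" by simp
    have "1-lipschitz_on UNIV (v i)" using v i by (simp add: potentials_def)
    from MK_witness_mass_le[OF \<Omega> \<rho>[OF i] MK[OF i] \<nu>s[OF i] \<nu> this]
    show "(\<integral>x. norm (s i x) \<partial>\<rho> i) \<le> integral\<^sup>L (\<nu>s i) (v i) - integral\<^sup>L \<nu> (v i)"
      using unit(2)[OF i i] by simp
    show "0 \<le> lam i" using lam(1)[OF i] by simp
  qed
  also have "\<dots> = dual_value v"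
    using potentials_integral_le(2)[OF v \<nu> spt]
    by (simp add: dual_value_def right_diff_distrib sum_subtractf)
  finally have le: "(\<Sum>i<N. lam i * (\<integral>x. norm (s i x) \<partial>\<rho> i)) \<le> dual_value v" .
  then show "cost_B N lam (\<lambda>i. (\<rho> i, s i)) \<le> dual_value v" by (simp add: cost_B_def)
  have "W1 (\<nu>s i) \<nu> \<le> ennreal (\<integral>x. norm (s i x) \<partial>\<rho> i)" if i: "i < N" for i
    by (rule W1_le_flow[OF \<Omega> \<rho>[OF i] sm[OF i] unit(1)[OF i i] dv[OF i] \<nu>s[OF i] \<nu>])
  then have "(\<Sum>i<N. ennreal (lam i) * W1 (\<nu>s i) \<nu>) \<le> ennreal (\<Sum>i<N. lam i * (\<integral>x. norm (s i x) \<partial>\<rho> i))"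
    by (rule sum_W1_le) auto
  then show "(\<Sum>i<N. ennreal (lam i) * W1 (\<nu>s i) \<nu>) \<le> ennreal (dual_value v)"
    using ennreal_leI[OF le] by (rule order_trans)
qed

text \<open>The median property enters once, to compare the cost of \<nu> with that of the measure
  \<mu> found by duality; afterwards only potentials and optimal plans towards \<nu> matter.\<close>

lemma ex_MK_certificate:
  assumes cvx: "convex \<Omega>" and med: "\<nu> \<in> Med \<Omega> N lam \<nu>s"
  shows "\<exists>v \<rho>. potentials v \<and> (\<forall>i<N. \<rho> i \<in> fmeas_on \<Omega> \<and> MK_system \<Omega> (v i) (\<rho> i) (\<nu>s i) \<nu>) \<and>
    (\<forall>x\<in>spt \<nu>. (\<Sum>i<N. lam i * v i x) = 0)"
proof -
  have \<nu>: "\<nu> \<in> prob_on \<Omega>" using med by (simp add: Med_def)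
  obtain \<mu> \<gamma> u where \<mu>: "\<mu> \<in> prob_on \<Omega>" and \<gamma>: "\<forall>i<N. \<gamma> i \<in> couplings (\<nu>s i) \<mu>"
    and u: "\<forall>i<N. 1-lipschitz_on UNIV (u i)" "\<forall>x\<in>\<Omega>. (\<Sum>i<N. lam i * u i x) \<le> 0"
    and le: "(\<Sum>i<N. lam i * (\<integral>z. dist (fst z) (snd z) \<partial>(\<gamma> i))) \<le> (\<Sum>i<N. lam i * integral\<^sup>L (\<nu>s i) (u i))"
    by (rule barycentre_duality[of \<Omega> N lam \<nu>s, OF \<Omega> lam \<nu>s])
  have pot: "potentials u" using u by (simp add: potentials_def)
  have "W1 (\<nu>s i) \<mu> \<le> ennreal (\<integral>z. dist (fst z) (snd z) \<partial>(\<gamma> i))" if i: "i < N" for i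
  proof -
    have g: "\<gamma> i \<in> couplings (\<nu>s i) \<mu>" using \<gamma> i by simp
    show ?thesis
      unfolding W1_def nn_integral_dist_coupling[OF g \<nu>s[OF i] \<mu> \<Omega>, symmetric] by (rule INF_lower[OF g])
  qed
  then have 1: "(\<Sum>i<N. ennreal (lam i) * W1 (\<nu>s i) \<mu>)
      \<le> ennreal (\<Sum>i<N. lam i * (\<integral>z. dist (fst z) (snd z) \<partial>(\<gamma> i)))"
    by (rule sum_W1_le) auto
  have "\<forall>i. \<exists>g. i < N \<longrightarrow> g \<in> couplings (\<nu>s i) \<nu> \<and> W1 (\<nu>s i) \<nu> = ennreal (\<integral>z. dist (fst z) (snd z) \<partial>g)"
  proof
    fix i
    show "\<exists>g. i < N \<longrightarrow> g \<in> couplings (\<nu>s i) \<nu> \<and> W1 (\<nu>s i) \<nu> = ennreal (\<integral>z. dist (fst z) (snd z) \<partial>g)"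
    proof (cases "i < N")
      case True
      obtain g where "g \<in> couplings (\<nu>s i) \<nu>" "W1 (\<nu>s i) \<nu> = ennreal (\<integral>z. dist (fst z) (snd z) \<partial>g)"
        by (rule W1_optimal_coupling[OF \<Omega> \<nu>s[OF True] \<nu>])
      then show ?thesis by auto
    qed simp
  qed
  then obtain g where *: "\<forall>i. i < N \<longrightarrow> g i \<in> couplings (\<nu>s i) \<nu> \<and>
      W1 (\<nu>s i) \<nu> = ennreal (\<integral>z. dist (fst z) (snd z) \<partial>(g i))"
    unfolding choice_iff ..
  have g: "g i \<in> couplings (\<nu>s i) \<nu>" and gW: "W1 (\<nu>s i) \<nu> = ennreal (\<integral>z. dist (fst z) (snd z) \<partial>(g i))"
    if "i < N" for i using * that by simp_all
  define d where "d i = (\<integral>z. dist (fst z) (snd z) \<partial>(g i))" for i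
  have "ennreal (\<Sum>i<N. lam i * d i) = (\<Sum>i<N. ennreal (lam i * d i))"
    using lam(1) by (intro sum_ennreal[symmetric]) (auto simp: d_def less_imp_le)
  also have "\<dots> = (\<Sum>i<N. ennreal (lam i) * W1 (\<nu>s i) \<nu>)"
    using lam(1) gW by (intro sum.cong) (auto simp: d_def ennreal_mult less_imp_le)
  also have "\<dots> \<le> (\<Sum>i<N. ennreal (lam i) * W1 (\<nu>s i) \<mu>)"
    using med \<mu> by (simp add: Med_def)
  also have "\<dots> \<le> ennreal (\<Sum>i<N. lam i * (\<integral>z. dist (fst z) (snd z) \<partial>(\<gamma> i)))" by (rule 1)
  finally have "(\<Sum>i<N. lam i * d i) \<le> (\<Sum>i<N. lam i * (\<integral>z. dist (fst z) (snd z) \<partial>(\<gamma> i)))"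
    using lam(1) by (subst (asm) ennreal_le_iff) (auto intro!: sum_nonneg mult_nonneg_nonneg simp: less_imp_le)
  with le have tot: "(\<Sum>i<N. lam i * d i) \<le> (\<Sum>i<N. lam i * integral\<^sup>L (\<nu>s i) (u i))" by linarith
  \<comment> \<open>The weighted defect of \<open>u i\<close> as a Kantorovich potential for the
    i-th pair. Every defect is nonnegative, while their sum is at most the integral of the slack
    against \<nu>, which is nonpositive; so all defects and the slack integral are zero.\<close>
  define a where "a i = lam i * (d i - (integral\<^sup>L (\<nu>s i) (u i) - integral\<^sup>L \<nu> (u i)))" for i
  have a0: "0 \<le> a i" if i: "i < N" for i
  proof -
    have "1-lipschitz_on UNIV (u i)" using u(1) i by simp
    from lipschitz_integral_le_coupling[OF g[OF i] \<nu>s[OF i] \<nu> \<Omega> this]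
    show ?thesis using lam(1)[OF i] by (simp add: a_def d_def)
  qed
  have "(\<Sum>i<N. a i) = (\<Sum>i<N. lam i * d i) - (\<Sum>i<N. lam i * integral\<^sup>L (\<nu>s i) (u i))
      + (\<Sum>i<N. lam i * integral\<^sup>L \<nu> (u i))"
    unfolding a_def sum_subtractf[symmetric] sum.distrib[symmetric]
    by (intro sum.cong refl) (simp add: algebra_simps)
  then have "(\<Sum>i<N. a i) \<le> (\<Sum>i<N. lam i * integral\<^sup>L \<nu> (u i))" using tot by linarith
  moreover have "(\<Sum>i<N. lam i * integral\<^sup>L \<nu> (u i)) \<le> 0" by (rule potentials_integral_le(1)[OF pot \<nu>])
  moreover have "0 \<le> (\<Sum>i<N. a i)" by (intro sum_nonneg) (simp add: a0)
  ultimately have z: "(\<Sum>i<N. lam i * integral\<^sup>L \<nu> (u i)) = 0" and "(\<Sum>i<N. a i) = 0" by linarith+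
  then have az: "a i = 0" if "i < N" for i
    using that sum_nonneg_eq_0_iff[of "{..<N}" a] a0 by auto
  have "\<forall>i. \<exists>\<rho>. i < N \<longrightarrow> \<rho> \<in> fmeas_on \<Omega> \<and> MK_system \<Omega> (u i) \<rho> (\<nu>s i) \<nu>"
  proof
    fix i
    show "\<exists>\<rho>. i < N \<longrightarrow> \<rho> \<in> fmeas_on \<Omega> \<and> MK_system \<Omega> (u i) \<rho> (\<nu>s i) \<nu>"
    proof (cases "i < N")
      case True
      have "(\<integral>z. dist (fst z) (snd z) \<partial>(g i)) = integral\<^sup>L (\<nu>s i) (u i) - integral\<^sup>L \<nu> (u i)"
        using az[OF True] lam(1)[OF True] by (simp add: a_def d_def)
      moreover have "1-lipschitz_on UNIV (u i)" using u(1) True by simp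
      ultimately show ?thesis
        using MK_system_of_optimal_plan[OF \<Omega> cvx \<nu>s[OF True] \<nu> g[OF True]] by auto
    qed simp
  qed
  then obtain \<rho> where "\<forall>i. i < N \<longrightarrow> \<rho> i \<in> fmeas_on \<Omega> \<and> MK_system \<Omega> (u i) (\<rho> i) (\<nu>s i) \<nu>"
    unfolding choice_iff ..
  then show ?thesis
    using pot potentials_integral_le(3)[OF pot \<nu> z] by (intro exI[of _ u] exI[of _ \<rho>]) simp
qed

text \<open>The extension is made componentwise and changes neither constraint nor value, because
  (D) sees the potentials only on \<Omega>.\<close>

lemma ex_potentials_extension:
  assumes "feasible_D \<Omega> N lam u"
  shows "\<exists>v. potentials v \<and> (\<forall>i<N. \<forall>x\<in>\<Omega>. v i x = u i x) \<and> dual_value v = value_D \<Omega> N lam \<nu>s u"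
proof -
  have N: "N > 0" using lam(2) by (cases N) auto
  have ne: "\<Omega> \<noteq> {}" by (rule prob_on_nonempty[OF \<nu>s[OF N]])
  have "\<forall>i. \<exists>v. i < N \<longrightarrow> 1-lipschitz_on UNIV v \<and> (\<forall>x\<in>\<Omega>. v x = u i x)"
    using lipschitz_extension[OF _ \<Omega> ne] assms by (simp add: feasible_D_def)
  then obtain v where *: "\<forall>i. i < N \<longrightarrow> 1-lipschitz_on UNIV (v i) \<and> (\<forall>x\<in>\<Omega>. v i x = u i x)"
    unfolding choice_iff ..
  then have vu: "v i x = u i x" if "i < N" "x \<in> \<Omega>" for i x using that by simp
  have "(\<Sum>i<N. lam i * v i x) \<le> 0" if x: "x \<in> \<Omega>" for x
  proof -
    have "(\<Sum>i<N. lam i * v i x) = (\<Sum>i<N. lam i * u i x)"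
      using vu x by (intro sum.cong) auto
    then show ?thesis using assms x by (simp add: feasible_D_def)
  qed
  then have "potentials v" using * by (simp add: potentials_def)
  moreover have "dual_value v = value_D \<Omega> N lam \<nu>s u"
    unfolding dual_value_def value_D_def
  proof (rule sum.cong[OF refl])
    fix i assume "i \<in> {..<N}"
    then have i: "i < N" by simp
    have "continuous_on UNIV (v i)" by (rule lipschitz_on_UNIV_continuous[of 1]) (use * i in simp)
    from set_integral_prob_on[OF \<nu>s[OF i] \<Omega> this vu[OF i]]
    show "lam i * integral\<^sup>L (\<nu>s i) (v i) = lam i * (LINT x:\<Omega>|\<nu>s i. u i x)" by simp
  qed
  ultimately show ?thesis using vu by (intro exI[of _ v]) simp
qed

end

theorem theorem6p2:
  fixes \<Omega> :: "'a::euclidean_space set" and N :: nat and lam :: "nat \<Rightarrow> real"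
    and \<nu>s :: "nat \<Rightarrow> 'a measure" and \<nu> :: "'a measure"
  assumes "convex \<Omega>" "compact \<Omega>" "interior \<Omega> \<noteq> {}"
    and "\<forall>i<N. lam i > 0" "(\<Sum>i<N. lam i) = 1"
    and "\<forall>i<N. \<nu>s i \<in> prob_on \<Omega>" "\<nu> \<in> prob_on \<Omega>"
  shows "(\<nu> \<in> Med \<Omega> N lam \<nu>s \<longleftrightarrow>
          (\<exists>u \<rho>. (\<forall>i<N. 1-lipschitz_on \<Omega> (u i) \<and> \<rho> i \<in> fmeas_on \<Omega> \<and>
                          MK_system \<Omega> (u i) (\<rho> i) (\<nu>s i) \<nu>) \<and>
                  (\<forall>x\<in>\<Omega>. (\<Sum>i<N. lam i * u i x) \<le> 0) \<and>
                  (\<forall>x\<in>spt \<nu>. (\<Sum>i<N. lam i * u i x) = 0)))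
       \<and> (\<forall>u \<rho> s. (\<forall>i<N. 1-lipschitz_on \<Omega> (u i) \<and> \<rho> i \<in> fmeas_on \<Omega> \<and>
                          MK_witness \<Omega> (u i) (\<rho> i) (\<nu>s i) \<nu> (s i)) \<and>
                  (\<forall>x\<in>\<Omega>. (\<Sum>i<N. lam i * u i x) \<le> 0) \<and>
                  (\<forall>x\<in>spt \<nu>. (\<Sum>i<N. lam i * u i x) = 0)
             \<longrightarrow> solves_D \<Omega> N lam \<nu>s u \<and> solves_B \<Omega> N lam \<nu>s (\<lambda>i. (\<rho> i, s i)) \<nu>)"
proof -
  interpret median_setting \<Omega> N lam \<nu>s
    by unfold_locales (use assms in auto)
  have \<nu>: "\<nu> \<in> prob_on \<Omega>" by fact
  \<comment> \<open>One certificate serves both the converse implication and the final claim. It is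
    built from extended potentials, which keep the support condition because the support of \<nu>
    lies in \<Omega>.\<close>
  have key: "\<nu> \<in> Med \<Omega> N lam \<nu>s \<and> solves_D \<Omega> N lam \<nu>s u \<and> solves_B \<Omega> N lam \<nu>s (\<lambda>i. (\<rho> i, s i)) \<nu>"
    if MK: "\<forall>i<N. 1-lipschitz_on \<Omega> (u i) \<and> \<rho> i \<in> fmeas_on \<Omega> \<and> MK_witness \<Omega> (u i) (\<rho> i) (\<nu>s i) \<nu> (s i)"
      and u: "\<forall>x\<in>\<Omega>. (\<Sum>i<N. lam i * u i x) \<le> 0" "\<forall>x\<in>spt \<nu>. (\<Sum>i<N. lam i * u i x) = 0"
    for u \<rho> s
  proof -
    have fD: "feasible_D \<Omega> N lam u" using MK u(1) by (simp add: feasible_D_def)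
    from ex_potentials_extension[OF fD] obtain v where v: "potentials v"
      and vu: "\<forall>i<N. \<forall>x\<in>\<Omega>. v i x = u i x" and val: "dual_value v = value_D \<Omega> N lam \<nu>s u" by auto
    have \<rho>: "\<rho> i \<in> fmeas_on \<Omega>" if "i < N" for i using MK that by simp
    have MKv: "MK_witness \<Omega> (v i) (\<rho> i) (\<nu>s i) \<nu> (s i)" if i: "i < N" for i
      by (rule MK_witness_cong[of \<Omega> "u i"]) (use MK vu i in auto)
    have spt: "\<forall>x\<in>spt \<nu>. (\<Sum>i<N. lam i * v i x) = 0"
    proof
      fix x assume x: "x \<in> spt \<nu>"
      then have "x \<in> \<Omega>" using spt_subset[OF \<nu> closed_\<Omega>] by auto
      then have "(\<Sum>i<N. lam i * v i x) = (\<Sum>i<N. lam i * u i x)"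
        using vu by (intro sum.cong) auto
      then show "(\<Sum>i<N. lam i * v i x) = 0" using u(2) x by simp
    qed
    note cert = MK_certificate[OF v \<nu> \<rho> MKv spt]
    have "\<nu> \<in> Med \<Omega> N lam \<nu>s"
      unfolding Med_def using \<nu> order_trans[OF cert(3) dual_value_le_W1[OF v]] by simp
    \<comment> \<open>The flows of the certificate act as the intermediary: any competitor in (D) is
      bounded by their cost, and that cost by the value of u.\<close>
    moreover have "value_D \<Omega> N lam \<nu>s w \<le> value_D \<Omega> N lam \<nu>s u" if w: "feasible_D \<Omega> N lam w" for w
    proof -
      from ex_potentials_extension[OF w] obtain w' where "potentials w'"
        "dual_value w' = value_D \<Omega> N lam \<nu>s w" by auto
      with dual_value_le_flow[OF _ cert(1), of w'] cert(2) val show ?thesis by simp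
    qed
    moreover have "cost_B N lam (\<lambda>i. (\<rho> i, s i)) \<le> cost_B N lam \<sigma>" if "feasible_B \<Omega> N \<nu>s \<sigma> \<mu>" for \<sigma> \<mu>
      using dual_value_le_flow[OF v that] cert(2) by simp
    ultimately show ?thesis using fD cert(1) by (simp add: solves_D_def solves_B_def)
  qed
  show ?thesis
  proof (intro conjI iffI allI impI)
    assume "\<nu> \<in> Med \<Omega> N lam \<nu>s"
    from ex_MK_certificate[OF assms(1) this] obtain v \<rho> where
      "potentials v" "\<forall>i<N. \<rho> i \<in> fmeas_on \<Omega> \<and> MK_system \<Omega> (v i) (\<rho> i) (\<nu>s i) \<nu>"
      "\<forall>x\<in>spt \<nu>. (\<Sum>i<N. lam i * v i x) = 0" by auto
    then show "\<exists>u \<rho>. (\<forall>i<N. 1-lipschitz_on \<Omega> (u i) \<and> \<rho> i \<in> fmeas_on \<Omega> \<and>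
                          MK_system \<Omega> (u i) (\<rho> i) (\<nu>s i) \<nu>) \<and>
                  (\<forall>x\<in>\<Omega>. (\<Sum>i<N. lam i * u i x) \<le> 0) \<and>
                  (\<forall>x\<in>spt \<nu>. (\<Sum>i<N. lam i * u i x) = 0)"
      by (intro exI[of _ v] exI[of _ \<rho>])
         (auto simp: potentials_def intro: lipschitz_on_subset[OF _ subset_UNIV])
  next
    assume "\<exists>u \<rho>. (\<forall>i<N. 1-lipschitz_on \<Omega> (u i) \<and> \<rho> i \<in> fmeas_on \<Omega> \<and>
                          MK_system \<Omega> (u i) (\<rho> i) (\<nu>s i) \<nu>) \<and>
                  (\<forall>x\<in>\<Omega>. (\<Sum>i<N. lam i * u i x) \<le> 0) \<and>
                  (\<forall>x\<in>spt \<nu>. (\<Sum>i<N. lam i * u i x) = 0)"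
    then obtain u \<rho> where u: "\<forall>i<N. 1-lipschitz_on \<Omega> (u i) \<and> \<rho> i \<in> fmeas_on \<Omega> \<and>
        MK_system \<Omega> (u i) (\<rho> i) (\<nu>s i) \<nu>"
      "\<forall>x\<in>\<Omega>. (\<Sum>i<N. lam i * u i x) \<le> 0" "\<forall>x\<in>spt \<nu>. (\<Sum>i<N. lam i * u i x) = 0" by auto
    have "\<forall>i. \<exists>s. i < N \<longrightarrow> MK_witness \<Omega> (u i) (\<rho> i) (\<nu>s i) \<nu> s"
      using u(1) by (simp add: MK_system_def)
    then obtain s where "\<forall>i. i < N \<longrightarrow> MK_witness \<Omega> (u i) (\<rho> i) (\<nu>s i) \<nu> (s i)"
      unfolding choice_iff ..
    then show "\<nu> \<in> Med \<Omega> N lam \<nu>s" using key[of u \<rho> s] u by simp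
  qed ((elim conjE, drule (2) key, simp)+)
qed

end
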